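(* Let $G\subset\mathbb{Z}^d/(2\mathbb{Z}^d)$ be a separable group with $k$ generators, thus of order $2^k$. Let $g\in L^2(\mathbb{R}^d)$ and let $N$ be a subset of $\mathbb{Z}^d$ such that $|N\cap\mathrm{orbit}(x)|=1$ for all $x\in\mathbb{Z}^d$. For each $\gamma\in N$ set $c_\gamma=2^{-k}|\mathrm{orbit}(\gamma)|^{1/2}$. Consider the Gabor system $$\mathcal{G}(g,G)=\{T_\lambda M_\gamma g\}_{\lambda\in\frac12\Lambda,\ \gamma\in\mathbb{Z}^d},\qquad \Lambda=\bigcup_{\sigma\in G}(\sigma+2\mathbb{Z}^d),$$ and the Wilson system $$\mathcal{W}(g,G)=\Big\{T_\lambda T_{\frac12h}\,c_\gamma\sum_{\sigma\in G}(-1)^{\langle I(h)+\gamma,\sigma\rangle}M_{R_\sigma\gamma}g\Big\}_{\lambda\in\mathbb{Z}^d,\ h\in G,\ \gamma\in N},$$ where those members of the family $\mathcal{W}(g,G)$ that are the zero function are disregarded (removed). If $g$ is separable with respect to $G$ and $\hat g(\omega)=\overline{\hat g(\omega)}$ for a.e. $\omega\in\mathbb{R}^d$, then the following holds: (i) The Gabor system $\mathcal{G}(g,G)$ is a Bessel sequence with bound $b$ if and only if the Wilson system $\mathcal{W}(g,G)$ is a Bessel sequence with bound $2^{-k}b$. In either (and hence both) cases the frame operator $S_{\mathcal{G}}$ of $\mathcal{G}(g,G)$ and the frame operator $S_{\mathcal{W}}$ of $\mathcal{W}(g,G)$ satisfy $S_{\mathcal{G}}=2^kS_{\mathcal{W}}$.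 (ii) The Gabor system $\mathcal{G}(g,G)$ is a frame for $L^2(\mathbb{R}^d)$ with bounds $a$ and $b$ if and only if the Wilson system $\mathcal{W}(g,G)$ is a Riesz basis for $L^2(\mathbb{R}^d)$ with bounds $2^{-k}a$ and $2^{-k}b$. (iii) The Gabor system $\mathcal{G}(g,G)$ is a tight frame for $L^2(\mathbb{R}^d)$ with frame bound $2^k$ if and only if the Wilson system $\mathcal{W}(g,G)$ is an orthonormal basis for $L^2(\mathbb{R}^d)$.
   Context: Operators: $T_\lambda f(x)=f(x-\lambda)$, $M_\gamma f(x)=e^{2\pi i\langle x,\gamma\rangle}f(x)$ for $\lambda,\gamma\in\mathbb{R}^d$; $\hat f$ is the unitary extension to $L^2(\mathbb{R}^d)$ of $\hat f(\omega)=\int f(x)e^{-2\pi i\langle\omega,x\rangle}dx$. Reflections: for $\sigma\in\mathbb{Z}^d$, $R_\sigma:\mathbb{R}^d\to\mathbb{R}^d$, $R_\sigma x=((-1)^{\sigma_1}x_1,\dots,(-1)^{\sigma_d}x_d)$. It depends only on $\sigma$ mod $2\mathbb{Z}^d$, so $R_\sigma$ is defined for $\sigma\in\mathbb{Z}^d/(2\mathbb{Z}^d)$; elements of this group are identified with coset representatives in $\{0,1\}^d$. For a subgroup $G\subset\mathbb{Z}^d/(2\mathbb{Z}^d)$, $\mathrm{orbit}(x)=\{R_\sigma x:\sigma\in G\}$. Separable groups: $[d]=\{1,\dots,d\}$ and $\mathrm{supp}\,\sigma=\{i\in[d]:\sigma_i\equiv1\bmod2\}$. A subgroup $G$ is separable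 if it has generators $\sigma^1,\dots,\sigma^k$ with $\mathrm{supp}\,\sigma^i\cap\mathrm{supp}\,\sigma^j=\emptyset$ for $i\ne j$; the sets $S_i=\mathrm{supp}\,\sigma^i$ are taken non-empty, and $S_0=[d]\setminus\bigcup_{i=1}^kS_i$ (possibly empty). The trivial group corresponds to $k=0$. Separable functions: for $S=\{s_1<\dots<s_m\}\subset[d]$, $P_S:\mathbb{R}^d\to\mathbb{R}^m$, $P_S(x)=(x_{s_1},\dots,x_{s_m})$. A function $g:\mathbb{R}^d\to\mathbb{C}$ is separable with respect to $G$ if there are functions $g_i:\mathbb{R}^{|S_i|}\to\mathbb{C}$, $i=0,\dots,k$, with $g(x)=\prod_{i=0}^kg_i(P_{S_i}x)$ (if $S_0=\emptyset$, $g_0$ is a constant). Dual group and $I$: for the lattice $\Lambda=\bigcup_{\sigma\in G}(\sigma+2\mathbb{Z}^d)$, the dual lattice is $\Lambda^\perp=\{\beta\in\mathbb{R}^d:\langle\beta,\lambda\rangle\in\mathbb{Z}\ \forall\lambda\in\Lambda\}$. The dual group $\widehat G$ is identified with $\mathbb{Z}^d/(2\Lambda^\perp)$ through the pairing $(-1)^{\langle\alpha,\sigma\rangle}$, $\alpha\in\mathbb{Z}^d$, $\sigma\in\Lambda$; thus $\langle\alpha,\sigma\rangle$ mod 2 is well defined for $\alpha\in\mathbb{Z}^d/(2\Lambda^\perp)$, $\sigma\in G$. $I:G\to\widehat G$ is the group isomorphism determined by $\langle I(\sigma^i),\sigma^j\rangle\equiv\delta_{i,j}\bmod2$; explicitly,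 choosing $n_i\in S_i$, $I(\sigma^i)$ is the class of the standard basis vector $\delta_{n_i}$. Elements of $\widehat G$ are identified with a fixed choice of representatives in $\mathbb{Z}^d$. Frame theory: families are indexed by the displayed index sets. A countable family $\{f_j\}$ in $L^2(\mathbb{R}^d)$ is a Bessel sequence with bound $b$ if $\sum_j|\langle f,f_j\rangle|^2\le b\|f\|^2$ for all $f$; its frame operator is $Sf=\sum_j\langle f,f_j\rangle f_j$. It is a frame with bounds $a,b>0$ if $a\|f\|^2\le\sum_j|\langle f,f_j\rangle|^2\le b\|f\|^2$ for all $f$; tight with bound $a$ if equality holds with $a=b$. It is a Riesz basis with bounds $a,b>0$ if its span is dense and $a\sum|c_j|^2\le\|\sum c_jf_j\|^2\le b\sum|c_j|^2$ for all finitely supported $(c_j)$. *)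

theory Defs
  imports
    "HOL-Analysis.Analysis"
    "HOL-Algebra.Coset"
    "HOL-Algebra.Generated_Groups"
    "HOL-Library.Z2"
begin

section \<open>The space of square integrable functions\<close>

text \<open>
  Elements of the complex space $L^2$ are represented by Borel measurable functions;
  equality in $L^2$ is equality almost everywhere.
\<close>

definition L2 :: "('a::euclidean_space \<Rightarrow> complex) set" where
  "L2 = {f \<in> borel_measurable lborel. integrable lborel (\<lambda>x. (cmod (f x))\<^sup>2)}"

definition l2_inner :: "('a::euclidean_space \<Rightarrow> complex) \<Rightarrow> ('a \<Rightarrow> complex) \<Rightarrow> complex" where
  "l2_inner f h = (LINT x|lborel. f x * cnj (h x))"

definition l2_norm :: "('a::euclidean_space \<Rightarrow> complex) \<Rightarrow> real" where
  "l2_norm f = sqrt (LINT x|lborel. (cmod (f x))\<^sup>2)"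

definition fourier_integral ::
    "('a::euclidean_space \<Rightarrow> complex) \<Rightarrow> 'a \<Rightarrow> complex" where
  "fourier_integral f \<omega> = (LINT x|lborel. f x * exp (- (2 * pi * (\<omega> \<bullet> x)) * \<i>))"

text \<open>
  \<open>has_fourier_L2 f h\<close> says that \<open>h\<close> is (a representative of) the Fourier transform of \<open>f\<close>:
  this relation is the closure in $L^2 \times L^2$ of the graph of the Fourier integral on
  $L^1 \cap L^2$, which is the graph of its unitary extension to $L^2$.
\<close>

definition has_fourier_L2 ::
    "('a::euclidean_space \<Rightarrow> complex) \<Rightarrow> ('a \<Rightarrow> complex) \<Rightarrow> bool" where
  "has_fourier_L2 f h \<longleftrightarrow> f \<in> L2 \<and> h \<in> L2 \<and>
     (\<exists>u :: nat \<Rightarrow> 'a \<Rightarrow> complex.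
        (\<forall>n. u n \<in> L2 \<and> integrable lborel (u n) \<and> fourier_integral (u n) \<in> L2) \<and>
        (\<lambda>n. l2_norm (\<lambda>x. u n x - f x)) \<longlonglongrightarrow> 0 \<and>
        (\<lambda>n. l2_norm (\<lambda>\<omega>. fourier_integral (u n) \<omega> - h \<omega>)) \<longlonglongrightarrow> 0)"

definition translate :: "'a::euclidean_space \<Rightarrow> ('a \<Rightarrow> complex) \<Rightarrow> 'a \<Rightarrow> complex" where
  "translate l f x = f (x - l)"

definition modulate :: "'a::euclidean_space \<Rightarrow> ('a \<Rightarrow> complex) \<Rightarrow> 'a \<Rightarrow> complex" where
  "modulate \<gamma> f x = exp ((2 * pi * (x \<bullet> \<gamma>)) * \<i>) * f x"


section \<open>Bessel sequences, frames and bases\<close>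

text \<open>A family is a function together with its index set, so repeated members count.\<close>

definition L2_family :: "'j set \<Rightarrow> ('j \<Rightarrow> 'a::euclidean_space \<Rightarrow> complex) \<Rightarrow> bool" where
  "L2_family J \<phi> \<longleftrightarrow> countable J \<and> (\<forall>j\<in>J. \<phi> j \<in> L2)"

definition bessel_bound ::
    "'j set \<Rightarrow> ('j \<Rightarrow> 'a::euclidean_space \<Rightarrow> complex) \<Rightarrow> real \<Rightarrow> bool" where
  "bessel_bound J \<phi> b \<longleftrightarrow> L2_family J \<phi> \<and>
     (\<forall>f\<in>L2. (\<lambda>j. (cmod (l2_inner f (\<phi> j)))\<^sup>2) summable_on J \<and>
        (\<Sum>\<^sub>\<infinity>j\<in>J. (cmod (l2_inner f (\<phi> j)))\<^sup>2) \<le> b * (l2_norm f)\<^sup>2)"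

definition frame_bounds ::
    "'j set \<Rightarrow> ('j \<Rightarrow> 'a::euclidean_space \<Rightarrow> complex) \<Rightarrow> real \<Rightarrow> real \<Rightarrow> bool" where
  "frame_bounds J \<phi> a b \<longleftrightarrow> L2_family J \<phi> \<and> 0 < a \<and> 0 < b \<and>
     (\<forall>f\<in>L2. (\<lambda>j. (cmod (l2_inner f (\<phi> j)))\<^sup>2) summable_on J \<and>
        a * (l2_norm f)\<^sup>2 \<le> (\<Sum>\<^sub>\<infinity>j\<in>J. (cmod (l2_inner f (\<phi> j)))\<^sup>2) \<and>
        (\<Sum>\<^sub>\<infinity>j\<in>J. (cmod (l2_inner f (\<phi> j)))\<^sup>2) \<le> b * (l2_norm f)\<^sup>2)"

definition tight_frame_bound ::
    "'j set \<Rightarrow> ('j \<Rightarrow> 'a::euclidean_space \<Rightarrow> complex) \<Rightarrow> real \<Rightarrow> bool" where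
  "tight_frame_bound J \<phi> a \<longleftrightarrow> frame_bounds J \<phi> a a"

text \<open>Unconditional convergence of a series in the $L^2$ norm.\<close>

definition has_L2_sum ::
    "'j set \<Rightarrow> ('j \<Rightarrow> 'a::euclidean_space \<Rightarrow> complex) \<Rightarrow> ('a \<Rightarrow> complex) \<Rightarrow> bool" where
  "has_L2_sum J \<phi> s \<longleftrightarrow> s \<in> L2 \<and>
     ((\<lambda>F. l2_norm (\<lambda>x. s x - (\<Sum>j\<in>F. \<phi> j x))) \<longlongrightarrow> 0) (finite_subsets_at_top J)"

definition is_frame_operator ::
    "'j set \<Rightarrow> ('j \<Rightarrow> 'a::euclidean_space \<Rightarrow> complex)
       \<Rightarrow> (('a \<Rightarrow> complex) \<Rightarrow> ('a \<Rightarrow> complex)) \<Rightarrow> bool" where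
  "is_frame_operator J \<phi> S \<longleftrightarrow>
     (\<forall>f\<in>L2. has_L2_sum J (\<lambda>j x. l2_inner f (\<phi> j) * \<phi> j x) (S f))"

definition dense_span :: "'j set \<Rightarrow> ('j \<Rightarrow> 'a::euclidean_space \<Rightarrow> complex) \<Rightarrow> bool" where
  "dense_span J \<phi> \<longleftrightarrow>
     (\<forall>f\<in>L2. \<forall>\<epsilon>>0. \<exists>F c. finite F \<and> F \<subseteq> J \<and>
        l2_norm (\<lambda>x. f x - (\<Sum>j\<in>F. c j * \<phi> j x)) < \<epsilon>)"

definition riesz_basis_bounds ::
    "'j set \<Rightarrow> ('j \<Rightarrow> 'a::euclidean_space \<Rightarrow> complex) \<Rightarrow> real \<Rightarrow> real \<Rightarrow> bool" where
  "riesz_basis_bounds J \<phi> a b \<longleftrightarrow> L2_family J \<phi> \<and> 0 < a \<and> 0 < b \<and> dense_span J \<phi> \<and>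
     (\<forall>F c. finite F \<longrightarrow> F \<subseteq> J \<longrightarrow>
        a * (\<Sum>j\<in>F. (cmod (c j))\<^sup>2) \<le> (l2_norm (\<lambda>x. \<Sum>j\<in>F. c j * \<phi> j x))\<^sup>2 \<and>
        (l2_norm (\<lambda>x. \<Sum>j\<in>F. c j * \<phi> j x))\<^sup>2 \<le> b * (\<Sum>j\<in>F. (cmod (c j))\<^sup>2))"

definition orthonormal_basis ::
    "'j set \<Rightarrow> ('j \<Rightarrow> 'a::euclidean_space \<Rightarrow> complex) \<Rightarrow> bool" where
  "orthonormal_basis J \<phi> \<longleftrightarrow> L2_family J \<phi> \<and> dense_span J \<phi> \<and>
     (\<forall>i\<in>J. \<forall>j\<in>J. l2_inner (\<phi> i) (\<phi> j) = of_bool (i = j))"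


section \<open>Subgroups of $\mathbb{Z}^d / 2\mathbb{Z}^d$, reflections and lattices\<close>

text \<open>
  The dimension is \<open>d = CARD('d)\<close> and \<open>bit ^ 'd\<close> is the group $\mathbb{Z}^d / 2\mathbb{Z}^d$;
  \<open>bit_rep\<close> picks the coset representative in $\{0,1\}^d$.
\<close>

definition bit_rep :: "bit ^ 'd \<Rightarrow> int ^ 'd" where
  "bit_rep \<sigma> = (\<chi> i. of_bit (\<sigma> $ i))"

definition real_vec :: "int ^ 'd \<Rightarrow> real ^ 'd" where
  "real_vec \<alpha> = (\<chi> i. real_of_int (\<alpha> $ i))"

definition add_grp :: "'a::ab_group_add set \<Rightarrow> 'a monoid" where
  "add_grp A = \<lparr>carrier = A, mult = (+), one = 0\<rparr>"

definition reflect :: "bit ^ 'd \<Rightarrow> 'a::ring_1 ^ 'd \<Rightarrow> 'a ^ 'd" where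
  "reflect \<sigma> x = (\<chi> i. (- 1) ^ of_bit (\<sigma> $ i) * x $ i)"

definition orbit :: "(bit ^ 'd) set \<Rightarrow> 'a::ring_1 ^ 'd \<Rightarrow> ('a ^ 'd) set" where
  "orbit G x = {reflect \<sigma> x | \<sigma>. \<sigma> \<in> G}"

definition supp :: "bit ^ 'd \<Rightarrow> 'd set" where
  "supp \<sigma> = {i. \<sigma> $ i = 1}"

text \<open>\<open>s 1, \<dots>, s k\<close> are the generators \<open>\<sigma>\<^sup>1, \<dots>, \<sigma>\<^sup>k\<close>.\<close>

definition separable_group :: "(bit ^ 'd) set \<Rightarrow> nat \<Rightarrow> (nat \<Rightarrow> bit ^ 'd) \<Rightarrow> bool" where
  "separable_group G k s \<longleftrightarrow>
     subgroup G (add_grp UNIV) \<and>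
     G = generate (add_grp UNIV) (s ` {1..k}) \<and>
     (\<forall>i\<in>{1..k}. supp (s i) \<noteq> {}) \<and>
     (\<forall>i\<in>{1..k}. \<forall>j\<in>{1..k}. i \<noteq> j \<longrightarrow> supp (s i) \<inter> supp (s j) = {})"

definition block :: "nat \<Rightarrow> (nat \<Rightarrow> bit ^ 'd) \<Rightarrow> nat \<Rightarrow> 'd set" where
  "block k s i = (if i = 0 then UNIV - (\<Union>j\<in>{1..k}. supp (s j)) else supp (s i))"

text \<open>
  The space $\mathbb{R}^{|S|}$ is identified with the functions on the index set \<open>S\<close>
  (extended by \<open>undefined\<close>), so \<open>proj S\<close> is the projection $P_S$.
\<close>

definition proj :: "'d set \<Rightarrow> real ^ 'd \<Rightarrow> 'd \<Rightarrow> real" where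
  "proj S x = restrict (\<lambda>i. x $ i) S"

definition separable_fun :: "nat \<Rightarrow> (nat \<Rightarrow> bit ^ 'd) \<Rightarrow> (real ^ 'd \<Rightarrow> complex) \<Rightarrow> bool" where
  "separable_fun k s g \<longleftrightarrow>
     (\<exists>gs :: nat \<Rightarrow> ('d \<Rightarrow> real) \<Rightarrow> complex.
        \<forall>x. g x = (\<Prod>i\<in>{0..k}. gs i (proj (block k s i) x)))"

definition lattice :: "(bit ^ 'd) set \<Rightarrow> (real ^ 'd) set" where
  "lattice G = (\<Union>\<sigma>\<in>G. {real_vec (bit_rep \<sigma>) + 2 *\<^sub>R real_vec n | n. True})"

definition dual_lattice :: "(real ^ 'd) set \<Rightarrow> (real ^ 'd) set" where
  "dual_lattice L = {\<beta>. \<forall>l\<in>L. \<beta> \<bullet> l \<in> \<int>}"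

text \<open>The group $2\Lambda^\perp$, as a subset of $\mathbb{Z}^d$.\<close>

definition twice_dual :: "(bit ^ 'd) set \<Rightarrow> (int ^ 'd) set" where
  "twice_dual G = {\<alpha>. \<exists>\<beta>\<in>dual_lattice (lattice G). real_vec \<alpha> = 2 *\<^sub>R \<beta>}"

definition dual_group :: "(bit ^ 'd) set \<Rightarrow> (int ^ 'd) set monoid" where
  "dual_group G = add_grp UNIV Mod twice_dual G"

text \<open>Only the parity of \<open>pairing \<alpha> \<sigma>\<close> is independent of the representative of \<open>\<sigma>\<close>.\<close>

definition pairing :: "int ^ 'd \<Rightarrow> bit ^ 'd \<Rightarrow> int" where
  "pairing \<alpha> \<sigma> = (\<Sum>i\<in>UNIV. \<alpha> $ i * bit_rep \<sigma> $ i)"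

definition is_dual_iso ::
    "(bit ^ 'd) set \<Rightarrow> nat \<Rightarrow> (nat \<Rightarrow> bit ^ 'd) \<Rightarrow> (bit ^ 'd \<Rightarrow> (int ^ 'd) set) \<Rightarrow> bool" where
  "is_dual_iso G k s I \<longleftrightarrow>
     I \<in> iso (add_grp G) (dual_group G) \<and>
     (\<forall>i\<in>{1..k}. \<forall>j\<in>{1..k}. \<forall>\<alpha>\<in>I (s i). pairing \<alpha> (s j) mod 2 = of_bool (i = j))"


section \<open>The Gabor and Wilson systems\<close>

definition gabor_index :: "(bit ^ 'd) set \<Rightarrow> ((real ^ 'd) \<times> (int ^ 'd)) set" where
  "gabor_index G = {(1/2) *\<^sub>R l | l. l \<in> lattice G} \<times> UNIV"

definition gabor ::
    "(real ^ 'd \<Rightarrow> complex) \<Rightarrow> (real ^ 'd) \<times> (int ^ 'd) \<Rightarrow> real ^ 'd \<Rightarrow> complex" where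
  "gabor g = (\<lambda>(l, \<gamma>). translate l (modulate (real_vec \<gamma>) g))"

text \<open>
  The function \<open>I\<close> has classes as values; \<open>\<rho>\<close> is the choice of their representatives in
  $\mathbb{Z}^d$.
\<close>

definition wilson ::
    "(bit ^ 'd) set \<Rightarrow> nat \<Rightarrow> (bit ^ 'd \<Rightarrow> (int ^ 'd) set) \<Rightarrow> ((int ^ 'd) set \<Rightarrow> int ^ 'd)
       \<Rightarrow> (real ^ 'd \<Rightarrow> complex)
       \<Rightarrow> (int ^ 'd) \<times> (bit ^ 'd) \<times> (int ^ 'd) \<Rightarrow> real ^ 'd \<Rightarrow> complex" where
  "wilson G k I \<rho> g = (\<lambda>(l, h, \<gamma>).
     translate (real_vec l) (translate ((1/2) *\<^sub>R real_vec (bit_rep h))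
       (\<lambda>x. complex_of_real (sqrt (real (card (orbit G \<gamma>))) / 2 ^ k) *
          (\<Sum>\<sigma>\<in>G. (- 1) powi pairing (\<rho> (I h) + \<gamma>) \<sigma> *
             modulate (real_vec (reflect \<sigma> \<gamma>)) g x))))"

text \<open>The members that vanish as elements of $L^2$ are removed.\<close>

definition wilson_index ::
    "(bit ^ 'd) set \<Rightarrow> nat \<Rightarrow> (bit ^ 'd \<Rightarrow> (int ^ 'd) set) \<Rightarrow> ((int ^ 'd) set \<Rightarrow> int ^ 'd)
       \<Rightarrow> (real ^ 'd \<Rightarrow> complex) \<Rightarrow> (int ^ 'd) set
       \<Rightarrow> ((int ^ 'd) \<times> (bit ^ 'd) \<times> (int ^ 'd)) set" where
  "wilson_index G k I \<rho> g N =
     {j \<in> UNIV \<times> G \<times> N. \<not> (AE x in lborel. wilson G k I \<rho> g j x = 0)}"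

end

theory Submission imports Defs "HOL-Probability.Characteristic_Functions" begin

text \<open>
  A real Fourier transform means \<open>g (- x) = cnj (g x)\<close>, and separability passes this symmetry to each
  factor of \<open>g\<close>. For a bounded \<open>f\<close> of bounded support, the energy of \<open>f\<close> in the Wilson system expands
  into diagonal terms, which add up to the Gabor energy, and cross terms indexed by \<open>\<tau> \<noteq> 0\<close> in \<open>G\<close>.
  Parseval's formula in the modulation index turns a cross term into a series of integrals of products
  of four translates of \<open>f\<close> and \<open>g\<close>. Exchanging the two arguments of \<open>g\<close> on one block contained in
  the support of \<open>\<tau>\<close> is an involution of the summation index that preserves the integral, by the
  symmetry of \<open>g\<close>, but reverses the sign given by \<open>I\<close>; hence the cross terms vanish, and (i) follows
  by density.

  If the Gabor system is a frame, let \<open>v\<close> be its canonical dual window. Testing the reconstruction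
  formula on the unit cube (the Wexler-Raz argument) shows that every member of the Wilson system of
  \<open>g\<close> has inner product \<open>0\<close> or \<open>1\<close> with its preimage under the Wilson frame operator. For a nonzero
  member it is \<open>1\<close>, which forces biorthogonality, so the Wilson frame is a Riesz basis. The converse
  needs only (i), as the bounds of a Riesz basis are frame bounds; (iii) is (ii) with equal bounds.
\<close>

section \<open>Frames in complex Hilbert spaces\<close>

text \<open>The energies are compared before any Bessel bound is known, so the convergence of every
  series must come from the test function. Its bounded support leaves boundedly many indices with a
  nonzero integrand at each point; this makes the cross terms absolutely summable, and only then may
  a series in the modulations be traded for one in \<open>n\<close> and its index set be permuted.
  The constants come from counting. The square of a sum over \<open>G\<close> has 2^k diagonal
  pairs, and the squared normalising factor of a Wilson member is its orbit length over 4^k: the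
  orbit length turns a sum over \<open>N\<close> into one over all frequencies, and 2^k / 4^k leaves
  the ratio 2^k of the two frame operators. Two frequencies in one orbit differ by a vector with
  even entries, on which every character of \<open>G\<close> is trivial; these differences are the
  only frequencies at which the reconstruction formula must give a Fourier coefficient of
  \<open>g\<close> times the conjugate of \<open>v\<close>. Unit cubes centred on half the lattice
  cover space 2^k times, hence the value 2^-k at frequency 0. Orbit length times stabilizer size is
  2^k, so a character sum over the stabilizer yields 0 or 1.\<close>

class complex_hilbert = real_inner + complete_space +
  fixes scaleC :: "complex \<Rightarrow> 'a \<Rightarrow> 'a" (infixr "*\<^sub>C" 75)
    and cinner :: "'a \<Rightarrow> 'a \<Rightarrow> complex"
  assumes scaleC_of_real: "complex_of_real r *\<^sub>C x = r *\<^sub>R x"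
    and scaleC_scaleC: "a *\<^sub>C b *\<^sub>C x = (a * b) *\<^sub>C x"
    and scaleC_add_left: "(a + b) *\<^sub>C x = a *\<^sub>C x + b *\<^sub>C x"
    and scaleC_add_right: "a *\<^sub>C (x + y) = a *\<^sub>C x + a *\<^sub>C y"
    and cinner_add_left: "cinner (x + y) z = cinner x z + cinner y z"
    and cinner_scaleC_left: "cinner (a *\<^sub>C x) y = a * cinner x y"
    and cnj_cinner: "cnj (cinner x y) = cinner y x"
    and Re_cinner: "Re (cinner x y) = inner x y"
begin

subclass banach ..

end

lemma cinner_add_right: "cinner (x::'h::complex_hilbert) (y + z) = cinner x y + cinner x z"
  by (metis cinner_add_left cnj_cinner complex_cnj_add)

lemma cinner_scaleC_right: "cinner (x::'h::complex_hilbert) (a *\<^sub>C y) = cnj a * cinner x y"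
  by (metis cinner_scaleC_left cnj_cinner complex_cnj_mult)

lemma cinner_scaleR_left: "cinner (r *\<^sub>R x) (y::'h::complex_hilbert) = of_real r * cinner x y"
  by (metis cinner_scaleC_left scaleC_of_real)

lemma scaleC_one [simp]: "1 *\<^sub>C (x::'h::complex_hilbert) = x"
  by (metis of_real_1 scaleC_of_real scaleR_one)

lemma cinner_zero_left [simp]: "cinner 0 (x::'h::complex_hilbert) = 0"
  using cinner_add_left[of 0 0 x] by simp

lemma cinner_zero_right [simp]: "cinner (x::'h::complex_hilbert) 0 = 0"
  using cinner_add_right[of x 0 0] by simp

lemma cinner_minus_left: "cinner (- x) (y::'h::complex_hilbert) = - cinner x y"
  using cinner_add_left[of x "- x" y] by (simp add: eq_neg_iff_add_eq_0 add.commute)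

lemma cinner_diff_left: "cinner (x - y) (z::'h::complex_hilbert) = cinner x z - cinner y z"
  using cinner_add_left[of x "- y" z] by (simp add: cinner_minus_left)

lemma cinner_sum_left:
  "cinner (\<Sum>i\<in>A. f i) (y::'h::complex_hilbert) = (\<Sum>i\<in>A. cinner (f i) y)"
  by (induction A rule: infinite_finite_induct) (auto simp: cinner_add_left)

lemma cinner_sum_right:
  "cinner (y::'h::complex_hilbert) (\<Sum>i\<in>A. f i) = (\<Sum>i\<in>A. cinner y (f i))"
  by (induction A rule: infinite_finite_induct) (auto simp: cinner_add_right)

lemma cinner_self: "cinner (x::'h::complex_hilbert) x = of_real ((norm x)\<^sup>2)"
proof (rule complex_eqI)
  show "Im (cinner x x) = Im (of_real ((norm x)\<^sup>2))"
    using arg_cong[OF cnj_cinner[of x x], of Im] by simp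
qed (simp add: Re_cinner power2_norm_eq_inner)

lemma norm_scaleC: "norm (a *\<^sub>C (x::'h::complex_hilbert)) = cmod a * norm x"
proof -
  have "complex_of_real ((norm (a *\<^sub>C x))\<^sup>2) = (a * cnj a) * cinner x x"
    unfolding cinner_self[symmetric] cinner_scaleC_left cinner_scaleC_right by (simp only: mult_ac)
  also have "\<dots> = complex_of_real ((cmod a * norm x)\<^sup>2)"
    by (simp only: cinner_self complex_norm_square[symmetric] power_mult_distrib of_real_mult of_real_power)
  finally have "complex_of_real ((norm (a *\<^sub>C x))\<^sup>2) = complex_of_real ((cmod a * norm x)\<^sup>2)" .
  then have "(norm (a *\<^sub>C x))\<^sup>2 = (cmod a * norm x)\<^sup>2"
    by (simp only: of_real_eq_iff)
  then show ?thesis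
    by (simp add: power2_eq_iff_nonneg)
qed

lemma norm_cinner_le: "cmod (cinner x (y::'h::complex_hilbert)) \<le> norm x * norm y"
proof (cases "cinner x y = 0")
  case False
  \<comment> \<open>Rotating \<open>x\<close> by this unimodular scalar makes the inner product
    equal to its modulus, so the real Cauchy-Schwarz inequality suffices.\<close>
  define a where "a = cnj (sgn (cinner x y))"
  have "a * cinner x y = of_real (cmod (cinner x y))"
    using False by (simp add: a_def sgn_eq field_simps complex_norm_square[symmetric] power2_eq_square)
  then have "cmod (cinner x y) = inner (a *\<^sub>C x) y"
    unfolding Re_cinner[symmetric] by (simp add: cinner_scaleC_left)
  also have "\<dots> \<le> norm (a *\<^sub>C x) * norm y"
    by (rule norm_cauchy_schwarz)
  also have "norm (a *\<^sub>C x) = norm x"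
    using False by (simp add: norm_scaleC a_def norm_sgn)
  finally show ?thesis .
qed simp

lemma bounded_linear_cinner_left: "bounded_linear (\<lambda>x. cinner x (y::'h::complex_hilbert))"
  by (rule bounded_linear_intro[where K = "norm y"])
    (auto simp: cinner_add_left cinner_scaleR_left scaleR_conv_of_real norm_cinner_le)

section \<open>Bessel families and their frame operators\<close>

definition bessel :: "'j set \<Rightarrow> ('j \<Rightarrow> 'h::complex_hilbert) \<Rightarrow> real \<Rightarrow> bool" where
  "bessel J \<phi> b \<longleftrightarrow>
     (\<forall>x F. finite F \<longrightarrow> F \<subseteq> J \<longrightarrow> (\<Sum>j\<in>F. (cmod (cinner x (\<phi> j)))\<^sup>2) \<le> b * (norm x)\<^sup>2)"

text \<open>A divergent infinite sum has the value 0, here and in \<open>frame_op\<close>; a lower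
  frame inequality is therefore always paired with \<open>bessel\<close>.\<close>

definition frame_energy :: "'j set \<Rightarrow> ('j \<Rightarrow> 'h::complex_hilbert) \<Rightarrow> 'h \<Rightarrow> real" where
  "frame_energy J \<phi> x = (\<Sum>\<^sub>\<infinity>j\<in>J. (cmod (cinner x (\<phi> j)))\<^sup>2)"

definition frame_op :: "'j set \<Rightarrow> ('j \<Rightarrow> 'h::complex_hilbert) \<Rightarrow> 'h \<Rightarrow> 'h" where
  "frame_op J \<phi> x = (\<Sum>\<^sub>\<infinity>j\<in>J. cinner x (\<phi> j) *\<^sub>C \<phi> j)"

lemma besselD:
  "bessel J \<phi> b \<Longrightarrow> finite F \<Longrightarrow> F \<subseteq> J \<Longrightarrow> (\<Sum>j\<in>F. (cmod (cinner x (\<phi> j)))\<^sup>2) \<le> b * (norm x)\<^sup>2"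
  by (auto simp: bessel_def)

lemma bessel_summable:
  assumes "bessel J \<phi> b"
  shows "(\<lambda>j. (cmod (cinner x (\<phi> j)))\<^sup>2) summable_on J"
  by (rule nonneg_bdd_above_summable_on) (auto intro!: bdd_aboveI2 besselD[OF assms])

lemma bessel_iff:
  "bessel J \<phi> b \<longleftrightarrow> (\<forall>x. (\<lambda>j. (cmod (cinner x (\<phi> j)))\<^sup>2) summable_on J \<and>
      frame_energy J \<phi> x \<le> b * (norm x)\<^sup>2)"
proof safe
  fix x assume "bessel J \<phi> b"
  then show "(\<lambda>j. (cmod (cinner x (\<phi> j)))\<^sup>2) summable_on J" "frame_energy J \<phi> x \<le> b * (norm x)\<^sup>2"
    unfolding frame_energy_def
    by (auto intro!: bessel_summable infsum_le_finite_sums besselD)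
next
  assume *: "\<forall>x. (\<lambda>j. (cmod (cinner x (\<phi> j)))\<^sup>2) summable_on J \<and>
      frame_energy J \<phi> x \<le> b * (norm x)\<^sup>2"
  show "bessel J \<phi> b"
    unfolding bessel_def
  proof (intro allI impI)
    fix x F assume "finite F" "F \<subseteq> J"
    then have "(\<Sum>j\<in>F. (cmod (cinner x (\<phi> j)))\<^sup>2) \<le> frame_energy J \<phi> x"
      unfolding frame_energy_def using * by (intro finite_sum_le_infsum) auto
    with * show "(\<Sum>j\<in>F. (cmod (cinner x (\<phi> j)))\<^sup>2) \<le> b * (norm x)\<^sup>2"
      by (meson order_trans)
  qed
qed

lemma norm_sum_mult_sq_le:
  fixes c d :: "'j \<Rightarrow> complex"
  shows "(cmod (\<Sum>j\<in>F. c j * d j))\<^sup>2 \<le> (\<Sum>j\<in>F. (cmod (c j))\<^sup>2) * (\<Sum>j\<in>F. (cmod (d j))\<^sup>2)"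
proof -
  have "(cmod (\<Sum>j\<in>F. c j * d j))\<^sup>2 \<le> (\<Sum>j\<in>F. cmod (c j) * cmod (d j))\<^sup>2"
    by (intro power_mono) (auto intro!: sum_norm_le simp: norm_mult)
  also have "\<dots> \<le> (\<Sum>j\<in>F. (cmod (c j))\<^sup>2) * (\<Sum>j\<in>F. (cmod (d j))\<^sup>2)"
    by (rule Cauchy_Schwarz_ineq_sum)
  finally show ?thesis .
qed

text \<open>Synthesis is adjoint to analysis and inherits its bound: pairing \<open>s\<close> with
  itself gives (norm s)^4 \<le> E * b * (norm s)^2, where E is the energy of the coefficients, and a
  factor (norm s)^2 cancels.\<close>

lemma bessel_synthesis_le:
  assumes "bessel J \<phi> b" "0 \<le> b" "finite F" "F \<subseteq> J"
  shows "(norm (\<Sum>j\<in>F. c j *\<^sub>C \<phi> j))\<^sup>2 \<le> b * (\<Sum>j\<in>F. (cmod (c j))\<^sup>2)"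
proof -
  define s where "s = (\<Sum>j\<in>F. c j *\<^sub>C \<phi> j)"
  have "((norm s)\<^sup>2)\<^sup>2 = (cmod (cinner s s))\<^sup>2"
    by (simp add: cinner_self norm_power)
  also have "cinner s s = (\<Sum>j\<in>F. c j * cinner (\<phi> j) s)"
    by (subst (1) s_def) (simp add: cinner_sum_left cinner_scaleC_left)
  also have "(cmod \<dots>)\<^sup>2 \<le> (\<Sum>j\<in>F. (cmod (c j))\<^sup>2) * (\<Sum>j\<in>F. (cmod (cinner (\<phi> j) s))\<^sup>2)"
    by (rule norm_sum_mult_sq_le)
  also have "(\<Sum>j\<in>F. (cmod (cinner (\<phi> j) s))\<^sup>2) = (\<Sum>j\<in>F. (cmod (cinner s (\<phi> j)))\<^sup>2)"
    by (intro sum.cong refl arg_cong[where f = "\<lambda>x. x\<^sup>2"]) (metis cnj_cinner complex_mod_cnj)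
  also have "(\<Sum>j\<in>F. (cmod (c j))\<^sup>2) * \<dots> \<le> (\<Sum>j\<in>F. (cmod (c j))\<^sup>2) * (b * (norm s)\<^sup>2)"
    by (intro mult_left_mono besselD[OF assms(1)] assms sum_nonneg) auto
  finally have *: "(norm s)\<^sup>2 * (norm s)\<^sup>2 \<le> (b * (\<Sum>j\<in>F. (cmod (c j))\<^sup>2)) * (norm s)\<^sup>2"
    by (simp add: power2_eq_square mult_ac)
  show ?thesis
  proof (cases "s = 0")
    case True
    then show ?thesis
      using assms(2) by (auto simp: s_def[symmetric] intro!: mult_nonneg_nonneg sum_nonneg)
  next
    case False
    then have "0 < (norm s)\<^sup>2" by simp
    from mult_right_le_imp_le[OF * this] show ?thesis by (simp add: s_def)
  qed
qed

text \<open>Completeness enters through the Cauchy criterion for the net of finite sums: beyond a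
  suitable finite set the remaining coefficients have small energy, which
  \<open>bessel_synthesis_le\<close> turns into a small norm.\<close>

lemma bessel_synthesis_summable:
  assumes "bessel J \<phi> b" "0 \<le> b" and c: "(\<lambda>j. (cmod (c j))\<^sup>2) summable_on J"
  shows "(\<lambda>j. c j *\<^sub>C \<phi> j) summable_on J"
proof -
  define f where "f j = c j *\<^sub>C \<phi> j" for j
  define q where "q j = (cmod (c j))\<^sup>2" for j
  obtain L where L: "(sum q \<longlongrightarrow> L) (finite_subsets_at_top J)"
    using c unfolding has_sum_def summable_on_def q_def by blast
  have "\<exists>P. eventually P (finite_subsets_at_top J) \<and>
              (\<forall>F F'. P F \<and> P F' \<longrightarrow> dist (sum f F) (sum f F') < e)" if "e > 0" for e
  proof -
    \<comment> \<open>The energy outside \<open>F0\<close> is at most 2 * d, and the factor 16 makes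
      b * 2 * d at most half of (e / 2)^2; the summand 1 keeps the divisor positive for b =
      0.\<close>
    define d where "d = e\<^sup>2 / (16 * (b + 1))"
    have d: "d > 0" using that assms(2) by (simp add: d_def)
    have "eventually (\<lambda>F. dist (sum q F) L < d) (finite_subsets_at_top J)"
      using L d by (auto simp: tendsto_iff)
    then obtain F0 where F0: "finite F0" "F0 \<subseteq> J"
      and F0': "\<And>F. finite F \<Longrightarrow> F0 \<subseteq> F \<Longrightarrow> F \<subseteq> J \<Longrightarrow> dist (sum q F) L < d"
      unfolding eventually_finite_subsets_at_top by auto
    have near: "dist (sum f F) (sum f F0) < e / 2" if "finite F" "F0 \<subseteq> F" "F \<subseteq> J" for F
    proof -
      have "sum q (F - F0) = sum q F - sum q F0"
        using that F0 by (simp add: sum_diff)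
      then have "sum q (F - F0) \<le> 2 * d"
        using F0'[OF that] F0'[OF F0(1) order_refl F0(2)] by (simp add: dist_real_def)
      then have "b * sum q (F - F0) \<le> b * (2 * d)"
        using assms(2) by (rule mult_left_mono)
      moreover have "(norm (sum f (F - F0)))\<^sup>2 \<le> b * sum q (F - F0)"
        unfolding f_def q_def using that by (intro bessel_synthesis_le[OF assms(1,2)]) auto
      ultimately have "(norm (sum f (F - F0)))\<^sup>2 \<le> b * (2 * d)" by linarith
      moreover have "b * (2 * d) \<le> (b + 1) * (2 * d)"
        using d by (intro mult_right_mono) auto
      moreover have "(b + 1) * (2 * d) = (e / 2)\<^sup>2 / 2"
        using assms(2) by (simp add: d_def power2_eq_square field_simps)
      moreover have "(e / 2)\<^sup>2 > 0" using \<open>e > 0\<close> by simp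
      ultimately have "(norm (sum f (F - F0)))\<^sup>2 < (e / 2)\<^sup>2" by linarith
      then have "norm (sum f (F - F0)) < e / 2"
        by (rule power2_less_imp_less) (use \<open>e > 0\<close> in simp)
      then show ?thesis
        using that F0 by (simp add: dist_norm sum_diff)
    qed
    show ?thesis
    proof (intro exI conjI allI impI)
      show "\<forall>\<^sub>F F in finite_subsets_at_top J. finite F \<and> F0 \<subseteq> F \<and> F \<subseteq> J"
        using F0 unfolding eventually_finite_subsets_at_top by (intro exI[of _ F0]) auto
      fix F F' assume "(finite F \<and> F0 \<subseteq> F \<and> F \<subseteq> J) \<and> (finite F' \<and> F0 \<subseteq> F' \<and> F' \<subseteq> J)"
      then have "dist (sum f F) (sum f F0) < e / 2" "dist (sum f F') (sum f F0) < e / 2"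
        using near by auto
      then show "dist (sum f F) (sum f F') < e"
        by (rule dist_triangle_half_l)
    qed
  qed
  then have "cauchy_filter (filtermap (sum f) (finite_subsets_at_top J))"
    by (simp add: cauchy_filter_metric_filtermap)
  then obtain L' where "(sum f \<longlongrightarrow> L') (finite_subsets_at_top J)"
    using complete_uniform[where S = "UNIV :: 'b set"] complete_UNIV
    by (force simp add: filterlim_def)
  then show ?thesis
    unfolding f_def using summable_on_def has_sum_def by blast
qed

lemma frame_op_has_sum:
  assumes "bessel J \<phi> b" "0 \<le> b"
  shows "((\<lambda>j. cinner x (\<phi> j) *\<^sub>C \<phi> j) has_sum frame_op J \<phi> x) J"
  unfolding frame_op_def
  by (intro has_sum_infsum bessel_synthesis_summable[OF assms] bessel_summable[OF assms(1)])

lemma frame_op_form: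
  assumes "bessel J \<phi> b" "0 \<le> b"
  shows "((\<lambda>j. cinner x (\<phi> j) * cinner (\<phi> j) y) has_sum cinner (frame_op J \<phi> x) y) J"
  using has_sum_bounded_linear[OF bounded_linear_cinner_left[of y] frame_op_has_sum[OF assms, of x]]
  by (simp add: o_def cinner_scaleC_left)

lemma cinner_mult_swap: "cinner x y * cinner y x = of_real ((cmod (cinner x (y::'h::complex_hilbert)))\<^sup>2)"
  by (metis cnj_cinner complex_norm_square)

lemma frame_op_energy:
  assumes "bessel J \<phi> b" "0 \<le> b"
  shows "cinner (frame_op J \<phi> x) x = of_real (frame_energy J \<phi> x)"
proof -
  have "((\<lambda>j. complex_of_real ((cmod (cinner x (\<phi> j)))\<^sup>2)) has_sum cinner (frame_op J \<phi> x) x) J"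
    using frame_op_form[OF assms, of x x] by (simp only: cinner_mult_swap)
  moreover have "((\<lambda>j. complex_of_real ((cmod (cinner x (\<phi> j)))\<^sup>2)) has_sum
      of_real (frame_energy J \<phi> x)) J"
    unfolding frame_energy_def by (intro has_sum_of_real has_sum_infsum bessel_summable[OF assms(1)])
  ultimately show ?thesis by (rule has_sum_unique)
qed

lemma frame_op_selfadjoint:
  assumes "bessel J \<phi> b" "0 \<le> b"
  shows "cinner (frame_op J \<phi> x) y = cinner x (frame_op J \<phi> y)"
proof -
  have "((\<lambda>j. cnj (cinner y (\<phi> j) * cinner (\<phi> j) x)) has_sum cnj (cinner (frame_op J \<phi> y) x)) J"
    by (subst has_sum_cnj_iff) (rule frame_op_form[OF assms])
  then have "((\<lambda>j. cinner x (\<phi> j) * cinner (\<phi> j) y) has_sum cinner x (frame_op J \<phi> y)) J"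
    by (simp only: complex_cnj_mult cnj_cinner mult.commute)
  then show ?thesis
    by (rule has_sum_unique[OF frame_op_form[OF assms]])
qed

lemma cinner_ext: "(\<And>y. cinner x y = cinner x' y) \<Longrightarrow> x = (x' :: 'h::complex_hilbert)"
  by (metis Re_cinner inner_eq_zero_iff inner_diff_left right_minus_eq)

text \<open>Linearity is read off from self-adjointness: with the operator moved to the other
  argument, only the additivity of the inner product is left.\<close>

lemma frame_op_add:
  assumes "bessel J \<phi> b" "0 \<le> b"
  shows "frame_op J \<phi> (x + y) = frame_op J \<phi> x + frame_op J \<phi> y"
  by (rule cinner_ext) (simp add: frame_op_selfadjoint[OF assms] cinner_add_left)

lemma frame_op_scaleC:
  assumes "bessel J \<phi> b" "0 \<le> b"
  shows "frame_op J \<phi> (a *\<^sub>C x) = a *\<^sub>C frame_op J \<phi> x"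
  by (rule cinner_ext) (simp add: frame_op_selfadjoint[OF assms] cinner_scaleC_left)

text \<open>Analysis and synthesis each contribute a factor sqrt b; the bound for finite partial
  sums passes to the limit.\<close>

lemma frame_op_norm_le:
  assumes "bessel J \<phi> b" "0 \<le> b"
  shows "norm (frame_op J \<phi> x) \<le> b * norm x"
proof -
  let ?S = "frame_op J \<phi> x"
  have "(norm (\<Sum>j\<in>F. cinner x (\<phi> j) *\<^sub>C \<phi> j))\<^sup>2 \<le> (b * norm x)\<^sup>2"
    if "finite F" "F \<subseteq> J" for F
  proof -
    have "(norm (\<Sum>j\<in>F. cinner x (\<phi> j) *\<^sub>C \<phi> j))\<^sup>2 \<le> b * (\<Sum>j\<in>F. (cmod (cinner x (\<phi> j)))\<^sup>2)"
      by (rule bessel_synthesis_le[OF assms that])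
    also have "\<dots> \<le> b * (b * (norm x)\<^sup>2)"
      by (intro mult_left_mono besselD[OF assms(1) that] assms)
    finally show ?thesis by (simp add: power2_eq_square mult_ac)
  qed
  then have le: "norm (\<Sum>j\<in>F. cinner x (\<phi> j) *\<^sub>C \<phi> j) \<le> b * norm x" if "finite F" "F \<subseteq> J" for F
    using that assms(2) by (meson mult_nonneg_nonneg norm_ge_zero power2_le_imp_le)
  have "((\<lambda>F. norm (\<Sum>j\<in>F. cinner x (\<phi> j) *\<^sub>C \<phi> j)) \<longlongrightarrow> norm ?S) (finite_subsets_at_top J)"
    using frame_op_has_sum[OF assms, of x] unfolding has_sum_def by (rule tendsto_norm)
  then show ?thesis
    by (rule tendsto_upperbound) (auto intro!: eventually_finite_subsets_at_top_weakI le)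
qed

lemma frame_op_bounded_linear:
  assumes "bessel J \<phi> b" "0 \<le> b"
  shows "bounded_linear (frame_op J \<phi>)"
  by (rule bounded_linear_intro[where K = b])
    (auto simp: frame_op_add[OF assms] frame_op_scaleC[OF assms] scaleC_of_real[symmetric]
      frame_op_norm_le[OF assms] mult.commute)

text \<open>The energy is the quadratic form of a bounded operator. Its continuity is what extends
  energy identities and inequalities from dense sets.\<close>

lemma continuous_frame_energy:
  assumes "bessel J \<phi> b" "0 \<le> b"
  shows "continuous_on UNIV (frame_energy J \<phi>)"
proof -
  have "frame_energy J \<phi> = (\<lambda>x. inner (frame_op J \<phi> x) x)"
    using frame_op_energy[OF assms] by (metis Re_cinner Re_complex_of_real)
  moreover have "continuous_on UNIV (\<lambda>x. inner (frame_op J \<phi> x) x)"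
    by (intro continuous_intros bounded_linear.continuous_on[OF frame_op_bounded_linear[OF assms]])
  ultimately show ?thesis by simp
qed

text \<open>For a suitable step t the map u \<mapsto> u - t * (S u - f) is a contraction, since S is
  bounded below as a form by a and in norm by b; its fixed point solves S u = f.\<close>

lemma frame_op_surj:
  assumes "bessel J \<phi> b" "0 \<le> b" "0 < a"
    and lower: "\<And>x. a * (norm x)\<^sup>2 \<le> frame_energy J \<phi> x"
  shows "\<exists>u. frame_op J \<phi> u = f"
proof -
  \<comment> \<open>On the zero space nothing forces a \<le> b; taking the maximum keeps 1 - a^2 /
    b'^2 nonnegative in every case.\<close>
  define b' where "b' = max b a"
  have b': "b' > 0" "a \<le> b'" "b \<le> b'" using assms by (auto simp: b'_def)
  \<comment> \<open>This step minimises 1 - 2 * t * a + t^2 * b'^2, the bound for the squared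
    contraction factor; \<open>c\<close> is the square root of the minimum.\<close>
  define t where "t = a / b'\<^sup>2"
  define c where "c = sqrt (1 - a\<^sup>2 / b'\<^sup>2)"
  let ?S = "frame_op J \<phi>"
  have t: "t > 0" using assms b' by (simp add: t_def)
  have ab: "0 \<le> 1 - a\<^sup>2 / b'\<^sup>2" "a\<^sup>2 / b'\<^sup>2 > 0"
    using b' assms by (auto simp: power_mono)
  have S_diff: "?S x - ?S y = ?S (x - y)" for x y
    using linear_diff[OF bounded_linear.linear[OF frame_op_bounded_linear[OF assms(1,2)]]] by metis
  have contr: "(norm (w - t *\<^sub>R ?S w))\<^sup>2 \<le> (c * norm w)\<^sup>2" for w
  proof -
    have "(norm (w - t *\<^sub>R ?S w))\<^sup>2 = (norm w)\<^sup>2 - 2 * t * inner (?S w) w + t\<^sup>2 * (norm (?S w))\<^sup>2"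
      by (simp only: power2_norm_eq_inner)
        (simp add: inner_diff_left inner_diff_right inner_commute power2_eq_square algebra_simps)
    also have "inner (?S w) w = frame_energy J \<phi> w"
      using frame_op_energy[OF assms(1,2)] by (metis Re_cinner Re_complex_of_real)
    also have "(norm w)\<^sup>2 - 2 * t * frame_energy J \<phi> w + t\<^sup>2 * (norm (?S w))\<^sup>2 \<le>
        (norm w)\<^sup>2 - 2 * t * (a * (norm w)\<^sup>2) + t\<^sup>2 * (b' * norm w)\<^sup>2"
    proof (intro add_mono diff_mono mult_left_mono lower power_mono order_refl)
      have "norm (?S w) \<le> b * norm w" by (rule frame_op_norm_le[OF assms(1,2)])
      also have "\<dots> \<le> b' * norm w" by (intro mult_right_mono b') auto
      finally show "norm (?S w) \<le> b' * norm w" .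
    qed (use t in auto)
    also have "\<dots> = (1 - a\<^sup>2 / b'\<^sup>2) * (norm w)\<^sup>2"
      using b' by (simp add: t_def power2_eq_square field_simps)
    also have "\<dots> = (c * norm w)\<^sup>2"
      unfolding power_mult_distrib c_def real_sqrt_pow2[OF ab(1)] ..
    finally show ?thesis .
  qed
  have c: "0 \<le> c" "c < 1" using ab by (auto simp: c_def)
  have "\<exists>!u. u - t *\<^sub>R (?S u - f) = u"
  proof (rule banach_fix_type[OF c], intro allI)
    fix x y
    have "norm ((x - y) - t *\<^sub>R ?S (x - y)) \<le> c * norm (x - y)"
      using contr[of "x - y"] c by (meson mult_nonneg_nonneg norm_ge_zero power2_le_imp_le)
    then show "dist (x - t *\<^sub>R (?S x - f)) (y - t *\<^sub>R (?S y - f)) \<le> c * dist x y"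
      by (simp add: dist_norm S_diff[symmetric] algebra_simps)
  qed
  then obtain u where "u - t *\<^sub>R (?S u - f) = u" by blast
  then have "?S u = f" using t by simp
  then show ?thesis ..
qed

section \<open>Riesz bases and frames\<close>

definition dense_in :: "'j set \<Rightarrow> ('j \<Rightarrow> 'h::complex_hilbert) \<Rightarrow> bool" where
  "dense_in J \<phi> \<longleftrightarrow>
     (\<forall>x. \<forall>\<epsilon>>0. \<exists>F c. finite F \<and> F \<subseteq> J \<and> norm (x - (\<Sum>j\<in>F. c j *\<^sub>C \<phi> j)) < \<epsilon>)"

definition riesz_seq :: "'j set \<Rightarrow> ('j \<Rightarrow> 'h::complex_hilbert) \<Rightarrow> real \<Rightarrow> real \<Rightarrow> bool" where
  "riesz_seq J \<phi> a b \<longleftrightarrow> (\<forall>F c. finite F \<longrightarrow> F \<subseteq> J \<longrightarrow>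
      a * (\<Sum>j\<in>F. (cmod (c j))\<^sup>2) \<le> (norm (\<Sum>j\<in>F. c j *\<^sub>C \<phi> j))\<^sup>2 \<and>
      (norm (\<Sum>j\<in>F. c j *\<^sub>C \<phi> j))\<^sup>2 \<le> b * (\<Sum>j\<in>F. (cmod (c j))\<^sup>2))"

text \<open>
  The coefficients of \<open>u i\<close> are the minimal-norm expansion of \<open>\<phi> i\<close>; since their energy is \<open>1\<close>
  and is already exhausted by the coefficient at \<open>i\<close>, the families are biorthogonal.
\<close>

lemma frame_imp_riesz:
  assumes B: "bessel J \<phi> b" "0 \<le> b" and a: "0 < a"
    and lower: "\<And>x. a * (norm x)\<^sup>2 \<le> frame_energy J \<phi> x"
    and u: "\<And>j. j \<in> J \<Longrightarrow> frame_op J \<phi> (u j) = \<phi> j" "\<And>j. j \<in> J \<Longrightarrow> cinner (u j) (\<phi> j) = 1"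
  shows "dense_in J \<phi>" "riesz_seq J \<phi> a b"
proof -
  let ?S = "frame_op J \<phi>"
  show "dense_in J \<phi>"
    unfolding dense_in_def
  proof (intro allI impI)
    fix x and e :: real assume e: "e > 0"
    obtain w where w: "?S w = x" using frame_op_surj[OF B a lower] by blast
    define f where "f j = cinner w (\<phi> j) *\<^sub>C \<phi> j" for j
    have hs: "(f has_sum x) J"
      using frame_op_has_sum[OF B, of w] w by (simp add: f_def[abs_def])
    have "\<exists>F. finite F \<and> F \<subseteq> J \<and> dist (sum f F) x \<le> e / 2"
      by (rule has_sum_finite_approximation[OF hs]) (use e in auto)
    then obtain F where F: "finite F" "F \<subseteq> J" "dist (sum f F) x \<le> e / 2" by auto
    then have "norm (x - sum f F) < e" using e by (simp add: dist_norm norm_minus_commute)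
    with F show "\<exists>F c. finite F \<and> F \<subseteq> J \<and> norm (x - (\<Sum>j\<in>F. c j *\<^sub>C \<phi> j)) < e"
      unfolding f_def by (intro exI[of _ F] exI[of _ "\<lambda>j. cinner w (\<phi> j)"]) simp
  qed
  have biorth: "cinner (u i) (\<phi> j) = of_bool (i = j)" if "i \<in> J" "j \<in> J" for i j
  proof (cases "i = j")
    case False
    have "complex_of_real (frame_energy J \<phi> (u i)) = cinner (\<phi> i) (u i)"
      using frame_op_energy[OF B, of "u i"] u(1)[OF that(1)] by simp
    also have "\<dots> = 1" using u(2)[OF that(1)] by (metis cnj_cinner complex_cnj_one)
    finally have "frame_energy J \<phi> (u i) = 1" by simp
    moreover have "(\<Sum>l\<in>{i,j}. (cmod (cinner (u i) (\<phi> l)))\<^sup>2) \<le> frame_energy J \<phi> (u i)"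
      unfolding frame_energy_def using that
      by (intro finite_sum_le_infsum bessel_summable[OF B(1)]) auto
    ultimately have "(cmod (cinner (u i) (\<phi> j)))\<^sup>2 \<le> 0"
      using False u(2)[OF that(1)] by simp
    with False show ?thesis by simp
  qed (use u that in simp)
  show "riesz_seq J \<phi> a b"
    unfolding riesz_seq_def
  proof (intro allI impI conjI)
    fix F and c :: "'a \<Rightarrow> complex" assume F: "finite F" "F \<subseteq> J"
    define x where "x = (\<Sum>j\<in>F. c j *\<^sub>C \<phi> j)"
    define w where "w = (\<Sum>j\<in>F. c j *\<^sub>C u j)"
    define E where "E = (\<Sum>j\<in>F. (cmod (c j))\<^sup>2)"
    have Sw: "?S w = x"
    proof -
      have "?S w = (\<Sum>j\<in>F. ?S (c j *\<^sub>C u j))"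
        unfolding w_def using bounded_linear.linear[OF frame_op_bounded_linear[OF B]]
        by (rule linear_sum)
      also have "\<dots> = x"
        unfolding x_def using F u by (intro sum.cong) (auto simp: frame_op_scaleC[OF B])
      finally show ?thesis .
    qed
    have "cinner w x = (\<Sum>i\<in>F. c i * cinner (u i) x)"
      by (simp add: w_def cinner_sum_left cinner_scaleC_left)
    also have "\<dots> = (\<Sum>i\<in>F. c i * cnj (c i))"
    proof (intro sum.cong refl arg_cong2[where f = "(*)"])
      fix i assume i: "i \<in> F"
      have "cinner (u i) x = (\<Sum>j\<in>F. cnj (c j) * cinner (u i) (\<phi> j))"
        by (simp add: x_def cinner_sum_right cinner_scaleC_right)
      also have "\<dots> = (\<Sum>j\<in>F. if i = j then cnj (c j) else 0)"
        using i F biorth by (intro sum.cong refl) (auto simp: subset_iff)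
      finally show "cinner (u i) x = cnj (c i)" using i F by simp
    qed
    also have "\<dots> = of_real E"
      by (simp only: E_def of_real_sum complex_norm_square)
    finally have wx: "cinner w x = of_real E" .
    then have xw: "cinner x w = of_real E" by (metis cnj_cinner complex_cnj_complex_of_real)
    have E0: "0 \<le> E" by (auto simp: E_def intro: sum_nonneg)
    \<comment> \<open>Since \<open>w\<close> is the preimage of \<open>x\<close> and E is their
      inner product, the lower frame bound gives a * (norm w)^2 \<le> E, and Cauchy-Schwarz gives E
      \<le> norm x * norm w. Eliminating the norm of \<open>w\<close> leaves the lower Riesz
      bound.\<close>
    have "a * (norm w)\<^sup>2 \<le> E"
      using lower[of w] frame_op_energy[OF B, of w] Sw xw by simp
    moreover have "E \<le> norm x * norm w"
      using norm_cinner_le[of x w] E0 by (simp add: xw)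
    then have "E\<^sup>2 \<le> (norm x)\<^sup>2 * (norm w)\<^sup>2"
      using E0 by (metis power_mono power_mult_distrib)
    ultimately have "a * E\<^sup>2 \<le> (norm x)\<^sup>2 * E"
      by (smt (verit, best) a mult.left_commute mult_left_mono zero_le_power2)
    then have "a * E \<le> (norm x)\<^sup>2"
      using E0 by (cases "E = 0") (auto simp: power2_eq_square)
    then show "a * (\<Sum>j\<in>F. (cmod (c j))\<^sup>2) \<le> (norm (\<Sum>j\<in>F. c j *\<^sub>C \<phi> j))\<^sup>2"
      by (simp add: E_def x_def)
    show "(norm (\<Sum>j\<in>F. c j *\<^sub>C \<phi> j))\<^sup>2 \<le> b * (\<Sum>j\<in>F. (cmod (c j))\<^sup>2)"
      by (rule bessel_synthesis_le[OF B F])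
  qed
qed

text \<open>The converse duality: synthesising the coefficients of \<open>x\<close> themselves and
  pairing the result with \<open>x\<close> gives their energy E, so that E^2 \<le> b * E * (norm
  x)^2.\<close>

lemma synthesis_le_imp_bessel:
  assumes b: "0 \<le> b" and le: "\<And>F c. finite F \<Longrightarrow> F \<subseteq> J \<Longrightarrow>
    (norm (\<Sum>j\<in>F. c j *\<^sub>C \<phi> j))\<^sup>2 \<le> b * (\<Sum>j\<in>F. (cmod (c j))\<^sup>2)"
  shows "bessel J \<phi> b"
  unfolding bessel_def
proof (intro allI impI)
  fix x F assume F: "finite F" "F \<subseteq> J"
  define E where "E = (\<Sum>j\<in>F. (cmod (cinner x (\<phi> j)))\<^sup>2)"
  define s where "s = (\<Sum>j\<in>F. cinner x (\<phi> j) *\<^sub>C \<phi> j)"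
  have E0: "0 \<le> E" by (auto simp: E_def intro: sum_nonneg)
  have "cinner s x = (\<Sum>j\<in>F. cinner x (\<phi> j) * cinner (\<phi> j) x)"
    by (simp add: s_def cinner_sum_left cinner_scaleC_left)
  also have "\<dots> = of_real E"
    by (simp only: cinner_mult_swap of_real_sum E_def)
  finally have "E\<^sup>2 \<le> (norm s * norm x)\<^sup>2"
    using norm_cinner_le[of s x] E0 by (intro power_mono) auto
  also have "\<dots> = (norm s)\<^sup>2 * (norm x)\<^sup>2" by (simp add: power_mult_distrib)
  also have "\<dots> \<le> (b * E) * (norm x)\<^sup>2"
    unfolding s_def E_def by (intro mult_right_mono le F) auto
  finally have "E * E \<le> (b * (norm x)\<^sup>2) * E" by (simp add: power2_eq_square mult_ac)
  then have "E \<le> b * (norm x)\<^sup>2"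
    using E0 b by (cases "E = 0") auto
  then show "(\<Sum>j\<in>F. (cmod (cinner x (\<phi> j)))\<^sup>2) \<le> b * (norm x)\<^sup>2"
    by (simp add: E_def)
qed

text \<open>For a finite combination y with coefficient energy E, Cauchy-Schwarz gives (norm y)^4
  \<le> E * frame_energy y, and the lower Riesz bound replaces E by (norm y)^2 / a. The resulting
  inequality defines a closed set, and such y are dense.\<close>

lemma riesz_imp_frame:
  assumes a: "0 < a" and b: "0 < b" and dense: "dense_in J \<phi>" and R: "riesz_seq J \<phi> a b"
  shows "bessel J \<phi> b" "a * (norm x)\<^sup>2 \<le> frame_energy J \<phi> x"
proof -
  show B: "bessel J \<phi> b"
    using R b by (intro synthesis_le_imp_bessel) (auto simp: riesz_seq_def)
  define X where "X = {x. a * (norm x)\<^sup>2 \<le> frame_energy J \<phi> x}"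
  have "closed X"
    unfolding X_def using b
    by (intro closed_Collect_le continuous_intros continuous_frame_energy[OF B]) auto
  have span: "(\<Sum>j\<in>F. c j *\<^sub>C \<phi> j) \<in> X" if F: "finite F" "F \<subseteq> J" for F c
  proof -
    define y where "y = (\<Sum>j\<in>F. c j *\<^sub>C \<phi> j)"
    define E where "E = (\<Sum>j\<in>F. (cmod (c j))\<^sup>2)"
    have aE: "a * E \<le> (norm y)\<^sup>2" using R F unfolding riesz_seq_def E_def y_def by blast
    have "((norm y)\<^sup>2)\<^sup>2 = (cmod (cinner y y))\<^sup>2" by (simp add: cinner_self norm_power)
    also have "cinner y y = (\<Sum>j\<in>F. cnj (c j) * cinner y (\<phi> j))"
      by (subst (2) y_def) (simp add: cinner_sum_right cinner_scaleC_right)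
    also have "(cmod \<dots>)\<^sup>2 \<le> (\<Sum>j\<in>F. (cmod (cnj (c j)))\<^sup>2) * (\<Sum>j\<in>F. (cmod (cinner y (\<phi> j)))\<^sup>2)"
      by (rule norm_sum_mult_sq_le)
    also have "\<dots> = E * (\<Sum>j\<in>F. (cmod (cinner y (\<phi> j)))\<^sup>2)" by (simp add: E_def)
    also have "\<dots> \<le> E * frame_energy J \<phi> y"
      unfolding frame_energy_def using F
      by (intro mult_left_mono finite_sum_le_infsum bessel_summable[OF B])
        (auto simp: E_def intro: sum_nonneg)
    finally have 1: "(norm y)\<^sup>2 * (norm y)\<^sup>2 \<le> E * frame_energy J \<phi> y"
      by (simp add: power2_eq_square mult_ac)
    have fe: "0 \<le> frame_energy J \<phi> y" unfolding frame_energy_def by (intro infsum_nonneg) auto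
    have "(a * (norm y)\<^sup>2) * (norm y)\<^sup>2 \<le> (a * E) * frame_energy J \<phi> y"
      using mult_left_mono[OF 1, of a] a by (simp add: mult_ac)
    also have "\<dots> \<le> (norm y)\<^sup>2 * frame_energy J \<phi> y"
      by (intro mult_right_mono aE fe)
    finally have "(a * (norm y)\<^sup>2) * (norm y)\<^sup>2 \<le> frame_energy J \<phi> y * (norm y)\<^sup>2"
      by (simp add: mult_ac)
    then have "a * (norm y)\<^sup>2 \<le> frame_energy J \<phi> y"
      using fe by (cases "y = 0") auto
    then show ?thesis by (simp add: X_def y_def)
  qed
  have "x \<in> closure X"
    unfolding closure_approachable
  proof (intro allI impI)
    fix e :: real assume "e > 0"
    from dense[unfolded dense_in_def, rule_format, OF this, of x]
    obtain F c where "finite F" "F \<subseteq> J" "norm (x - (\<Sum>j\<in>F. c j *\<^sub>C \<phi> j)) < e"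
      by (elim exE conjE)
    then show "\<exists>y\<in>X. dist y x < e"
      using span[of F c] by (auto simp: dist_norm norm_minus_commute)
  qed
  then show "a * (norm x)\<^sup>2 \<le> frame_energy J \<phi> x"
    using \<open>closed X\<close> by (simp add: X_def)
qed

section \<open>Extension from dense sets, polarisation\<close>

lemma bessel_of_dense:
  assumes D: "closure D = UNIV"
    and le: "\<And>x F. x \<in> D \<Longrightarrow> finite F \<Longrightarrow> F \<subseteq> J \<Longrightarrow>
      (\<Sum>j\<in>F. (cmod (cinner x (\<phi> j)))\<^sup>2) \<le> b * (norm x)\<^sup>2"
  shows "bessel J \<phi> b"
  unfolding bessel_def
proof (intro allI impI)
  fix x F assume F: "finite F" "F \<subseteq> J"
  have "closed {x. (\<Sum>j\<in>F. (cmod (cinner x (\<phi> j)))\<^sup>2) \<le> b * (norm x)\<^sup>2}"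
    by (intro closed_Collect_le continuous_intros
        bounded_linear.continuous_on[OF bounded_linear_cinner_left])
  moreover have "D \<subseteq> {x. (\<Sum>j\<in>F. (cmod (cinner x (\<phi> j)))\<^sup>2) \<le> b * (norm x)\<^sup>2}"
    using le F by auto
  ultimately have "closure D \<subseteq> {x. (\<Sum>j\<in>F. (cmod (cinner x (\<phi> j)))\<^sup>2) \<le> b * (norm x)\<^sup>2}"
    by (rule closure_minimal[rotated])
  then show "(\<Sum>j\<in>F. (cmod (cinner x (\<phi> j)))\<^sup>2) \<le> b * (norm x)\<^sup>2"
    using D by auto
qed

text \<open>Summability of the second family is a hypothesis of its own: a divergent energy would be
  recorded as 0, and the identity \<open>eq\<close> would then bound nothing.\<close>

lemma bessel_transfer:
  assumes D: "closure D = UNIV" and B: "bessel J \<phi> b" and c: "0 < c"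
    and sum: "\<And>x. x \<in> D \<Longrightarrow> (\<lambda>j. (cmod (cinner x (\<psi> j)))\<^sup>2) summable_on K"
    and eq: "\<And>x. x \<in> D \<Longrightarrow> frame_energy J \<phi> x = c * frame_energy K \<psi> x"
  shows "bessel K \<psi> (b / c)"
proof (rule bessel_of_dense[OF D])
  fix x F assume x: "x \<in> D" and F: "finite F" "F \<subseteq> K"
  have "(\<Sum>j\<in>F. (cmod (cinner x (\<psi> j)))\<^sup>2) \<le> frame_energy K \<psi> x"
    unfolding frame_energy_def by (intro finite_sum_le_infsum sum x F) auto
  also have "\<dots> = frame_energy J \<phi> x / c" using eq[OF x] c by simp
  also have "\<dots> \<le> b * (norm x)\<^sup>2 / c"
    using B c by (intro divide_right_mono) (auto simp: bessel_iff)
  finally show "(\<Sum>j\<in>F. (cmod (cinner x (\<psi> j)))\<^sup>2) \<le> b / c * (norm x)\<^sup>2" by simp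
qed

lemma frame_energy_eq_of_dense:
  assumes D: "closure D = UNIV" and B: "bessel J \<phi> b" "0 \<le> b" "bessel K \<psi> b'" "0 \<le> b'"
    and eq: "\<And>x. x \<in> D \<Longrightarrow> frame_energy J \<phi> x = c * frame_energy K \<psi> x"
  shows "frame_energy J \<phi> x = c * frame_energy K \<psi> x"
proof -
  have "closed {x. frame_energy J \<phi> x = c * frame_energy K \<psi> x}"
    by (intro closed_Collect_eq continuous_intros continuous_frame_energy[OF B(1,2)]
        continuous_frame_energy[OF B(3,4)])
  then have "closure D \<subseteq> {x. frame_energy J \<phi> x = c * frame_energy K \<psi> x}"
    using eq by (intro closure_minimal) auto
  then show ?thesis using D by auto
qed

text \<open>The difference \<open>A\<close> of the two sides is self-adjoint with vanishing
  quadratic form; evaluated at x + A x, the form leaves twice the squared norm of A x.\<close>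

lemma frame_op_eq_of_energy:
  assumes B: "bessel J \<phi> b" "0 \<le> b" "bessel K \<psi> b'" "0 \<le> b'"
    and eq: "\<And>x. frame_energy J \<phi> x = c * frame_energy K \<psi> x"
  shows "frame_op J \<phi> x = c *\<^sub>R frame_op K \<psi> x"
proof -
  define A where "A x = frame_op J \<phi> x - c *\<^sub>R frame_op K \<psi> x" for x
  have Ax: "inner (A x) x = 0" for x
    using arg_cong[OF frame_op_energy[OF B(1,2), of x], of Re]
      arg_cong[OF frame_op_energy[OF B(3,4), of x], of Re] eq[of x]
    by (simp add: A_def inner_diff_left Re_cinner)
  have add: "A (x + y) = A x + A y" for x y
    by (simp add: A_def frame_op_add[OF B(1,2)] frame_op_add[OF B(3,4)] scaleR_add_right)
  have sa: "inner (A x) y = inner (A y) x" for x y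
    using arg_cong[OF frame_op_selfadjoint[OF B(1,2), of x y], of Re]
      arg_cong[OF frame_op_selfadjoint[OF B(3,4), of x y], of Re]
    by (simp add: A_def inner_diff_left Re_cinner inner_commute[of y] inner_commute[of x])
  have "inner (A x) (A x) = 0"
    using Ax[of "x + A x"] Ax[of x] Ax[of "A x"] sa[of x "A x"]
    by (simp add: add inner_add_left inner_add_right)
  then show ?thesis by (simp add: A_def)
qed

lemma riesz_one_iff_orthonormal:
  "riesz_seq J \<phi> 1 1 \<longleftrightarrow> (\<forall>i\<in>J. \<forall>j\<in>J. cinner (\<phi> i) (\<phi> j) = of_bool (i = j))"
proof safe
  fix i j assume R: "riesz_seq J \<phi> 1 1" and ij: "i \<in> J" "j \<in> J"
  have n: "(norm (\<Sum>j\<in>F. c j *\<^sub>C \<phi> j))\<^sup>2 = (\<Sum>j\<in>F. (cmod (c j))\<^sup>2)" if "finite F" "F \<subseteq> J" for F c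
    using R that unfolding riesz_seq_def by (auto simp: order_antisym)
  have n1: "(norm (\<phi> i))\<^sup>2 = 1" if "i \<in> J" for i
    using n[of "{i}" "\<lambda>_. 1"] that by simp
  show "cinner (\<phi> i) (\<phi> j) = of_bool (i = j)"
  proof (cases "i = j")
    case True
    then show ?thesis using n1[OF ij(1)] by (simp add: cinner_self flip: of_real_power)
  next
    case False
    \<comment> \<open>Taken at z = 1 and z = \<i>, this kills the real and the imaginary part of the
      inner product.\<close>
    have *: "Re (cinner (\<phi> i) (z *\<^sub>C \<phi> j)) = 0" if z: "cmod z = 1" for z
    proof -
      have "(norm (\<phi> i + z *\<^sub>C \<phi> j))\<^sup>2 = 2"
        using n[of "{i, j}" "\<lambda>l. if l = i then 1 else z"] ij False z by auto
      moreover have "(norm (\<phi> i + z *\<^sub>C \<phi> j))\<^sup>2 =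
          (norm (\<phi> i))\<^sup>2 + (norm (z *\<^sub>C \<phi> j))\<^sup>2 + 2 * inner (\<phi> i) (z *\<^sub>C \<phi> j)"
        by (simp add: power2_norm_eq_inner inner_add_left inner_add_right inner_commute)
      ultimately show ?thesis
        using n1[OF ij(1)] n1[OF ij(2)] z by (simp add: norm_scaleC Re_cinner)
    qed
    show ?thesis
      using *[of 1] *[of \<i>] False by (simp add: cinner_scaleC_right complex_eq_iff)
  qed
next
  assume o: "\<forall>i\<in>J. \<forall>j\<in>J. cinner (\<phi> i) (\<phi> j) = of_bool (i = j)"
  have "(norm (\<Sum>j\<in>F. c j *\<^sub>C \<phi> j))\<^sup>2 = (\<Sum>j\<in>F. (cmod (c j))\<^sup>2)" if F: "finite F" "F \<subseteq> J" for F c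
  proof -
    define x where "x = (\<Sum>j\<in>F. c j *\<^sub>C \<phi> j)"
    have "complex_of_real ((norm x)\<^sup>2) = (\<Sum>i\<in>F. c i * cinner (\<phi> i) x)"
      unfolding cinner_self[symmetric]
      by (subst (1) x_def) (simp add: cinner_sum_left cinner_scaleC_left)
    also have "\<dots> = (\<Sum>i\<in>F. c i * cnj (c i))"
    proof (intro sum.cong refl arg_cong2[where f = "(*)"])
      fix i assume i: "i \<in> F"
      have "cinner (\<phi> i) x = (\<Sum>j\<in>F. cnj (c j) * cinner (\<phi> i) (\<phi> j))"
        by (simp add: x_def cinner_sum_right cinner_scaleC_right)
      also have "\<dots> = (\<Sum>j\<in>F. if i = j then cnj (c j) else 0)"
        using i F o by (intro sum.cong refl) (auto simp: subset_iff)
      finally show "cinner (\<phi> i) x = cnj (c i)" using i F by simp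
    qed
    also have "\<dots> = of_real (\<Sum>j\<in>F. (cmod (c j))\<^sup>2)"
      by (simp only: of_real_sum complex_norm_square)
    finally show ?thesis by (simp only: of_real_eq_iff x_def)
  qed
  then show "riesz_seq J \<phi> 1 1" by (simp add: riesz_seq_def)
qed

section \<open>The Hilbert space of square integrable functions\<close>

lemma L2_measurable [measurable_dest]: "f \<in> L2 \<Longrightarrow> f \<in> borel_measurable borel"
  by (auto simp: L2_def)

lemma L2_integrable_square: "f \<in> L2 \<Longrightarrow> integrable lborel (\<lambda>x. (cmod (f x))\<^sup>2)"
  by (auto simp: L2_def)

lemma L2I: "f \<in> borel_measurable borel \<Longrightarrow> integrable lborel (\<lambda>x. (cmod (f x))\<^sup>2) \<Longrightarrow> f \<in> L2"
  by (auto simp: L2_def)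

lemma L2_bound:
  assumes "f \<in> borel_measurable borel" "integrable lborel w" "AE x in lborel. (cmod (f x))\<^sup>2 \<le> w x"
  shows "f \<in> L2"
proof (rule L2I)
  show "integrable lborel (\<lambda>x. (cmod (f x))\<^sup>2)"
    by (rule Bochner_Integration.integrable_bound[OF assms(2)]) (use assms in auto)
qed fact

lemma cmod_add_square_le: "(cmod (a + b))\<^sup>2 \<le> 2 * (cmod a)\<^sup>2 + 2 * (cmod b)\<^sup>2"
proof -
  have "(cmod (a + b))\<^sup>2 \<le> (cmod a + cmod b)\<^sup>2"
    by (intro power_mono norm_triangle_ineq) auto
  also have "\<dots> \<le> 2 * (cmod a)\<^sup>2 + 2 * (cmod b)\<^sup>2"
    using sum_squares_bound[of "cmod a" "cmod b"] by (simp add: power2_sum)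
  finally show ?thesis .
qed

lemma L2_add [simp, intro]: "f \<in> L2 \<Longrightarrow> h \<in> L2 \<Longrightarrow> (\<lambda>x. f x + h x) \<in> L2"
  by (rule L2_bound[where w = "\<lambda>x. 2 * (cmod (f x))\<^sup>2 + 2 * (cmod (h x))\<^sup>2"])
    (auto intro!: L2_integrable_square L2_measurable cmod_add_square_le)

lemma L2_bounded_mult:
  assumes "f \<in> L2" "m \<in> borel_measurable borel" "\<And>x. cmod (m x) \<le> C"
  shows "(\<lambda>x. m x * f x) \<in> L2"
proof (rule L2_bound[where w = "\<lambda>x. C\<^sup>2 * (cmod (f x))\<^sup>2"])
  show "AE x in lborel. (cmod (m x * f x))\<^sup>2 \<le> C\<^sup>2 * (cmod (f x))\<^sup>2"
    using assms(3) by (auto simp: norm_mult power_mult_distrib intro!: mult_right_mono power_mono)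
qed (use assms in \<open>auto intro: L2_measurable L2_integrable_square\<close>)

lemma L2_scale [simp, intro]: "f \<in> L2 \<Longrightarrow> (\<lambda>x. c * f x) \<in> L2"
  by (rule L2_bounded_mult[where C = "cmod c"]) auto

lemma L2_uminus [simp, intro]: "f \<in> L2 \<Longrightarrow> (\<lambda>x. - f x) \<in> L2"
  using L2_scale[of f "-1"] by simp

lemma L2_diff [simp, intro]: "f \<in> L2 \<Longrightarrow> h \<in> L2 \<Longrightarrow> (\<lambda>x. f x - h x) \<in> L2"
  using L2_add[of f "\<lambda>x. - h x"] by simp

lemma L2_zero [simp, intro]: "(\<lambda>x. 0) \<in> L2"
  by (rule L2I) auto

lemma L2_sum [simp, intro]: "(\<And>i. i \<in> A \<Longrightarrow> f i \<in> L2) \<Longrightarrow> (\<lambda>x. \<Sum>i\<in>A. f i x) \<in> L2"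
  by (induction A rule: infinite_finite_induct) auto

lemma L2_cnj [simp, intro]: "f \<in> L2 \<Longrightarrow> (\<lambda>x. cnj (f x)) \<in> L2"
  by (rule L2_bound[where w = "\<lambda>x. (cmod (f x))\<^sup>2"])
    (auto intro: L2_measurable L2_integrable_square borel_measurable_continuous_on continuous_on_cnj)

lemma L2_norm_fun [simp, intro]: "f \<in> L2 \<Longrightarrow> (\<lambda>x. complex_of_real (cmod (f x))) \<in> L2"
  by (rule L2_bound[where w = "\<lambda>x. (cmod (f x))\<^sup>2"])
    (auto intro: L2_measurable L2_integrable_square)

lemma L2_indicator:
  assumes "f \<in> L2" "A \<in> sets borel"
  shows "(\<lambda>x. indicator A x * f x) \<in> L2"
  by (rule L2_bounded_mult[OF assms(1), where C = 1])
    (use assms in \<open>auto simp: indicator_def\<close>)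

lemma L2_mult_integrable:
  assumes "f \<in> L2" "h \<in> L2"
  shows "integrable lborel (\<lambda>x. f x * h x)"
proof (rule Bochner_Integration.integrable_bound)
  show "integrable lborel (\<lambda>x. (cmod (f x))\<^sup>2 + (cmod (h x))\<^sup>2)"
    using assms by (auto intro: L2_integrable_square)
  show "AE x in lborel. norm (f x * h x) \<le> norm ((cmod (f x))\<^sup>2 + (cmod (h x))\<^sup>2)"
  proof (intro AE_I2)
    fix x
    show "norm (f x * h x) \<le> norm ((cmod (f x))\<^sup>2 + (cmod (h x))\<^sup>2)"
      using sum_squares_bound[of "cmod (f x)" "cmod (h x)"]
        mult_nonneg_nonneg[OF norm_ge_zero norm_ge_zero, of "f x" "h x"]
      unfolding norm_mult real_norm_def by linarith
  qed
qed (use assms in \<open>auto intro: L2_measurable\<close>)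

lemma L2_inner_integrable: "f \<in> L2 \<Longrightarrow> h \<in> L2 \<Longrightarrow> integrable lborel (\<lambda>x. f x * cnj (h x))"
  by (rule L2_mult_integrable) auto

section \<open>Classes of square integrable functions\<close>

definition l2_rel :: "('a::euclidean_space \<Rightarrow> complex) \<Rightarrow> ('a \<Rightarrow> complex) \<Rightarrow> bool" where
  "l2_rel f h \<longleftrightarrow> f \<in> L2 \<and> h \<in> L2 \<and> (AE x in lborel. f x = h x)"

\<comment> \<open>The relation is partial: a function outside \<open>L2\<close> is not related to
  itself, so classes contain only square integrable functions, and facts about \<open>cls f\<close>
  ask for membership of \<open>f\<close> in \<open>L2\<close>.\<close>
quotient_type (overloaded) 'a L2_space = "'a::euclidean_space \<Rightarrow> complex" / partial: l2_rel
proof (rule part_equivpI)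
  show "\<exists>f::'a \<Rightarrow> complex. l2_rel f f"
    by (intro exI[of _ "\<lambda>_. 0"]) (auto simp: l2_rel_def)
qed (auto simp: l2_rel_def symp_def transp_def)

definition cls :: "('a::euclidean_space \<Rightarrow> complex) \<Rightarrow> 'a L2_space" where
  "cls = abs_L2_space"

definition rep :: "'a::euclidean_space L2_space \<Rightarrow> 'a \<Rightarrow> complex" where
  "rep = rep_L2_space"

lemma cls_eq_iff: "f \<in> L2 \<Longrightarrow> h \<in> L2 \<Longrightarrow> cls f = cls h \<longleftrightarrow> (AE x in lborel. f x = h x)"
  unfolding cls_def using Quotient3_rel[OF Quotient3_L2_space, of f h] by (simp add: l2_rel_def)

lemma rep_L2 [simp, intro]: "rep x \<in> L2"
  using Quotient3_rep_reflp[OF Quotient3_L2_space, of x] by (simp add: rep_def l2_rel_def)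

lemma cls_rep [simp]: "cls (rep x) = x"
  by (simp add: cls_def rep_def Quotient3_abs_rep[OF Quotient3_L2_space])

lemma rep_cls: "f \<in> L2 \<Longrightarrow> AE x in lborel. rep (cls f) x = f x"
  by (subst cls_eq_iff[symmetric]) auto

lemma L2_space_cases [case_names cls]: obtains f where "f \<in> L2" "x = cls f"
  by (metis cls_rep rep_L2)

lemma L2_mult_cnj_measurable [intro]:
  "f \<in> L2 \<Longrightarrow> h \<in> L2 \<Longrightarrow> (\<lambda>x. f x * cnj (h x)) \<in> borel_measurable borel"
  by (intro borel_measurable_times L2_measurable L2_cnj)

lemma l2_inner_cong_AE:
  assumes "f \<in> L2" "f' \<in> L2" "h \<in> L2" "h' \<in> L2"
    "AE x in lborel. f x = f' x" "AE x in lborel. h x = h' x"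
  shows "l2_inner f h = l2_inner f' h'"
  unfolding l2_inner_def
proof (rule integral_cong_AE)
  show "AE x in lborel. f x * cnj (h x) = f' x * cnj (h' x)"
    using assms(5,6) by eventually_elim simp
qed (use assms in auto)

lemma l2_inner_add_left:
  "f \<in> L2 \<Longrightarrow> f' \<in> L2 \<Longrightarrow> h \<in> L2 \<Longrightarrow> l2_inner (\<lambda>x. f x + f' x) h = l2_inner f h + l2_inner f' h"
  by (simp add: l2_inner_def distrib_right L2_inner_integrable)

lemma l2_inner_scale_left: "l2_inner (\<lambda>x. c * f x) h = c * l2_inner f h"
  by (simp add: l2_inner_def mult.assoc)

lemma cnj_l2_inner: "cnj (l2_inner f h) = l2_inner h f"
  unfolding l2_inner_def by (subst Bochner_Integration.integral_cnj[symmetric]) (simp add: mult.commute)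

lemma l2_inner_self: "l2_inner f f = of_real (LINT x|lborel. (cmod (f x))\<^sup>2)"
  unfolding l2_inner_def
  by (simp only: complex_norm_square[symmetric] integral_complex_of_real)

lemma l2_norm_square: "(l2_norm f)\<^sup>2 = (LINT x|lborel. (cmod (f x))\<^sup>2)"
  by (simp add: l2_norm_def)

text \<open>The pointwise inequality 2 * a * b \<le> (B / A) * a^2 + (A / B) * b^2 is integrated
  with the two norms as weights A and B, for which the right side of the expanded square becomes (A
  + B)^2.\<close>

lemma l2_norm_triangle:
  assumes "f \<in> L2" "h \<in> L2"
  shows "l2_norm (\<lambda>x. f x + h x) \<le> l2_norm f + l2_norm h"
proof (rule field_le_epsilon)
  fix e :: real assume e: "e > 0"
  \<comment> \<open>The summand e / 2 keeps both weights positive when a norm vanishes.\<close>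
  define A B where "A = l2_norm f + e / 2" and "B = l2_norm h + e / 2"
  have AB: "0 < A" "0 < B" using e by (auto simp: A_def B_def l2_norm_def add_nonneg_pos)
  have pt: "(cmod (a + b))\<^sup>2 \<le> (1 + B / A) * (cmod a)\<^sup>2 + (1 + A / B) * (cmod b)\<^sup>2" for a b
  proof -
    have "2 * (B * cmod a) * (A * cmod b) \<le> (B * cmod a)\<^sup>2 + (A * cmod b)\<^sup>2"
      by (rule sum_squares_bound)
    then have "(2 * (B * cmod a) * (A * cmod b)) / (A * B) \<le> ((B * cmod a)\<^sup>2 + (A * cmod b)\<^sup>2) / (A * B)"
      using AB by (intro divide_right_mono) auto
    then have "2 * cmod a * cmod b \<le> B / A * (cmod a)\<^sup>2 + A / B * (cmod b)\<^sup>2"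
      using AB by (simp add: field_simps power2_eq_square)
    moreover have "(cmod (a + b))\<^sup>2 \<le> (cmod a + cmod b)\<^sup>2"
      by (intro power_mono norm_triangle_ineq) auto
    ultimately show ?thesis by (simp add: power2_sum algebra_simps)
  qed
  have "(l2_norm (\<lambda>x. f x + h x))\<^sup>2 \<le>
      (LINT x|lborel. (1 + B / A) * (cmod (f x))\<^sup>2 + (1 + A / B) * (cmod (h x))\<^sup>2)"
    unfolding l2_norm_square
    by (intro integral_mono L2_integrable_square L2_add assms Bochner_Integration.integrable_add
        integrable_mult_right pt)
  also have "\<dots> = (1 + B / A) * (l2_norm f)\<^sup>2 + (1 + A / B) * (l2_norm h)\<^sup>2"
    by (simp add: l2_norm_square L2_integrable_square assms)
  also have "\<dots> \<le> (1 + B / A) * A\<^sup>2 + (1 + A / B) * B\<^sup>2"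
    using e AB by (intro add_mono mult_left_mono power_mono) (auto simp: A_def B_def l2_norm_def)
  also have "\<dots> = (A + B)\<^sup>2"
    using AB by (simp add: field_simps power2_eq_square)
  finally have "l2_norm (\<lambda>x. f x + h x) \<le> A + B"
    by (rule power2_le_imp_le) (use AB in simp)
  then show "l2_norm (\<lambda>x. f x + h x) \<le> l2_norm f + l2_norm h + e"
    by (simp add: A_def B_def)
qed

lemma l2_norm_cong_AE:
  assumes "f \<in> L2" "h \<in> L2" "AE x in lborel. f x = h x"
  shows "l2_norm f = l2_norm h"
  using l2_inner_cong_AE[OF assms(1,2) assms(1,2) assms(3) assms(3)]
  by (simp add: l2_norm_def l2_inner_self)

lemma l2_norm_eq_0_iff: "f \<in> L2 \<Longrightarrow> l2_norm f = 0 \<longleftrightarrow> (AE x in lborel. f x = 0)"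
  using integral_nonneg_eq_0_iff_AE[OF L2_integrable_square[of f]]
  by (simp add: l2_norm_def)

instantiation L2_space :: (euclidean_space) real_vector
begin

definition zero_L2_space :: "'a L2_space" where "0 = cls (\<lambda>_. 0)"
definition plus_L2_space :: "'a L2_space \<Rightarrow> 'a L2_space \<Rightarrow> 'a L2_space" where
  "x + y = cls (\<lambda>t. rep x t + rep y t)"
definition uminus_L2_space :: "'a L2_space \<Rightarrow> 'a L2_space" where "- x = cls (\<lambda>t. - rep x t)"
definition minus_L2_space :: "'a L2_space \<Rightarrow> 'a L2_space \<Rightarrow> 'a L2_space" where
  "x - y = cls (\<lambda>t. rep x t - rep y t)"
definition scaleR_L2_space :: "real \<Rightarrow> 'a L2_space \<Rightarrow> 'a L2_space" where
  "r *\<^sub>R x = cls (\<lambda>t. of_real r * rep x t)"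

lemma cls_add: "f \<in> L2 \<Longrightarrow> h \<in> L2 \<Longrightarrow> cls f + cls h = cls (\<lambda>x. f x + h x)"
  unfolding plus_L2_space_def using rep_cls[of f] rep_cls[of h]
  by (subst cls_eq_iff) (auto elim!: eventually_elim2)

lemma cls_uminus: "f \<in> L2 \<Longrightarrow> - cls f = cls (\<lambda>x. - f x)"
  unfolding uminus_L2_space_def using rep_cls[of f]
  by (subst cls_eq_iff) (auto elim!: eventually_mono)

lemma cls_diff: "f \<in> L2 \<Longrightarrow> h \<in> L2 \<Longrightarrow> cls f - cls h = cls (\<lambda>x. f x - h x)"
  unfolding minus_L2_space_def using rep_cls[of f] rep_cls[of h]
  by (subst cls_eq_iff) (auto elim!: eventually_elim2)

lemma cls_scaleR: "f \<in> L2 \<Longrightarrow> r *\<^sub>R cls f = cls (\<lambda>x. of_real r * f x)"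
  unfolding scaleR_L2_space_def using rep_cls[of f]
  by (subst cls_eq_iff) (auto elim!: eventually_mono)

instance
proof
  fix x y z :: "'a L2_space" and a b :: real
  obtain f where f: "f \<in> L2" "x = cls f" by (rule L2_space_cases)
  obtain g where g: "g \<in> L2" "y = cls g" by (rule L2_space_cases)
  obtain h where h: "h \<in> L2" "z = cls h" by (rule L2_space_cases)
  note [simp] = f g h cls_add cls_scaleR cls_uminus cls_diff zero_L2_space_def
  show "x + y + z = x + (y + z)" by (simp add: add.assoc)
  show "x + y = y + x" by (simp add: add.commute)
  show "0 + x = x" by simp
  show "- x + x = 0" by simp
  show "x - y = x + - y" by simp
  show "a *\<^sub>R (x + y) = a *\<^sub>R x + a *\<^sub>R y" by (simp add: distrib_left)
  show "(a + b) *\<^sub>R x = a *\<^sub>R x + b *\<^sub>R x" by (simp add: distrib_right)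
  show "a *\<^sub>R b *\<^sub>R x = (a * b) *\<^sub>R x" by (simp add: mult.assoc)
  show "1 *\<^sub>R x = x" by simp
qed

end

instantiation L2_space :: (euclidean_space) real_normed_vector
begin

definition norm_L2_space_def: "norm (x :: 'a L2_space) = l2_norm (rep x)"
definition sgn_L2_space_def: "sgn (x :: 'a L2_space) = x /\<^sub>R norm x"
definition dist_L2_space_def: "dist (x :: 'a L2_space) y = norm (x - y)"
definition uniformity_L2_space_def [code del]:
  "(uniformity :: ('a L2_space \<times> 'a L2_space) filter) =
     (INF e\<in>{0 <..}. principal {(x, y). dist x y < e})"
definition open_L2_space_def [code del]:
  "open (U :: 'a L2_space set) \<longleftrightarrow> (\<forall>x\<in>U. \<forall>\<^sub>F (x', y) in uniformity. x' = x \<longrightarrow> y \<in> U)"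

lemma norm_cls: "f \<in> L2 \<Longrightarrow> norm (cls f) = l2_norm f"
  unfolding norm_L2_space_def by (rule l2_norm_cong_AE) (auto intro: rep_cls)

instance
proof
  fix x y :: "'a L2_space" and a :: real
  obtain f where f: "f \<in> L2" "x = cls f" by (rule L2_space_cases)
  obtain g where g: "g \<in> L2" "y = cls g" by (rule L2_space_cases)
  note [simp] = f g cls_add cls_scaleR norm_cls zero_L2_space_def
  show "sgn x = inverse (norm x) *\<^sub>R x" by (rule sgn_L2_space_def)
  show "dist x y = norm (x - y)" by (rule dist_L2_space_def)
  show "uniformity = (INF e\<in>{0 <..}. principal {(x :: 'a L2_space, y). dist x y < e})"
    by (rule uniformity_L2_space_def)
  show "open U = (\<forall>x\<in>U. \<forall>\<^sub>F (x', y) in uniformity. x' = x \<longrightarrow> y \<in> U)" for U :: "'a L2_space set"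
    by (rule open_L2_space_def)
  show "norm x = 0 \<longleftrightarrow> x = 0" by (simp add: l2_norm_eq_0_iff cls_eq_iff)
  show "norm (x + y) \<le> norm x + norm y" by (simp add: l2_norm_triangle)
  show "norm (a *\<^sub>R x) = \<bar>a\<bar> * norm x"
    by (simp add: l2_norm_def norm_mult power_mult_distrib real_sqrt_mult)
qed

end

instantiation L2_space :: (euclidean_space) real_inner
begin

definition inner_L2_space :: "'a L2_space \<Rightarrow> 'a L2_space \<Rightarrow> real" where
  "inner x y = Re (l2_inner (rep x) (rep y))"

lemma inner_cls: "f \<in> L2 \<Longrightarrow> h \<in> L2 \<Longrightarrow> inner (cls f) (cls h) = Re (l2_inner f h)"
  unfolding inner_L2_space_def
  by (subst l2_inner_cong_AE[of _ f _ h]) (auto intro: rep_cls)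

instance
proof
  fix x y z :: "'a L2_space" and a b :: real
  obtain f where f: "f \<in> L2" "x = cls f" by (rule L2_space_cases)
  obtain g where g: "g \<in> L2" "y = cls g" by (rule L2_space_cases)
  obtain h where h: "h \<in> L2" "z = cls h" by (rule L2_space_cases)
  note [simp] = f g h cls_add cls_scaleR inner_cls
  show "inner x y = inner y x"
    using arg_cong[OF cnj_l2_inner[of f g], of Re] by simp
  show "inner (x + y) z = inner x z + inner y z" by (simp add: l2_inner_add_left)
  show "inner (a *\<^sub>R x) y = a * inner x y" by (simp add: l2_inner_scale_left)
  show "0 \<le> inner x x" by (simp add: l2_inner_self)
  show n: "norm x = sqrt (inner x x)"
    by (simp add: norm_cls l2_inner_self l2_norm_def)
  have "inner x x = 0 \<longleftrightarrow> norm x = 0" unfolding n by simp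
  then show "inner x x = 0 \<longleftrightarrow> x = 0" by simp
qed

end

lemma cls_sum:
  "(\<And>i. i \<in> A \<Longrightarrow> f i \<in> L2) \<Longrightarrow> (\<Sum>i\<in>A. cls (f i)) = cls (\<lambda>x. \<Sum>i\<in>A. f i x)"
  by (induction A rule: infinite_finite_induct) (auto simp: zero_L2_space_def cls_add)

lemma nn_integral_L2:
  "f \<in> L2 \<Longrightarrow> (\<integral>\<^sup>+x. ennreal ((cmod (f x))\<^sup>2) \<partial>lborel) = ennreal ((norm (cls f))\<^sup>2)"
  by (subst nn_integral_eq_integral) (auto simp: L2_integrable_square norm_cls l2_norm_square)

lemma norm_cls_norm: "f \<in> L2 \<Longrightarrow> norm (cls (\<lambda>x. complex_of_real (cmod (f x)))) = norm (cls f)"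
  by (simp add: norm_cls l2_norm_def)

text \<open>The Riesz-Fischer argument: along a subsequence with steps below 2^-n the moduli of the
  increments have a square integrable sum, so the subsequence converges almost everywhere, and
  Fatou's lemma makes its limit a limit in norm.\<close>

instance L2_space :: (euclidean_space) complete_space
proof
  fix X :: "nat \<Rightarrow> 'a L2_space" assume X: "Cauchy X"
  define f where "f n = rep (X n)" for n
  have f [simp, intro]: "f n \<in> L2" and Xf: "X n = cls (f n)" for n
    by (auto simp: f_def)
  have "\<exists>r. \<forall>n. (\<forall>m\<ge>r n. dist (X m) (X (r n)) < (1/2)^n) \<and> r n < r (Suc n)"
  proof (rule dependent_nat_choice)
    show "\<exists>x. \<forall>m\<ge>x. dist (X m) (X x) < (1/2)^0"
      using X[unfolded Cauchy_altdef2, rule_format, of 1] by simp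
  next
    fix x n
    have "(1/2::real)^Suc n > 0" by simp
    from X[unfolded Cauchy_def, rule_format, OF this]
    obtain N where N: "\<And>m n'. m \<ge> N \<Longrightarrow> n' \<ge> N \<Longrightarrow> dist (X m) (X n') < (1/2)^Suc n"
      by auto
    show "\<exists>y. (\<forall>m\<ge>y. dist (X m) (X y) < (1/2)^Suc n) \<and> x < y"
      by (intro exI[of _ "max N (Suc x)"] conjI allI impI N) auto
  qed
  then obtain r where r: "\<And>n m. m \<ge> r n \<Longrightarrow> dist (X m) (X (r n)) < (1/2)^n" "\<And>n. r n < r (Suc n)"
    by blast
  define d where "d n x = f (r (Suc n)) x - f (r n) x" for n x
  have d [simp, intro]: "d n \<in> L2" for n by (auto simp: d_def[abs_def])
  have nd: "norm (cls (d n)) \<le> (1/2)^n" for n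
    using r(1)[of n "r (Suc n)"] r(2)[of n]
    by (simp add: d_def[abs_def] dist_norm Xf cls_diff)
  define G where "G N x = (\<Sum>n<N. cmod (d n x))" for N x
  have GL2: "(\<lambda>x. complex_of_real (G N x)) \<in> L2" for N
    unfolding G_def of_real_sum by (intro L2_sum L2_norm_fun d)
  have G0: "0 \<le> G N x" for N x by (auto simp: G_def intro: sum_nonneg)
  \<comment> \<open>The norms of the increments add up to at most 2; the constant is the square of
    this.\<close>
  have G: "(\<integral>\<^sup>+x. ennreal ((G N x)\<^sup>2) \<partial>lborel) \<le> ennreal 4" for N
  proof -
    have "norm (cls (\<lambda>x. complex_of_real (G N x))) = norm (\<Sum>n<N. cls (\<lambda>x. complex_of_real (cmod (d n x))))"
      by (simp add: cls_sum G_def)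
    also have "\<dots> \<le> (\<Sum>n<N. norm (cls (d n)))"
      by (rule order_trans[OF norm_sum]) (simp add: norm_cls_norm)
    also have "\<dots> \<le> (\<Sum>n<N. (1/2)^n)" by (intro sum_mono nd)
    also have "\<dots> \<le> 2" by (simp add: geometric_sum)
    finally have "(norm (cls (\<lambda>x. complex_of_real (G N x))))\<^sup>2 \<le> 2\<^sup>2"
      by (intro power_mono) auto
    then have "ennreal ((norm (cls (\<lambda>x. complex_of_real (G N x))))\<^sup>2) \<le> ennreal 4"
      by (intro ennreal_leI) simp
    then show ?thesis
      using nn_integral_L2[OF GL2, of N] by simp
  qed
  have [measurable]: "d n \<in> borel_measurable borel" "f n \<in> borel_measurable borel" for n
    by (auto intro: L2_measurable)
  have Gm [measurable]: "G N \<in> borel_measurable borel" for N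
    unfolding G_def[abs_def] by measurable
  have "(\<integral>\<^sup>+x. (SUP N. ennreal ((G N x)\<^sup>2)) \<partial>lborel) = (SUP N. \<integral>\<^sup>+x. ennreal ((G N x)\<^sup>2) \<partial>lborel)"
  proof (rule nn_integral_monotone_convergence_SUP)
    show "incseq (\<lambda>N x. ennreal ((G N x)\<^sup>2))"
      by (auto simp: incseq_def le_fun_def G_def intro!: ennreal_leI power_mono sum_mono2 sum_nonneg)
  qed measurable
  also have "\<dots> \<le> ennreal 4" by (rule SUP_least) (rule G)
  finally have "(\<integral>\<^sup>+x. (SUP N. ennreal ((G N x)\<^sup>2)) \<partial>lborel) \<noteq> \<infinity>"
    by (auto simp: top_unique)
  then have "AE x in lborel. (SUP N. ennreal ((G N x)\<^sup>2)) \<noteq> \<infinity>"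
    by (intro nn_integral_PInf_AE) measurable
  then have conv: "AE x in lborel. convergent (\<lambda>n. f (r n) x)"
  proof eventually_elim
    fix x assume "(SUP N. ennreal ((G N x)\<^sup>2)) \<noteq> \<infinity>"
    then obtain K where K: "(SUP N. ennreal ((G N x)\<^sup>2)) = ennreal K" "0 \<le> K"
      by (cases "SUP N. ennreal ((G N x)\<^sup>2)") auto
    have "G N x \<le> sqrt K" for N
    proof -
      have "ennreal ((G N x)\<^sup>2) \<le> ennreal K" unfolding K(1)[symmetric] by (rule SUP_upper) simp
      then show ?thesis using K(2) by (simp add: real_le_rsqrt)
    qed
    then have "summable (\<lambda>n. cmod (d n x))"
      by (intro summableI_nonneg_bounded[where x = "sqrt K"]) (auto simp: G_def)
    then have "summable (\<lambda>n. d n x)" by (rule summable_norm_cancel)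
    then have "convergent (\<lambda>N. f (r 0) x + (\<Sum>n<N. d n x))"
      by (intro convergent_add convergent_const) (simp add: summable_iff_convergent)
    then show "convergent (\<lambda>n. f (r n) x)"
      using sum_lessThan_telescope[of "\<lambda>n. f (r n) x"] by (simp add: d_def)
  qed
  define F where "F x = lim (\<lambda>n. f (r n) x)" for x
  have F [measurable]: "F \<in> borel_measurable borel"
    unfolding F_def[abs_def] by measurable
  have lim: "AE x in lborel. (\<lambda>n. f (r n) x) \<longlonglongrightarrow> F x"
    using conv by eventually_elim (simp add: F_def convergent_LIMSEQ_iff)
  \<comment> \<open>The limit is taken along \<open>r\<close> with \<open>m\<close> fixed, so the
    Cauchy condition bounds every integral whose lower limit is taken.\<close>
  have fatou: "(\<integral>\<^sup>+x. ennreal ((cmod (F x - f m x))\<^sup>2) \<partial>lborel) \<le> ennreal (e\<^sup>2)"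
    if e: "e > 0" "\<And>n. n \<ge> N \<Longrightarrow> dist (X n) (X m) \<le> e" for e N m
  proof -
    have "(\<integral>\<^sup>+x. ennreal ((cmod (F x - f m x))\<^sup>2) \<partial>lborel) =
        (\<integral>\<^sup>+x. liminf (\<lambda>n. ennreal ((cmod (f (r n) x - f m x))\<^sup>2)) \<partial>lborel)"
    proof (rule nn_integral_cong_AE)
      show "AE x in lborel. ennreal ((cmod (F x - f m x))\<^sup>2) =
          liminf (\<lambda>n. ennreal ((cmod (f (r n) x - f m x))\<^sup>2))"
        using lim
      proof eventually_elim
        fix x assume "(\<lambda>n. f (r n) x) \<longlonglongrightarrow> F x"
        then have "(\<lambda>n. ennreal ((cmod (f (r n) x - f m x))\<^sup>2)) \<longlonglongrightarrow> ennreal ((cmod (F x - f m x))\<^sup>2)"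
          by (intro tendsto_intros)
        then show "ennreal ((cmod (F x - f m x))\<^sup>2) =
          liminf (\<lambda>n. ennreal ((cmod (f (r n) x - f m x))\<^sup>2))"
          by (intro lim_imp_Liminf[symmetric]) auto
      qed
    qed
    also have "\<dots> \<le> liminf (\<lambda>n. \<integral>\<^sup>+x. ennreal ((cmod (f (r n) x - f m x))\<^sup>2) \<partial>lborel)"
      by (intro nn_integral_liminf) measurable
    also have "\<dots> = liminf (\<lambda>n. ennreal ((dist (X (r n)) (X m))\<^sup>2))"
      by (simp add: nn_integral_L2 dist_norm Xf cls_diff)
    also have "\<dots> \<le> liminf (\<lambda>n. ennreal (e\<^sup>2))"
    proof (rule Liminf_mono, rule eventually_sequentiallyI[of N])
      fix n assume "N \<le> n"
      moreover have "n \<le> r n" using r(2) by (intro seq_suble) (simp add: strict_mono_Suc_iff)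
      ultimately show "ennreal ((dist (X (r n)) (X m))\<^sup>2) \<le> ennreal (e\<^sup>2)"
        using e(2)[of "r n"] by (intro ennreal_leI power_mono) auto
    qed
    also have "\<dots> = ennreal (e\<^sup>2)" by (simp add: Liminf_const)
    finally show ?thesis .
  qed
  have diffL2: "(\<lambda>x. F x - f m x) \<in> L2"
    if "(\<integral>\<^sup>+x. ennreal ((cmod (F x - f m x))\<^sup>2) \<partial>lborel) \<le> ennreal (e\<^sup>2)" for m e
    using that f[of m] 
    by (intro L2I integrableI_bounded) (auto intro: L2_measurable simp: top_unique le_less_trans)
  have FL2: "F \<in> L2"
  proof -
    obtain M where M: "\<And>m n. m \<ge> M \<Longrightarrow> n \<ge> M \<Longrightarrow> dist (X m) (X n) < 1"
      using X[unfolded Cauchy_def, rule_format, of 1] by auto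
    have "(\<lambda>x. F x - f M x) \<in> L2"
      using M by (intro diffL2[of _ 1] fatou[of 1 M]) (auto intro: less_imp_le)
    from L2_add[OF this f[of M]] show ?thesis by simp
  qed
  have "X \<longlonglongrightarrow> cls F"
  proof (rule metric_LIMSEQ_I)
    fix e :: real assume e: "0 < e"
    then obtain M where M: "\<And>m n. m \<ge> M \<Longrightarrow> n \<ge> M \<Longrightarrow> dist (X m) (X n) < e / 2"
      using X[unfolded Cauchy_def, rule_format, of "e / 2"] by auto
    have "dist (X m) (cls F) < e" if "m \<ge> M" for m
    proof -
      have "(\<integral>\<^sup>+x. ennreal ((cmod (F x - f m x))\<^sup>2) \<partial>lborel) \<le> ennreal ((e/2)\<^sup>2)"
        using M that e by (intro fatou[of "e/2" M]) (auto intro: less_imp_le)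
      then have "(norm (cls (\<lambda>x. F x - f m x)))\<^sup>2 \<le> (e/2)\<^sup>2"
        using FL2 by (subst (asm) nn_integral_L2) auto
      then have "norm (cls (\<lambda>x. F x - f m x)) \<le> e / 2"
        by (rule power2_le_imp_le) (use e in simp)
      then have "dist (cls F) (X m) \<le> e / 2"
        using FL2 by (simp add: dist_norm Xf cls_diff)
      then show ?thesis
        using e by (simp add: dist_commute)
    qed
    then show "\<exists>no. \<forall>n\<ge>no. dist (X n) (cls F) < e" by blast
  qed
  then show "convergent X" by (rule convergentI)
qed

instantiation L2_space :: (euclidean_space) complex_hilbert
begin

definition scaleC_L2_space :: "complex \<Rightarrow> 'a L2_space \<Rightarrow> 'a L2_space" where
  "c *\<^sub>C x = cls (\<lambda>t. c * rep x t)"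
definition cinner_L2_space :: "'a L2_space \<Rightarrow> 'a L2_space \<Rightarrow> complex" where
  "cinner x y = l2_inner (rep x) (rep y)"

lemma cls_scaleC: "f \<in> L2 \<Longrightarrow> c *\<^sub>C cls f = cls (\<lambda>x. c * f x)"
  unfolding scaleC_L2_space_def using rep_cls[of f]
  by (subst cls_eq_iff) (auto elim!: eventually_mono)

lemma cinner_cls: "f \<in> L2 \<Longrightarrow> h \<in> L2 \<Longrightarrow> cinner (cls f) (cls h) = l2_inner f h"
  unfolding cinner_L2_space_def by (rule l2_inner_cong_AE) (auto intro: rep_cls)

instance
proof
  fix x y z :: "'a L2_space" and a b :: complex and r :: real
  obtain f where f: "f \<in> L2" "x = cls f" by (rule L2_space_cases)
  obtain g where g: "g \<in> L2" "y = cls g" by (rule L2_space_cases)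
  obtain h where h: "h \<in> L2" "z = cls h" by (rule L2_space_cases)
  note [simp] = f g h cls_add cls_scaleR cls_scaleC inner_cls cinner_cls
  show "complex_of_real r *\<^sub>C x = r *\<^sub>R x" by simp
  show "a *\<^sub>C b *\<^sub>C x = (a * b) *\<^sub>C x" by (simp add: mult.assoc)
  show "(a + b) *\<^sub>C x = a *\<^sub>C x + b *\<^sub>C x" by (simp add: distrib_right)
  show "a *\<^sub>C (x + y) = a *\<^sub>C x + a *\<^sub>C y" by (simp add: distrib_left)
  show "cinner (x + y) z = cinner x z + cinner y z" by (simp add: l2_inner_add_left)
  show "cinner (a *\<^sub>C x) y = a * cinner x y" by (simp add: l2_inner_scale_left)
  show "cnj (cinner x y) = cinner y x" by (simp add: cnj_l2_inner)
  show "Re (cinner x y) = inner x y" by simp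
qed

end


section \<open>From families of functions to families of classes\<close>

lemma all_L2_space: "(\<forall>x. P x) \<longleftrightarrow> (\<forall>f\<in>L2. P (cls f))"
  by (metis L2_space_cases)

lemma L2_familyD: "L2_family J \<phi> \<Longrightarrow> j \<in> J \<Longrightarrow> \<phi> j \<in> L2"
  by (auto simp: L2_family_def)

lemma coef_cls_cong:
  assumes "L2_family J \<phi>" "f \<in> L2"
  shows "(\<lambda>j. (cmod (cinner (cls f) (cls (\<phi> j))))\<^sup>2) summable_on J \<longleftrightarrow>
      (\<lambda>j. (cmod (l2_inner f (\<phi> j)))\<^sup>2) summable_on J"
    "frame_energy J (\<lambda>j. cls (\<phi> j)) (cls f) = (\<Sum>\<^sub>\<infinity>j\<in>J. (cmod (l2_inner f (\<phi> j)))\<^sup>2)"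
  unfolding frame_energy_def using assms
  by (auto intro!: summable_on_cong infsum_cong simp: cinner_cls L2_familyD)

lemma cls_combination:
  assumes "L2_family J \<phi>" "F \<subseteq> J"
  shows "(\<Sum>j\<in>F. c j *\<^sub>C cls (\<phi> j)) = cls (\<lambda>x. \<Sum>j\<in>F. c j * \<phi> j x)"
    "(\<lambda>x. \<Sum>j\<in>F. c j * \<phi> j x) \<in> L2"
proof -
  have m: "\<phi> j \<in> L2" if "j \<in> F" for j using assms that by (auto intro: L2_familyD)
  then have "(\<Sum>j\<in>F. c j *\<^sub>C cls (\<phi> j)) = (\<Sum>j\<in>F. cls (\<lambda>x. c j * \<phi> j x))"
    by (intro sum.cong refl) (simp add: cls_scaleC)
  also have "\<dots> = cls (\<lambda>x. \<Sum>j\<in>F. c j * \<phi> j x)"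
    using m by (intro cls_sum) auto
  finally show "(\<Sum>j\<in>F. c j *\<^sub>C cls (\<phi> j)) = cls (\<lambda>x. \<Sum>j\<in>F. c j * \<phi> j x)" .
  show "(\<lambda>x. \<Sum>j\<in>F. c j * \<phi> j x) \<in> L2" using m by auto
qed

lemma bessel_bound_iff:
  "bessel_bound J \<phi> b \<longleftrightarrow> L2_family J \<phi> \<and> bessel J (\<lambda>j. cls (\<phi> j)) b"
  unfolding bessel_bound_def bessel_iff all_L2_space
  by (auto simp: coef_cls_cong norm_cls)

lemma frame_bounds_iff:
  "frame_bounds J \<phi> a b \<longleftrightarrow> L2_family J \<phi> \<and> 0 < a \<and> 0 < b \<and> bessel J (\<lambda>j. cls (\<phi> j)) b \<and>
     (\<forall>x. a * (norm x)\<^sup>2 \<le> frame_energy J (\<lambda>j. cls (\<phi> j)) x)"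
  unfolding frame_bounds_def bessel_iff all_L2_space
  by (auto simp: coef_cls_cong norm_cls)

lemma dense_span_iff:
  assumes "L2_family J \<phi>"
  shows "dense_span J \<phi> \<longleftrightarrow> dense_in J (\<lambda>j. cls (\<phi> j))"
proof -
  have "norm (cls f - (\<Sum>j\<in>F. c j *\<^sub>C cls (\<phi> j))) = l2_norm (\<lambda>x. f x - (\<Sum>j\<in>F. c j * \<phi> j x))"
    if "f \<in> L2" "F \<subseteq> J" for f F c
    using that by (simp add: cls_combination[OF assms] cls_diff norm_cls L2_diff)
  then show ?thesis
    unfolding dense_span_def dense_in_def all_L2_space
    by (intro ball_cong refl all_cong1 imp_cong ex_cong1) auto
qed

lemma riesz_basis_bounds_iff:
  "riesz_basis_bounds J \<phi> a b \<longleftrightarrow> L2_family J \<phi> \<and> 0 < a \<and> 0 < b \<and>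
     dense_in J (\<lambda>j. cls (\<phi> j)) \<and> riesz_seq J (\<lambda>j. cls (\<phi> j)) a b"
proof (cases "L2_family J \<phi>")
  case True
  have "norm (\<Sum>j\<in>F. c j *\<^sub>C cls (\<phi> j)) = l2_norm (\<lambda>x. \<Sum>j\<in>F. c j * \<phi> j x)"
    if "F \<subseteq> J" for F c
    using that by (simp add: cls_combination[OF True] norm_cls)
  then show ?thesis
    unfolding riesz_basis_bounds_def riesz_seq_def dense_span_iff[OF True]
    by (intro conj_cong refl all_cong1 imp_cong) auto
qed (simp add: riesz_basis_bounds_def)

lemma orthonormal_basis_iff:
  "orthonormal_basis J \<phi> \<longleftrightarrow> L2_family J \<phi> \<and> dense_in J (\<lambda>j. cls (\<phi> j)) \<and>
     riesz_seq J (\<lambda>j. cls (\<phi> j)) 1 1"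
proof (cases "L2_family J \<phi>")
  case True
  then show ?thesis
    unfolding orthonormal_basis_def riesz_one_iff_orthonormal dense_span_iff[OF True]
    by (intro conj_cong refl ball_cong) (auto simp: cinner_cls L2_familyD)
qed (simp add: orthonormal_basis_def)

lemma is_frame_operator_iff:
  assumes "L2_family J \<phi>"
  shows "is_frame_operator J \<phi> S \<longleftrightarrow> (\<forall>f\<in>L2. S f \<in> L2 \<and>
    ((\<lambda>j. cinner (cls f) (cls (\<phi> j)) *\<^sub>C cls (\<phi> j)) has_sum cls (S f)) J)"
  unfolding is_frame_operator_def has_L2_sum_def
proof (intro ball_cong refl conj_cong)
  fix f :: "'b \<Rightarrow> complex" assume f: "f \<in> L2" and Sf: "S f \<in> L2"
  let ?t = "\<lambda>F. (\<Sum>j\<in>F. cinner (cls f) (cls (\<phi> j)) *\<^sub>C cls (\<phi> j))"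
  let ?u = "\<lambda>F. l2_norm (\<lambda>x. S f x - (\<Sum>j\<in>F. l2_inner f (\<phi> j) * \<phi> j x))"
  have eq: "dist (?t F) (cls (S f)) = ?u F" if "F \<subseteq> J" for F
  proof -
    have "?t F = (\<Sum>j\<in>F. l2_inner f (\<phi> j) *\<^sub>C cls (\<phi> j))"
      using that f assms by (intro sum.cong refl) (auto simp: cinner_cls L2_familyD subset_iff)
    then show ?thesis
      using that Sf cls_combination[OF assms that]
      by (subst dist_commute) (simp add: dist_norm cls_diff norm_cls)
  qed
  have "(?u \<longlongrightarrow> 0) (finite_subsets_at_top J) \<longleftrightarrow>
      ((\<lambda>F. dist (?t F) (cls (S f))) \<longlongrightarrow> 0) (finite_subsets_at_top J)"
    by (intro filterlim_cong refl eventually_finite_subsets_at_top_weakI) (simp add: eq)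
  also have "\<dots> \<longleftrightarrow> ((\<lambda>j. cinner (cls f) (cls (\<phi> j)) *\<^sub>C cls (\<phi> j)) has_sum cls (S f)) J"
    unfolding has_sum_def by (rule tendsto_dist_iff[symmetric])
  finally show "(?u \<longlongrightarrow> 0) (finite_subsets_at_top J) \<longleftrightarrow>
      ((\<lambda>j. cinner (cls f) (cls (\<phi> j)) *\<^sub>C cls (\<phi> j)) has_sum cls (S f)) J" .
qed

text \<open>Boundedness makes the product with any window square integrable, and bounded support
  leaves boundedly many integer translates at each point. Continuity is not demanded, so that
  truncations of \<open>L2\<close> functions qualify.\<close>

definition test_fun :: "('a::euclidean_space \<Rightarrow> complex) \<Rightarrow> bool" where
  "test_fun f \<longleftrightarrow> f \<in> borel_measurable borel \<and> (\<exists>C. \<forall>x. cmod (f x) \<le> C) \<and>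
     (\<exists>M. \<forall>x. f x \<noteq> 0 \<longrightarrow> norm x \<le> M)"

lemma test_fun_L2: "test_fun f \<Longrightarrow> f \<in> L2"
proof -
  assume f: "test_fun f"
  then obtain C M where C: "\<And>x. cmod (f x) \<le> C" and M: "\<And>x. f x \<noteq> 0 \<Longrightarrow> norm x \<le> M"
    by (auto simp: test_fun_def)
  show "f \<in> L2"
  proof (rule L2_bound)
    show "integrable lborel (\<lambda>x. indicator (cball 0 M) x * C\<^sup>2 :: real)"
      by (intro integrable_mult_left integrable_real_indicator) (auto simp: emeasure_bounded_finite[unfolded infinity_ennreal_def])
    show "AE x in lborel. (cmod (f x))\<^sup>2 \<le> indicator (cball 0 M) x * C\<^sup>2"
      using C M by (intro AE_I2) (auto simp: indicator_def intro!: power_mono)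
  qed (use f in \<open>auto simp: test_fun_def\<close>)
qed

text \<open>Cutting an \<open>L2\<close> function off where its argument or its value exceeds n
  gives test functions that converge to it by dominated convergence.\<close>

lemma closure_test_fun: "closure (cls ` {f. test_fun f}) = UNIV"
proof -
  have "cls f \<in> closure (cls ` {f. test_fun f})" if f: "f \<in> L2" for f :: "'a \<Rightarrow> complex"
  proof -
    have [measurable]: "f \<in> borel_measurable borel" using f by (rule L2_measurable)
    define A where "A n = {x. norm x \<le> real n \<and> cmod (f x) \<le> real n}" for n
    define u where "u n x = indicator (A n) x * f x" for n x
    have [measurable]: "A n \<in> sets borel" for n
      unfolding A_def by measurable
    have u: "test_fun (u n)" for n
      unfolding test_fun_def
    proof (intro conjI exI allI impI)
      show "u n \<in> borel_measurable borel" unfolding u_def[abs_def] by measurable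
      show "cmod (u n x) \<le> real n" for x by (auto simp: u_def A_def indicator_def)
      show "norm x \<le> real n" if "u n x \<noteq> 0" for x
        using that by (auto simp: u_def A_def indicator_def split: if_splits)
    qed
    have "(\<lambda>n. LINT x|lborel. (cmod (u n x - f x))\<^sup>2) \<longlonglongrightarrow> (LINT x|(lborel::'a measure). 0)"
    proof (rule integral_dominated_convergence[where w = "\<lambda>x. (cmod (f x))\<^sup>2"])
      show "AE x in lborel. (\<lambda>n. (cmod (u n x - f x))\<^sup>2) \<longlonglongrightarrow> 0"
      proof (intro AE_I2)
        fix x
        have "eventually (\<lambda>n. u n x = f x) sequentially"
          using eventually_ge_at_top[of "nat \<lceil>norm x\<rceil>"] eventually_ge_at_top[of "nat \<lceil>cmod (f x)\<rceil>"]
          by eventually_elim (simp add: u_def A_def nat_ceiling_le_eq)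
        then show "(\<lambda>n. (cmod (u n x - f x))\<^sup>2) \<longlonglongrightarrow> 0"
          by (intro tendsto_eventually) (auto elim: eventually_mono)
      qed
      show "AE x in lborel. norm ((cmod (u n x - f x))\<^sup>2) \<le> (cmod (f x))\<^sup>2" for n
        by (intro AE_I2) (auto simp: u_def indicator_def)
    qed (use f in \<open>auto intro: L2_integrable_square simp: u_def[abs_def]\<close>)
    then have "(\<lambda>n. sqrt (LINT x|lborel. (cmod (u n x - f x))\<^sup>2)) \<longlonglongrightarrow> 0"
      using tendsto_real_sqrt by fastforce
    then have "(\<lambda>n. dist (cls (u n)) (cls f)) \<longlonglongrightarrow> 0"
      using u f by (simp add: dist_norm cls_diff norm_cls test_fun_L2 L2_diff l2_norm_def)
    then have "(\<lambda>n. cls (u n)) \<longlonglongrightarrow> cls f"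
      by (simp add: tendsto_dist_iff[of _ "cls f"])
    then show ?thesis
      unfolding closure_sequential by (intro exI[of _ "\<lambda>n. cls (u n)"]) (auto intro: u)
  qed
  then show ?thesis
    by (metis L2_space_cases UNIV_eq_I)
qed

section \<open>Uniqueness of Fourier coefficients\<close>

definition wave :: "real ^ 'd \<Rightarrow> real ^ 'd \<Rightarrow> complex" where
  "wave y x = cis (2 * pi * (y \<bullet> x))"

lemma norm_wave [simp]: "cmod (wave y x) = 1"
  by (simp add: wave_def)

lemma wave_0_left [simp]: "wave 0 x = 1" and wave_0_right [simp]: "wave y 0 = 1"
  by (simp_all add: wave_def)

lemma wave_add_left: "wave (y + z) x = wave y x * wave z x"
  by (simp add: wave_def cis_mult inner_add_left algebra_simps)

lemma wave_add_right: "wave y (x + z) = wave y x * wave y z"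
  by (simp add: wave_def cis_mult inner_add_right algebra_simps)

lemma wave_minus_left: "wave (- y) x = cnj (wave y x)"
  by (simp add: wave_def cis_cnj)

lemma wave_minus_right: "wave y (- x) = cnj (wave y x)"
  by (simp add: wave_def cis_cnj)

lemma wave_diff_left: "wave (y - z) x = wave y x * cnj (wave z x)"
  using wave_add_left[of y "- z" x] by (simp add: wave_minus_left)

lemma wave_mult_cnj [simp]: "wave y x * cnj (wave y x) = 1" "cnj (wave y x) * wave y x = 1"
  using wave_diff_left[of y y x] by (simp_all add: mult.commute)

lemma wave_nonzero [simp]: "wave y x \<noteq> 0"
  by (simp add: wave_def)

lemma continuous_wave: "continuous_on A (wave y)"
  unfolding wave_def[abs_def] by (intro continuous_intros)

lemma wave_measurable [measurable]: "wave y \<in> borel_measurable borel"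
  by (intro borel_measurable_continuous_onI continuous_wave)

lemma real_vec_simps [simp]: "real_vec a $ i = real_of_int (a $ i)"
  by (simp add: real_vec_def)

lemma real_vec_add: "real_vec (a + b) = real_vec a + real_vec b"
  and real_vec_diff: "real_vec (a - b) = real_vec a - real_vec b"
  and real_vec_minus: "real_vec (- a) = - real_vec a"
  and real_vec_0 [simp]: "real_vec 0 = 0"
  by (simp_all add: vec_eq_iff)

lemma wave_of_int: "y \<bullet> x \<in> \<int> \<Longrightarrow> wave y x = 1"
  by (auto simp: wave_def Ints_def cis_multiple_2pi)

lemma real_vec_inner_Ints: "real_vec a \<bullet> real_vec b \<in> \<int>"
  by (auto simp: inner_vec_def)

lemma integrable_bounded_mult:
  fixes W m :: "'a::euclidean_space \<Rightarrow> complex"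
  assumes "integrable lborel W" "m \<in> borel_measurable borel" "\<And>x. cmod (m x) \<le> C"
  shows "integrable lborel (\<lambda>x. W x * m x)"
proof (rule Bochner_Integration.integrable_bound)
  show "integrable lborel (\<lambda>x. C * cmod (W x))"
    using assms by auto
  show "AE x in lborel. norm (W x * m x) \<le> norm (C * cmod (W x))"
  proof (intro AE_I2)
    fix x
    have "norm (W x * m x) \<le> C * cmod (W x)"
      using mult_left_mono[OF assms(3)[of x], of "cmod (W x)"] by (simp add: norm_mult mult.commute)
    then show "norm (W x * m x) \<le> norm (C * cmod (W x))" by simp
  qed
qed (use assms in auto)

text \<open>An embedding of the torus of period R. Polynomials in its coordinates are the
  trigonometric polynomials, so that polynomial approximation on a compact box becomes trigonometric
  approximation.\<close>

definition torus_map :: "real \<Rightarrow> real ^ 'd \<Rightarrow> (real ^ 'd) \<times> (real ^ 'd)" where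
  "torus_map R x = ((\<chi> i. cos (2 * pi * x $ i / R)), (\<chi> i. sin (2 * pi * x $ i / R)))"

lemma continuous_torus_map: "continuous_on A (torus_map R)"
  unfolding torus_map_def[abs_def] divide_inverse
  by (intro continuous_intros)

lemma torus_map_in_box: "torus_map R x \<in> cbox (\<chi> i. - 1, \<chi> i. - 1) (\<chi> i. 1, \<chi> i. 1)"
  by (auto simp: torus_map_def cbox_Pair_eq mem_box_cart)

text \<open>All Fourier coefficients of the R-periodisation of \<open>W\<close> vanish, while
  \<open>W\<close> itself may live on the whole space.\<close>

definition annihilates :: "real \<Rightarrow> (real ^ 'd \<Rightarrow> complex) \<Rightarrow> bool" where
  "annihilates R W \<longleftrightarrow> integrable lborel W \<and>
     (\<forall>\<gamma>. (LINT x|lborel. W x * wave (real_vec \<gamma> /\<^sub>R R) x) = 0)"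

lemma wave_axis: "wave (real_vec (axis i 1) /\<^sub>R R) x = cis (2 * pi * x $ i / R)"
proof -
  have "real_vec (axis i 1) = (axis i 1 :: real ^ 'a)"
    by (simp add: vec_eq_iff axis_def)
  then show ?thesis by (simp add: wave_def inner_axis' field_simps)
qed

text \<open>Multiplication by a wave of the same period only shifts the index of the vanishing
  coefficients.\<close>

lemma annihilates_shift:
  assumes "annihilates R W"
  shows "annihilates R (\<lambda>x. W x * wave (real_vec \<delta> /\<^sub>R R) x)"
  unfolding annihilates_def
proof (intro conjI allI)
  show "integrable lborel (\<lambda>x. W x * wave (real_vec \<delta> /\<^sub>R R) x)"
    using assms by (intro integrable_bounded_mult[where C = 1]) (auto simp: annihilates_def)
  fix \<gamma>
  have "(\<lambda>x. W x * wave (real_vec \<delta> /\<^sub>R R) x * wave (real_vec \<gamma> /\<^sub>R R) x) =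
      (\<lambda>x. W x * wave (real_vec (\<delta> + \<gamma>) /\<^sub>R R) x)"
    by (simp add: real_vec_add scaleR_add_right wave_add_left mult_ac)
  then show "(LINT x|lborel. W x * wave (real_vec \<delta> /\<^sub>R R) x * wave (real_vec \<gamma> /\<^sub>R R) x) = 0"
    using assms by (simp add: annihilates_def)
qed

lemma annihilates_add:
  assumes "annihilates R V" "annihilates R W"
  shows "annihilates R (\<lambda>x. V x + W x)"
proof -
  have i: "integrable lborel (\<lambda>x. V x * wave (real_vec \<gamma> /\<^sub>R R) x)"
      "integrable lborel (\<lambda>x. W x * wave (real_vec \<gamma> /\<^sub>R R) x)" for \<gamma>
    using assms by (auto intro!: integrable_bounded_mult[where C = 1] simp: annihilates_def)
  show ?thesis
    using assms i by (simp add: annihilates_def distrib_right)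
qed

lemma annihilates_scale: "annihilates R W \<Longrightarrow> annihilates R (\<lambda>x. c * W x)"
  by (simp add: annihilates_def mult.assoc)

lemma annihilates_sum:
  "(\<And>i. i \<in> A \<Longrightarrow> annihilates R (W i)) \<Longrightarrow> annihilates R (\<lambda>x. \<Sum>i\<in>A. W i x)"
  by (induction A rule: infinite_finite_induct) (auto simp: annihilates_add annihilates_def[of _ "\<lambda>_. 0"])

lemma annihilates_trig:
  assumes W: "annihilates R W"
  shows "annihilates R (\<lambda>x. W x * of_real (cos (2 * pi * x $ i / R)))"
    "annihilates R (\<lambda>x. W x * of_real (sin (2 * pi * x $ i / R)))"
proof -
  have m: "annihilates R (\<lambda>x. W x * cis (2 * pi * x $ i / R))"
    using annihilates_shift[OF W, of "axis i 1"] by (simp add: wave_axis)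
  have "wave (real_vec (- axis i 1) /\<^sub>R R) x = cnj (cis (2 * pi * x $ i / R))" for x
    by (simp only: wave_axis[symmetric] real_vec_minus scaleR_minus_right wave_minus_left)
  then have m': "annihilates R (\<lambda>x. W x * cnj (cis (2 * pi * x $ i / R)))"
    using annihilates_shift[OF W, of "- axis i 1"] by simp
  have "(\<lambda>x. W x * of_real (cos (2 * pi * x $ i / R))) = (\<lambda>x. 1/2 * (W x * cis (2 * pi * x $ i / R) +
      W x * cnj (cis (2 * pi * x $ i / R))))"
    by (rule ext) (simp add: complex_eq_iff field_simps)
  then show "annihilates R (\<lambda>x. W x * of_real (cos (2 * pi * x $ i / R)))"
    using annihilates_scale[OF annihilates_add[OF m m'], of "1/2"] by simp
  have "(\<lambda>x. W x * of_real (sin (2 * pi * x $ i / R))) = (\<lambda>x. (- \<i> / 2) * (W x * cis (2 * pi * x $ i / R) +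
      (- 1) * (W x * cnj (cis (2 * pi * x $ i / R)))))"
    by (rule ext) (simp add: complex_eq_iff field_simps)
  then show "annihilates R (\<lambda>x. W x * of_real (sin (2 * pi * x $ i / R)))"
    using annihilates_scale[OF annihilates_add[OF m annihilates_scale[OF m', of "-1"]], of "- \<i> / 2"] by simp
qed

lemma annihilates_polynomial:
  assumes "real_polynomial_function p" "annihilates R W"
  shows "annihilates R (\<lambda>x. W x * of_real (p (torus_map R x)))"
  using assms
\<comment> \<open>\<open>W\<close> must vary: the product case applies the hypothesis for the second
  factor to \<open>W\<close> times the first factor.\<close>
proof (induction p arbitrary: W rule: real_polynomial_function.induct)
  case (linear f)
  have "annihilates R (\<lambda>x. W x * of_real (torus_map R x \<bullet> b))" if "b \<in> Basis" for b
    using that annihilates_trig[OF linear(2)]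
    by (auto simp: Basis_prod_def Basis_vec_def torus_map_def inner_axis)
  then have "annihilates R (\<lambda>x. \<Sum>b\<in>Basis. of_real (f b) * (W x * of_real (torus_map R x \<bullet> b)))"
    by (intro annihilates_sum annihilates_scale)
  moreover have "(\<lambda>x. W x * of_real (f (torus_map R x))) =
      (\<lambda>x. \<Sum>b\<in>Basis. of_real (f b) * (W x * of_real (torus_map R x \<bullet> b)))"
  proof
    fix x
    have "f (torus_map R x) = f (\<Sum>b\<in>Basis. (torus_map R x \<bullet> b) *\<^sub>R b)"
      by (simp only: euclidean_representation)
    also have "\<dots> = (\<Sum>b\<in>Basis. (torus_map R x \<bullet> b) * f b)"
      using bounded_linear.linear[OF linear(1)] by (simp add: linear_sum linear_cmul)
    finally show "W x * of_real (f (torus_map R x)) =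
        (\<Sum>b\<in>Basis. of_real (f b) * (W x * of_real (torus_map R x \<bullet> b)))"
      by (simp add: sum_distrib_left mult_ac)
  qed
  ultimately show ?case by simp
next
  case (const c)
  then show ?case using annihilates_scale[of R W "of_real c"] by (simp add: mult.commute)
next
  case (add f g)
  from annihilates_add[OF add.IH(1)[OF add.prems] add.IH(2)[OF add.prems]]
  show ?case by (simp add: distrib_left)
next
  case (mult f g)
  from mult.IH(2)[OF mult.IH(1)[OF mult.prems]]
  show ?case by (simp add: mult.assoc)
qed

text \<open>Stone-Weierstrass on the box that contains the torus replaces \<open>\<phi>\<close> by a
  polynomial, with an error controlled by the integral of the modulus of \<open>W\<close>.\<close>

lemma annihilates_continuous:
  assumes W: "annihilates R W" and \<phi>: "continuous_on UNIV \<phi>" "\<And>z. \<bar>\<phi> z\<bar> \<le> 1"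
  shows "(LINT x|lborel. W x * of_real (\<phi> (torus_map R x))) = 0"
proof -
  let ?I = "LINT x|lborel. W x * of_real (\<phi> (torus_map R x))"
  have Wi: "integrable lborel W" using W by (simp add: annihilates_def)
  have [measurable]: "(\<lambda>x. \<phi> (torus_map R x)) \<in> borel_measurable borel"
    by (intro borel_measurable_continuous_onI continuous_on_compose2[OF \<phi>(1)] continuous_torus_map) auto
  have i\<phi>: "integrable lborel (\<lambda>x. W x * of_real (\<phi> (torus_map R x)))"
    using \<phi>(2) by (intro integrable_bounded_mult[where C = 1] Wi) auto
  have "cmod ?I \<le> 0 + e" if e: "e > 0" for e
  proof -
    define C where "C = (LINT x|lborel. cmod (W x))"
    have C: "C \<ge> 0" by (auto simp: C_def)
    \<comment> \<open>The summand 1 keeps the divisor positive when \<open>W\<close> vanishes almost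
      everywhere.\<close>
    define d where "d = e / (C + 1)"
    have d: "d > 0" using e C by (simp add: d_def)
    obtain p where p: "real_polynomial_function p"
      "\<And>z. z \<in> cbox (\<chi> i. - 1, \<chi> i. - 1) (\<chi> i. 1, \<chi> i. 1) \<Longrightarrow> \<bar>\<phi> z - p z\<bar> < d"
      using Stone_Weierstrass_real_polynomial_function[OF compact_cbox continuous_on_subset[OF \<phi>(1)] d]
      by (metis top_greatest)
    have ann: "annihilates R (\<lambda>x. W x * of_real (p (torus_map R x)))"
      by (rule annihilates_polynomial[OF p(1) W])
    then have ip: "integrable lborel (\<lambda>x. W x * of_real (p (torus_map R x)))"
      and p0: "(LINT x|lborel. W x * of_real (p (torus_map R x))) = 0"
      by (auto simp: annihilates_def dest: spec[of _ 0])
    have "?I = (LINT x|lborel. W x * of_real (\<phi> (torus_map R x)) - W x * of_real (p (torus_map R x)))"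
      using i\<phi> ip p0 by simp
    also have "cmod \<dots> \<le> (LINT x|lborel. d * cmod (W x))"
    proof (rule Bochner_Integration.integral_norm_bound_integral)
      fix x
      have "\<bar>\<phi> (torus_map R x) - p (torus_map R x)\<bar> \<le> d"
        using p(2)[OF torus_map_in_box] by (simp add: less_imp_le)
      then have "cmod (W x) * \<bar>\<phi> (torus_map R x) - p (torus_map R x)\<bar> \<le> cmod (W x) * d"
        by (intro mult_left_mono) auto
      then show "norm (W x * of_real (\<phi> (torus_map R x)) - W x * of_real (p (torus_map R x))) \<le> d * cmod (W x)"
        by (simp add: right_diff_distrib[symmetric] norm_mult mult.commute flip: of_real_diff)
    qed (use i\<phi> ip Wi in auto)
    also have "\<dots> = d * C" by (simp add: C_def)
    also have "\<dots> \<le> d * (C + 1)" using d by (intro mult_left_mono) auto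
    also have "\<dots> = e" using C by (simp add: d_def)
    finally show ?thesis by simp
  qed
  then have "cmod ?I \<le> 0" by (rule field_le_epsilon)
  then show ?thesis by simp
qed

abbreviation ccube :: "real \<Rightarrow> (real ^ 'd) set" where "ccube R \<equiv> cbox (\<chi> i. - R / 2) (\<chi> i. R / 2)"
abbreviation ocube :: "real \<Rightarrow> (real ^ 'd) set" where "ocube R \<equiv> box (\<chi> i. - R / 2) (\<chi> i. R / 2)"

text \<open>Opposite faces of the closed cube have the same image, which is why one point is taken
  in the open cube: the coordinates then differ by a multiple of R of modulus below R.\<close>

lemma torus_map_inj:
  assumes R: "0 < R" and x: "x \<in> ocube R" and y: "y \<in> ccube R" and eq: "torus_map R x = torus_map R y"
  shows "x = y"
proof (rule vec_eq_iff[THEN iffD2, rule_format])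
  fix i
  have "cos (2 * pi * x $ i / R) = cos (2 * pi * y $ i / R)"
    "sin (2 * pi * x $ i / R) = sin (2 * pi * y $ i / R)"
    using eq by (auto simp: torus_map_def vec_eq_iff)
  then obtain n :: int where "2 * pi * x $ i / R = 2 * pi * y $ i / R + 2 * pi * n"
    using sin_cos_eq_iff by metis
  then have "(2 * pi) * (x $ i / R) = (2 * pi) * (y $ i / R + n)"
    by (simp only: distrib_left times_divide_eq_right)
  then have "x $ i / R = y $ i / R + n"
    by (rule mult_left_cancel[THEN iffD1, rotated]) simp
  then have n: "x $ i = y $ i + n * R" using R by (simp add: field_simps)
  moreover have "\<bar>x $ i - y $ i\<bar> < R"
    using x y by (auto simp: mem_box_cart abs_less_iff) (smt (verit) field_sum_of_halves)+
  ultimately have "\<bar>real_of_int n\<bar> * R < 1 * R" using R by (simp add: abs_mult)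
  then have "n = 0" using R by (simp only: mult_less_cancel_right) auto
  with n show "x $ i = y $ i" by simp
qed

text \<open>
  A continuous function on the torus that approximates the indicator of \<open>B\<close> integrates \<open>W\<close> to \<open>0\<close>;
  outside the fundamental cube only its boundedness is used.
\<close>

lemma annihilates_open:
  assumes R: "0 < R" and W: "annihilates R W" and B: "open B" "B \<subseteq> ocube R"
  shows "cmod (LINT x|lborel. indicator B x * W x) \<le> (LINT x|lborel. indicator (- ccube R) x * cmod (W x))"
proof -
  \<comment> \<open>The part of the torus to be avoided: by injectivity, a point of the closed cube
    is mapped into \<open>K\<close> exactly if it lies outside \<open>B\<close>.\<close>
  define K where "K = torus_map R ` (ccube R - B)"
  have Wi [measurable]: "integrable lborel W" using W by (simp add: annihilates_def)
  have [measurable]: "B \<in> sets borel" using B by simp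
  have "compact K"
    unfolding K_def by (intro compact_continuous_image continuous_torus_map compact_diff compact_cbox B)
  then have Kc: "closed K" by (rule compact_imp_closed)
  \<comment> \<open>A corner lies in the closed but not in the open cube. That \<open>K\<close> is
    nonempty matters, since the distance to the empty set is 0 by convention and
    \<open>\<phi>\<close> would vanish.\<close>
  have "(\<chi> i. R / 2) \<in> ccube R - B"
    using R B(2) by (force simp: mem_box_cart)
  then have Kne: "K \<noteq> {}" by (auto simp: K_def)
  \<comment> \<open>These continuous functions increase to the indicator of the complement of the
    closed set \<open>K\<close>.\<close>
  define \<phi> where "\<phi> m z = min 1 (real m * infdist z K)" for m z
  define \<psi> where "\<psi> x = (if torus_map R x \<in> K then 0 else 1 :: real)" for x
  have \<phi>c: "continuous_on A (\<phi> m)" for m A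
    unfolding \<phi>_def[abs_def] by (intro continuous_intros)
  have \<phi>1: "\<bar>\<phi> m z\<bar> \<le> 1" for m z
    by (auto simp: \<phi>_def infdist_nonneg)
  have \<phi>m [measurable]: "(\<lambda>x. \<phi> m (torus_map R x)) \<in> borel_measurable borel" for m
    by (intro borel_measurable_continuous_onI continuous_on_compose2[OF \<phi>c] continuous_torus_map) auto
  have lim: "(\<lambda>m. \<phi> m (torus_map R x)) \<longlonglongrightarrow> \<psi> x" for x
  proof (cases "torus_map R x \<in> K")
    case True
    then show ?thesis by (simp add: \<phi>_def \<psi>_def)
  next
    case False
    then have pos: "infdist (torus_map R x) K > 0"
      using Kc Kne by (simp add: infdist_pos_not_in_closed)
    obtain M :: nat where M: "1 / infdist (torus_map R x) K \<le> M" using real_arch_simple by blast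
    have "\<phi> m (torus_map R x) = 1" if "m \<ge> M" for m
    proof -
      have "1 / infdist (torus_map R x) K \<le> m" using M that by (meson of_nat_mono order_trans)
      then show ?thesis using pos by (simp add: \<phi>_def field_simps)
    qed
    then show ?thesis
      using False by (intro tendsto_eventually) (auto simp: \<psi>_def eventually_sequentially)
  qed
  have \<psi>m [measurable]: "\<psi> \<in> borel_measurable borel"
    by (rule borel_measurable_LIMSEQ_real[OF lim]) measurable
  have "(\<lambda>m. LINT x|lborel. W x * of_real (\<phi> m (torus_map R x))) \<longlonglongrightarrow> (LINT x|lborel. W x * of_real (\<psi> x))"
  proof (rule integral_dominated_convergence[where w = "\<lambda>x. cmod (W x)"])
    show "AE x in lborel. (\<lambda>m. W x * of_real (\<phi> m (torus_map R x))) \<longlonglongrightarrow> W x * of_real (\<psi> x)"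
      by (intro AE_I2 tendsto_intros lim)
    show "AE x in lborel. norm (W x * of_real (\<phi> m (torus_map R x))) \<le> cmod (W x)" for m
      using \<phi>1 by (intro AE_I2) (simp add: norm_mult mult_left_le)
  qed (use Wi in auto)
  then have W\<psi>: "(LINT x|lborel. W x * of_real (\<psi> x)) = 0"
    using annihilates_continuous[OF W \<phi>c \<phi>1] by (simp add: LIMSEQ_const_iff)
  have \<psi>B: "\<psi> x = indicator B x" if x: "x \<in> ccube R" for x
  proof (cases "x \<in> B")
    case True
    have "torus_map R x \<notin> K"
      using torus_map_inj[OF R subsetD[OF B(2) True]] True by (force simp: K_def)
    with True show ?thesis by (simp add: \<psi>_def)
  qed (use x in \<open>auto simp: \<psi>_def K_def\<close>)
  have "B \<subseteq> ccube R" using B(2) box_subset_cbox by blast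
  then have eq: "indicator B x * W x = W x * of_real (\<psi> x) - indicator (- ccube R) x * (W x * of_real (\<psi> x))" for x
    using \<psi>B[of x] by (auto simp: indicator_def)
  have i1: "integrable lborel (\<lambda>x. W x * of_real (\<psi> x))"
  proof (rule integrable_bounded_mult[OF Wi])
    show "cmod (of_real (\<psi> x)) \<le> 1" for x by (simp add: \<psi>_def)
  qed measurable
  have i2: "integrable lborel (\<lambda>x. indicator (- ccube R) x * (W x * of_real (\<psi> x)))"
    using integrable_bounded_mult[OF i1, of "indicator (- ccube R)" 1] by (auto simp: indicator_def mult.commute)
  have "(LINT x|lborel. indicator B x * W x) = - (LINT x|lborel. indicator (- ccube R) x * (W x * of_real (\<psi> x)))"
    unfolding eq using i1 i2 W\<psi> by simp
  also have "cmod \<dots> \<le> (LINT x|lborel. indicator (- ccube R) x * cmod (W x))"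
    unfolding norm_minus_cancel
  proof (rule Bochner_Integration.integral_norm_bound_integral[OF i2])
    show "integrable lborel (\<lambda>x. indicator (- ccube R) x * cmod (W x))"
      by (rule Bochner_Integration.integrable_bound[OF integrable_norm[OF Wi]]) (auto simp: indicator_def)
    show "norm (indicator (- ccube R) x * (W x * of_real (\<psi> x))) \<le> indicator (- ccube R) x * cmod (W x)" for x
      by (auto simp: indicator_def norm_mult \<psi>_def)
  qed
  finally show ?thesis .
qed

text \<open>Bounded open sets are stable under intersection and generate the Borel sets, so a Dynkin
  argument extends the hypothesis to all Borel sets; real and imaginary part are then densities with
  vanishing integrals.\<close>

lemma AE_zero_of_open:
  fixes W :: "real ^ 'd \<Rightarrow> complex"
  assumes W [measurable]: "integrable lborel W"
    and z: "\<And>B. open B \<Longrightarrow> bounded B \<Longrightarrow> (LINT x|lborel. indicator B x * W x) = 0"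
  shows "AE x in lborel. W x = 0"
proof -
  have iW: "integrable lborel (\<lambda>x. indicator A x * W x)" if "A \<in> sets borel" for A
    using integrable_bounded_mult[OF W, of "indicator A" 1] that by (auto simp: indicator_def mult.commute)
  \<comment> \<open>The whole space is not bounded. Its integral, on which the complement case
    depends, is obtained from growing balls.\<close>
  have total: "(LINT x|lborel. W x) = 0"
  proof -
    have "(\<lambda>n. LINT x|lborel. indicator (ball 0 (real n)) x * W x) \<longlonglongrightarrow> (LINT x|lborel. W x)"
    proof (rule integral_dominated_convergence[where w = "\<lambda>x. cmod (W x)"])
      show "AE x in lborel. (\<lambda>n. indicator (ball 0 (real n)) x * W x) \<longlonglongrightarrow> W x"
      proof (intro AE_I2 tendsto_eventually)
        fix x :: "real ^ 'd"
        show "\<forall>\<^sub>F n in sequentially. indicator (ball 0 (real n)) x * W x = W x"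
          using eventually_gt_at_top[of "nat \<lceil>norm x\<rceil>"]
          by eventually_elim (auto simp: indicator_def, linarith)
      qed
    qed (use W in \<open>auto simp: indicator_def\<close>)
    moreover have "(LINT x|lborel. indicator (ball 0 (real n)) x * W x) = 0" for n by (rule z) auto
    ultimately show ?thesis by (simp add: LIMSEQ_const_iff)
  qed
  have P: "(LINT x|lborel. indicator A x * W x) = 0" if A: "A \<in> sets borel" for A
  proof -
    have "A \<in> sigma_sets UNIV {B. open B \<and> bounded B}"
    proof -
      have "A \<in> sigma_sets UNIV (range (\<lambda>(a, b). box a b :: (real ^ 'd) set))"
        using A by (simp add: borel_eq_box)
      moreover have "range (\<lambda>(a, b). box a b :: (real ^ 'd) set) \<subseteq> {B. open B \<and> bounded B}"
        by (auto simp: open_box bounded_box)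
      ultimately show ?thesis by (meson sigma_sets_mono' subsetD)
    qed
    then show ?thesis
    proof (induction rule: sigma_sets_induct_disjoint[rotated 2, consumes 1,
        case_names basic empty compl union])
      case (basic B)
      then show ?case using z by auto
    next
      case empty
      then show ?case by simp
    next
      case (compl B)
      have B: "B \<in> sets borel"
        using compl(1) by (metis (no_types, lifting) borel_open mem_Collect_eq sets.sigma_sets_subset
            space_borel subsetD subsetI)
      have "(LINT x|lborel. indicator (UNIV - B) x * W x) = (LINT x|lborel. W x - indicator B x * W x)"
        by (intro Bochner_Integration.integral_cong) (auto simp: indicator_def)
      then show ?case using compl(2) total iW[OF B] W by simp
    next
      case (union B)
      have B: "B i \<in> sets borel" for i
        using union(2) by (metis (no_types, lifting) borel_open mem_Collect_eq sets.sigma_sets_subset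
            space_borel subsetD subsetI rangeI)
      have "(LINT x:(\<Union>i. B i)|lborel. W x) = (\<Sum>i. (LINT x:(B i)|lborel. W x))"
      proof (rule lebesgue_integral_countable_add)
        show "B i \<inter> B j = {}" if "i \<noteq> j" for i j
          using union(1) that by (auto simp: disjoint_family_on_def)
        show "set_integrable lborel (\<Union>i. B i) W"
        proof -
          have "(\<lambda>x. indicator (\<Union>i. B i) x *\<^sub>R W x) = (\<lambda>x. indicator (\<Union>i. B i) x * W x)"
            by (auto simp: indicator_def)
          then show ?thesis using iW[of "\<Union>i. B i"] B by (simp add: set_integrable_def)
        qed
      qed (use B in auto)
      moreover have "(LINT x:A|lborel. W x) = (LINT x|lborel. indicator A x * W x)" for A
        unfolding set_lebesgue_integral_def by (intro Bochner_Integration.integral_cong) (auto simp: indicator_def)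
      ultimately show ?case using union(3) by simp
    next
      show "Int_stable {B::(real ^ 'd) set. open B \<and> bounded B}"
        by (auto simp: Int_stable_def)
    qed auto
  qed
  have iRe: "integrable lborel (\<lambda>x. Re (W x))" and iIm: "integrable lborel (\<lambda>x. Im (W x))"
    using W by auto
  have "AE x in lborel. Re (W x) = 0"
  proof (rule density_unique_real[OF iRe])
    fix A :: "(real ^ 'd) set" assume A: "A \<in> sets lborel"
    have "(LINT x:A|lborel. Re (W x)) = (LINT x|lborel. Re (indicator A x * W x))"
      unfolding set_lebesgue_integral_def by (intro Bochner_Integration.integral_cong) (auto simp: indicator_def)
    also have "\<dots> = Re (LINT x|lborel. indicator A x * W x)"
      using iW[of A] A by (intro integral_Re) simp
    also have "\<dots> = 0" using P[of A] A by simp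
    finally show "(LINT x:A|lborel. Re (W x)) = (LINT x:A|lborel. 0)" by (simp add: set_lebesgue_integral_def)
  qed simp
  moreover have "AE x in lborel. Im (W x) = 0"
  proof (rule density_unique_real[OF iIm])
    fix A :: "(real ^ 'd) set" assume A: "A \<in> sets lborel"
    have "(LINT x:A|lborel. Im (W x)) = (LINT x|lborel. Im (indicator A x * W x))"
      unfolding set_lebesgue_integral_def by (intro Bochner_Integration.integral_cong) (auto simp: indicator_def)
    also have "\<dots> = Im (LINT x|lborel. indicator A x * W x)"
      using iW[of A] A by (intro integral_Im) simp
    also have "\<dots> = 0" using P[of A] A by simp
    finally show "(LINT x:A|lborel. Im (W x)) = (LINT x:A|lborel. 0)" by (simp add: set_lebesgue_integral_def)
  qed simp
  ultimately show ?thesis by eventually_elim (simp add: complex_eq_iff)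
qed

text \<open>With the support in the closed unit cube the error term of
  \<open>annihilates_open\<close> is 0, and the faces left out by the open cube form a null
  set.\<close>

lemma torus_uniqueness:
  assumes W: "annihilates 1 W" and supp: "\<And>x. x \<notin> ccube 1 \<Longrightarrow> W x = 0"
  shows "AE x in lborel. W x = 0"
proof (rule AE_zero_of_open)
  show Wi: "integrable lborel W" using W by (simp add: annihilates_def)
  fix B :: "(real ^ 'a) set" assume B: "open B" "bounded B"
  have "(\<lambda>x. indicator (- ccube 1) x * cmod (W x)) = (\<lambda>_. 0)"
  proof
    fix x show "indicator (- ccube 1) x * cmod (W x) = 0"
      by (cases "x \<in> ccube 1") (simp_all add: supp del: mem_box_cart)
  qed
  then have "cmod (LINT x|lborel. indicator (B \<inter> ocube 1) x * W x) \<le> 0"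
    using annihilates_open[OF _ W, of "B \<inter> ocube 1"] B by (simp add: open_Int open_box)
  moreover have "(LINT x|lborel. indicator (B \<inter> ocube 1) x * W x) = (LINT x|lborel. indicator B x * W x)"
  proof (rule integral_cong_AE)
    have "emeasure lborel (ccube 1 - ocube 1 :: (real ^ 'a) set) = 0"
      by (subst emeasure_Diff) (auto simp: emeasure_lborel_cbox_eq emeasure_lborel_box_eq
          intro: subsetD[OF box_subset_cbox])
    then have "AE x in (lborel :: (real ^ 'a) measure). x \<notin> ccube 1 - ocube 1"
      by (intro AE_not_in) (auto simp: null_sets_def)
    then show "AE x in lborel. indicator (B \<inter> ocube 1) x * W x = indicator B x * W x"
      using supp by (auto simp: indicator_def elim!: eventually_mono)
  next
    have [measurable]: "B \<in> sets borel" "W \<in> borel_measurable borel" using B Wi by auto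
    show "(\<lambda>x. indicator (B \<inter> ocube 1) x * W x) \<in> borel_measurable lborel"
      "(\<lambda>x. indicator B x * W x) \<in> borel_measurable lborel"
      by measurable
  qed
  ultimately show "(LINT x|lborel. indicator B x * W x) = 0" by simp
qed

text \<open>A vanishing transform annihilates \<open>W\<close> at every period n; the error term of
  \<open>annihilates_open\<close> is the mass outside a cube of side n and tends to 0.\<close>

lemma fourier_uniqueness:
  assumes Wi: "integrable lborel W" and z: "\<And>y. (LINT x|lborel. W x * wave y x) = 0"
  shows "AE x in lborel. W x = 0"
proof (rule AE_zero_of_open[OF Wi])
  fix B :: "(real ^ 'a) set" assume B: "open B" "bounded B"
  then obtain M where M: "\<And>x. x \<in> B \<Longrightarrow> norm x \<le> M" by (auto simp: bounded_iff)
  let ?c = "cmod (LINT x|lborel. indicator B x * W x)"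
  have "(\<lambda>n. LINT x|lborel. indicator (- ccube (real n)) x * cmod (W x)) \<longlonglongrightarrow> (LINT x|(lborel::(real^'a) measure). 0)"
  proof (rule integral_dominated_convergence[where w = "\<lambda>x. cmod (W x)"])
    show "AE x in lborel. (\<lambda>n. indicator (- ccube (real n)) x * cmod (W x)) \<longlonglongrightarrow> 0"
    proof (intro AE_I2 tendsto_eventually)
      fix x :: "real ^ 'a"
      show "\<forall>\<^sub>F n in sequentially. indicator (- ccube (real n)) x * cmod (W x) = 0"
        using eventually_ge_at_top[of "nat \<lceil>2 * norm x\<rceil>"]
      proof eventually_elim
        case (elim n)
        then have "2 * norm x \<le> n" by (simp add: nat_ceiling_le_eq)
        have "x \<in> ccube (real n)"
          unfolding mem_box_cart
        proof (intro allI conjI)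
          fix i
          show "(\<chi> i. - real n / 2) $ i \<le> x $ i" "x $ i \<le> (\<chi> i. real n / 2) $ i"
            using component_le_norm_cart[of x i] \<open>2 * norm x \<le> n\<close> by (simp_all add: abs_le_iff)
        qed
        then show ?case by simp
      qed
    qed
  qed (use Wi in \<open>auto simp: indicator_def\<close>)
  moreover have "eventually (\<lambda>n. ?c \<le> (LINT x|lborel. indicator (- ccube (real n)) x * cmod (W x))) sequentially"
    using eventually_gt_at_top[of "nat \<lceil>2 * M\<rceil>"] eventually_gt_at_top[of 0]
  proof eventually_elim
    case (elim n)
    have "annihilates (real n) W"
      using Wi z by (simp add: annihilates_def)
    moreover have "B \<subseteq> ocube (real n)"
    proof
      fix x assume "x \<in> B"
      then have "2 * norm x < n" using M[of x] elim(1) by linarith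
      show "x \<in> ocube (real n)"
        unfolding mem_box_cart
      proof (intro allI conjI)
        fix i
        show "(\<chi> i. - real n / 2) $ i < x $ i" "x $ i < (\<chi> i. real n / 2) $ i"
          using component_le_norm_cart[of x i] \<open>2 * norm x < n\<close> by (simp_all add: abs_le_iff)
      qed
    qed
    ultimately show ?case
      using annihilates_open[of "real n" W B] B elim by simp
  qed
  ultimately have "?c \<le> 0"
    using tendsto_lowerbound[of _ 0 sequentially ?c] by simp
  then show "(LINT x|lborel. indicator B x * W x) = 0" by simp
qed

lemma borel_measurable_cnj [measurable (raw)]:
  "f \<in> borel_measurable M \<Longrightarrow> (\<lambda>x. cnj (f x)) \<in> borel_measurable M"
  by (rule borel_measurable_continuous_on[OF continuous_on_cnj[OF continuous_on_id]])

lemma borel_measurable_cis [measurable (raw)]: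
  "f \<in> borel_measurable M \<Longrightarrow> (\<lambda>x. cis (f x)) \<in> borel_measurable M"
  by (rule borel_measurable_continuous_on[OF continuous_on_cis[OF continuous_on_id]])

section \<open>Translations, sign changes and products over coordinates\<close>

lemma AE_translate: "AE x in lborel. P x \<Longrightarrow> AE x in lborel. P (x + c :: 'a::euclidean_space)"
proof -
  assume "AE x in lborel. P x"
  then have "AE x in distr lborel borel ((+) c). P x" by (simp only: lborel_distr_plus)
  from AE_distrD[OF _ this] show ?thesis by (simp add: add.commute)
qed

lemma integral_translate:
  fixes f :: "'a::euclidean_space \<Rightarrow> 'b::{banach, second_countable_topology}"
  assumes "f \<in> borel_measurable borel"
  shows "(LINT x|lborel. f (x + c)) = (LINT x|lborel. f x)"
  using integral_distr[of "(+) c" lborel borel f] assms by (simp add: lborel_distr_plus add.commute)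

lemma integrable_translate_iff:
  fixes f :: "'a::euclidean_space \<Rightarrow> 'b::{banach, second_countable_topology}"
  assumes "f \<in> borel_measurable borel"
  shows "integrable lborel (\<lambda>x. f (x + c)) \<longleftrightarrow> integrable lborel f"
  using integrable_distr_eq[of "(+) c" lborel borel f] assms by (simp add: lborel_distr_plus add.commute)

lemma measurable_translate:
  "f \<in> borel_measurable borel \<Longrightarrow> (\<lambda>x. f (x + c :: 'a::euclidean_space)) \<in> borel_measurable borel"
  by (rule measurable_compose[of "\<lambda>x. x + c" borel borel f]) auto

lemma L2_translate: "f \<in> L2 \<Longrightarrow> (\<lambda>x. f (x + c)) \<in> L2"
  using integrable_translate_iff[of "\<lambda>x. (cmod (f x))\<^sup>2" c] L2_integrable_square[of f]
  by (intro L2I) (simp_all add: measurable_translate[OF L2_measurable] L2_measurable)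

lemma l2_inner_translate:
  "f \<in> L2 \<Longrightarrow> h \<in> L2 \<Longrightarrow> l2_inner (\<lambda>x. f (x + c)) (\<lambda>x. h (x + c)) = l2_inner f h"
  unfolding l2_inner_def
  by (rule integral_translate[of "\<lambda>x. f x * cnj (h x)"]) (rule L2_mult_cnj_measurable)

definition sign_map :: "('d \<Rightarrow> real) \<Rightarrow> real ^ 'd \<Rightarrow> real ^ 'd" where
  "sign_map e x = (\<chi> i. e i * x $ i)"

lemma sign_map_measurable [measurable]: "sign_map e \<in> borel_measurable borel"
  unfolding sign_map_def[abs_def]
  by (intro borel_measurable_continuous_onI continuous_intros)

lemma distr_sign_map:
  assumes "\<And>i. \<bar>e i\<bar> = 1"
  shows "distr lborel borel (sign_map e) = lborel"
proof -
  \<comment> \<open>The signs indexed by basis vectors instead of coordinates, the form in which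
    \<open>lborel_affine_euclidean\<close> takes them.\<close>
  define c where "c b = (\<Sum>i\<in>UNIV. e i * b $ i)" for b :: "real ^ 'a"
  have c_axis: "c (axis i 1) = e i" for i
    by (simp add: c_def axis_def if_distrib cong: if_cong)
  have c1: "\<bar>c b\<bar> = 1" if "b \<in> Basis" for b
    using that assms by (auto simp: Basis_vec_def c_axis)
  have "(0 :: real ^ 'a) + (\<Sum>j\<in>Basis. (c j * (x \<bullet> j)) *\<^sub>R j) = sign_map e x" for x
  proof -
    have "(\<Sum>j\<in>Basis. (c j * (x \<bullet> j)) *\<^sub>R j) = (\<Sum>i\<in>UNIV. (e i * x $ i) *\<^sub>R axis i 1)"
    proof -
      have B: "(Basis :: (real ^ 'a) set) = (\<lambda>i. axis i 1) ` UNIV"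
        by (auto simp: Basis_vec_def)
      have inj: "inj (\<lambda>i. axis i (1::real))" by (auto simp: inj_on_def axis_eq_axis)
      show ?thesis
        unfolding B by (subst sum.reindex[OF inj]) (simp add: c_axis inner_axis)
    qed
    also have "\<dots> = sign_map e x"
      by (simp add: vec_eq_iff sign_map_def axis_def if_distrib cong: if_cong)
    finally show ?thesis by simp
  qed
  then have "lborel = density (distr lborel borel (sign_map e)) (\<lambda>_. (\<Prod>j\<in>(Basis :: (real ^ 'a) set). \<bar>c j\<bar>))"
    using lborel_affine_euclidean[of c "0 :: real ^ 'a"] c1 by fastforce
  also have "(\<Prod>j\<in>(Basis :: (real ^ 'a) set). \<bar>c j\<bar>) = 1"
    using c1 by simp
  finally show ?thesis by (simp add: density_1)
qed

context
  fixes e :: "'d::finite \<Rightarrow> real"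
  assumes e: "\<And>i. \<bar>e i\<bar> = 1"
begin

lemma AE_sign_map: "AE x in lborel. P x \<Longrightarrow> AE x in lborel. P (sign_map e x)"
proof -
  assume "AE x in lborel. P x"
  then have "AE x in distr lborel borel (sign_map e). P x" by (simp only: distr_sign_map[OF e])
  from AE_distrD[OF _ this] show ?thesis by simp
qed

lemma integral_sign_map:
  fixes f :: "real ^ 'd \<Rightarrow> 'b::{banach, second_countable_topology}"
  assumes "f \<in> borel_measurable borel"
  shows "(LINT x|lborel. f (sign_map e x)) = (LINT x|lborel. f x)"
  using integral_distr[of "sign_map e" lborel borel f] assms by (simp add: distr_sign_map[OF e])

lemma integrable_sign_map_iff:
  fixes f :: "real ^ 'd \<Rightarrow> 'b::{banach, second_countable_topology}"
  assumes "f \<in> borel_measurable borel"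
  shows "integrable lborel (\<lambda>x. f (sign_map e x)) \<longleftrightarrow> integrable lborel f"
  using integrable_distr_eq[of "sign_map e" lborel borel f] assms by (simp add: distr_sign_map[OF e])

lemma L2_sign_map: "f \<in> L2 \<Longrightarrow> (\<lambda>x. f (sign_map e x)) \<in> L2"
  using integrable_sign_map_iff[of "\<lambda>x. (cmod (f x))\<^sup>2"] L2_integrable_square[of f]
    measurable_compose[OF sign_map_measurable[of e] L2_measurable[of f]]
  by (auto intro!: L2I L2_measurable)

end

lemma sign_map_uminus: "sign_map (\<lambda>_. - 1) x = - x"
  by (simp add: sign_map_def vec_eq_iff)

lemma AE_uminus_vec: "AE x in lborel. P x \<Longrightarrow> AE x in lborel. P (- x :: real ^ 'd)"
  using AE_sign_map[of "\<lambda>_. - 1" P] by (simp add: sign_map_uminus)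

lemma L2_uminus_arg: "f \<in> L2 \<Longrightarrow> (\<lambda>x :: real ^ 'd. f (- x)) \<in> L2"
  using L2_sign_map[of "\<lambda>_. - 1" f] by (simp add: sign_map_uminus)

lemma integral_uminus_vec:
  fixes f :: "real ^ 'd \<Rightarrow> 'b::{banach, second_countable_topology}"
  shows "f \<in> borel_measurable borel \<Longrightarrow> (LINT x|lborel. f (- x)) = (LINT x|lborel. f x)"
  using integral_sign_map[of "\<lambda>_. - 1" f] by (simp add: sign_map_uminus)

lemma lborel_product:
  fixes f :: "'a::euclidean_space \<Rightarrow> real \<Rightarrow> 'b::{real_normed_field, banach, second_countable_topology}"
  assumes f: "\<And>b. b \<in> Basis \<Longrightarrow> integrable lborel (f b)"
  shows integral_lborel_product:
      "(LINT x|lborel. (\<Prod>b\<in>Basis. f b (x \<bullet> b))) = (\<Prod>b\<in>Basis. (LINT t|lborel. f b t))"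
    and integrable_lborel_product: "integrable lborel (\<lambda>x. \<Prod>b\<in>Basis. f b (x \<bullet> b))"
proof -
  interpret product_sigma_finite "\<lambda>_ :: 'a. lborel :: real measure"
    by (intro product_sigma_finite.intro sigma_finite_lborel)
  let ?T = "\<lambda>g :: 'a \<Rightarrow> real. \<Sum>b\<in>Basis. g b *\<^sub>R b"
  have fb: "f b \<in> borel_measurable borel" if "b \<in> Basis" for b
    using borel_measurable_integrable[OF f[OF that]] by simp
  have m: "?T \<in> measurable (Pi\<^sub>M Basis (\<lambda>_. lborel)) borel" by measurable
  have fm: "(\<lambda>x. \<Prod>b\<in>Basis. f b (x \<bullet> b)) \<in> borel_measurable borel"
    by (intro borel_measurable_prod measurable_compose[OF _ fb]) auto
  have inner: "?T g \<bullet> b = g b" if "b \<in> Basis" for g b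
    using that by (simp add: inner_sum_left inner_Basis if_distrib cong: if_cong)
  then have eq: "(\<Prod>b\<in>Basis. f b (?T g \<bullet> b)) = (\<Prod>b\<in>Basis. f b (g b))" for g
    by (intro prod.cong refl) simp
  have "(LINT x|lborel. (\<Prod>b\<in>Basis. f b (x \<bullet> b))) =
      (LINT g|Pi\<^sub>M Basis (\<lambda>_. lborel). (\<Prod>b\<in>Basis. f b (g b)))"
    by (subst lborel_eq) (simp only: integral_distr[OF m fm] eq)
  also have "\<dots> = (\<Prod>b\<in>Basis. (LINT t|lborel. f b t))"
    by (rule product_integral_prod) (use f in auto)
  finally show "(LINT x|lborel. (\<Prod>b\<in>Basis. f b (x \<bullet> b))) = (\<Prod>b\<in>Basis. (LINT t|lborel. f b t))" .
  have "integrable (Pi\<^sub>M Basis (\<lambda>_. lborel)) (\<lambda>g. \<Prod>b\<in>Basis. f b (g b))"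
    by (rule product_integrable_prod) (use f in auto)
  then show "integrable lborel (\<lambda>x. \<Prod>b\<in>Basis. f b (x \<bullet> b))"
    by (subst lborel_eq) (simp only: integrable_distr_eq[OF m fm] eq)
qed

lemma cis_sum: "cis (\<Sum>i\<in>A. f i) = (\<Prod>i\<in>A. cis (f i))"
  by (induction A rule: infinite_finite_induct) (auto simp: cis_mult[symmetric])

lemma wave_prod: "wave y x = (\<Prod>b\<in>Basis. cis (2 * pi * (y \<bullet> b) * (x \<bullet> b)))"
  unfolding wave_def by (subst euclidean_inner) (simp add: sum_distrib_left mult.assoc flip: cis_sum)

section \<open>Real Fourier transforms\<close>

definition gauss :: "real ^ 'd \<Rightarrow> real" where
  "gauss x = (\<Prod>b\<in>Basis. std_normal_density (x \<bullet> b))"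

text \<open>The Fourier transform of \<open>gauss\<close>, as \<open>gauss_fourier\<close> shows: in
  each coordinate, the characteristic function of the standard normal law at 2 * pi times that
  coordinate.\<close>

definition gauss_hat :: "real ^ 'd \<Rightarrow> real" where
  "gauss_hat x = (\<Prod>b\<in>Basis. exp (- ((2 * pi * (x \<bullet> b))\<^sup>2) / 2))"

lemma gauss_hat_pos: "0 < gauss_hat x"
  by (simp add: gauss_hat_def prod_pos)

lemma gauss_hat_even: "gauss_hat (- x) = gauss_hat x"
  by (simp add: gauss_hat_def)

lemma gauss_measurable [measurable]: "gauss \<in> borel_measurable borel" "gauss_hat \<in> borel_measurable borel"
  unfolding gauss_def[abs_def] gauss_hat_def[abs_def] by measurable

lemma gauss_integrable: "integrable lborel (\<lambda>x. complex_of_real (gauss x))"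
  unfolding gauss_def by (intro integrable_of_real integrable_lborel_product) auto

lemma bounded_integrable_L2:
  assumes "integrable lborel f" "\<And>x. 0 \<le> f x" "\<And>x. f x \<le> C"
  shows "(\<lambda>x. complex_of_real (f x)) \<in> L2"
proof (rule L2_bound)
  show "integrable lborel (\<lambda>x. C * f x)" using assms by simp
  show "AE x in lborel. (cmod (complex_of_real (f x)))\<^sup>2 \<le> C * f x"
    using assms by (auto simp: power2_eq_square intro!: mult_right_mono)
qed (use assms in auto)

lemma gauss_L2: "(\<lambda>x. complex_of_real (gauss x)) \<in> L2"
proof (rule bounded_integrable_L2)
  show "integrable lborel gauss"
    unfolding gauss_def[abs_def] by (intro integrable_lborel_product) auto
  show "0 \<le> gauss x" for x :: "real ^ 'a" by (auto simp: gauss_def intro: prod_nonneg)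
  have "std_normal_density t \<le> 1 / sqrt (2 * pi)" for t
    by (simp add: std_normal_density_def field_simps)
  then show "gauss x \<le> (\<Prod>b\<in>(Basis :: (real ^ 'a) set). 1 / sqrt (2 * pi))" for x :: "real ^ 'a"
    unfolding gauss_def by (intro prod_mono) auto
qed

lemma gauss_hat_L2: "(\<lambda>x. complex_of_real (gauss_hat x)) \<in> L2"
proof (rule bounded_integrable_L2)
  \<comment> \<open>Each factor is a multiple of the normal density with standard deviation 1 / (2 *
    pi).\<close>
  have "(\<lambda>t. exp (- ((2 * pi * t)\<^sup>2) / 2)) = (\<lambda>t. normal_density 0 (1 / (2 * pi)) t * (1 / sqrt (2 * pi)))"
    by (simp add: normal_density_def fun_eq_iff power2_eq_square real_sqrt_divide field_simps)
  then have "integrable lborel (\<lambda>t. exp (- ((2 * pi * t)\<^sup>2) / 2))" by simp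
  then show "integrable lborel gauss_hat"
    unfolding gauss_hat_def[abs_def] by (intro integrable_lborel_product) auto
  show "0 \<le> gauss_hat x" for x :: "real ^ 'a" using gauss_hat_pos[of x] by simp
  show "gauss_hat x \<le> 1" for x :: "real ^ 'a" unfolding gauss_hat_def by (intro prod_le_1) auto
qed

lemma gauss_fourier: "(LINT w|lborel. complex_of_real (gauss w) * cnj (wave x w)) = of_real (gauss_hat x)"
proof -
  have "(LINT w|lborel. complex_of_real (gauss w) * cnj (wave x w)) =
      (LINT w|lborel. (\<Prod>b\<in>Basis. (\<lambda>t. std_normal_density t *\<^sub>R cis (- (2 * pi * (x \<bullet> b)) * t)) (w \<bullet> b)))"
    by (intro Bochner_Integration.integral_cong refl)
      (simp add: gauss_def wave_prod cis_cnj scaleR_conv_of_real prod.distrib)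
  also have "\<dots> = (\<Prod>b\<in>Basis. (LINT t|lborel. std_normal_density t *\<^sub>R cis (- (2 * pi * (x \<bullet> b)) * t)))"
  proof (rule integral_lborel_product)
    fix b :: "real ^ 'a"
    show "integrable lborel (\<lambda>t. std_normal_density t *\<^sub>R cis (- (2 * pi * (x \<bullet> b)) * t))"
      by (rule Bochner_Integration.integrable_bound[where f = std_normal_density]) auto
  qed
  also have "\<dots> = (\<Prod>b\<in>Basis. complex_of_real (exp (- ((2 * pi * (x \<bullet> b))\<^sup>2) / 2)))"
  proof (intro prod.cong refl)
    fix b :: "real ^ 'a"
    have [measurable]: "(\<lambda>t. iexp (c * t)) \<in> borel_measurable borel" for c
      by (intro borel_measurable_continuous_onI continuous_intros)
    have "char std_normal_distribution (- (2 * pi * (x \<bullet> b))) =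
        (LINT t|lborel. std_normal_density t *\<^sub>R iexp (- (2 * pi * (x \<bullet> b)) * t))"
      unfolding char_def by (subst integral_density) (auto simp: normal_density_nonneg)
    then show "(LINT t|lborel. std_normal_density t *\<^sub>R cis (- (2 * pi * (x \<bullet> b)) * t)) =
        complex_of_real (exp (- ((2 * pi * (x \<bullet> b))\<^sup>2) / 2))"
      by (simp add: char_std_normal_distribution cis_conv_exp)
  qed
  also have "\<dots> = of_real (gauss_hat x)" by (simp add: gauss_hat_def)
  finally show ?thesis .
qed

lemma fourier_integral_wave: "fourier_integral f w = (LINT x|lborel. f x * cnj (wave w x))"
  unfolding fourier_integral_def wave_def cis_cnj cis_conv_exp
  by (simp add: mult.commute[of _ \<i>] exp_cnj)

lemma wave_commute: "wave x y = wave y x"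
  by (simp add: wave_def inner_commute)

text \<open>Fubini's theorem moves the transform from \<open>u\<close> to \<open>\<phi>\<close>.
  With a fixed Gaussian as \<open>\<phi>\<close> both sides are \<open>L2\<close> inner products, so
  the identity survives the two limits in \<open>has_fourier_L2\<close>.\<close>

lemma fourier_multiplication:
  assumes u [measurable]: "integrable lborel u" and \<phi> [measurable]: "integrable lborel \<phi>"
  shows "(LINT x|lborel. u x * (LINT w|lborel. \<phi> w * cnj (wave x w))) =
    (LINT w|lborel. \<phi> w * (LINT x|lborel. u x * cnj (wave w x)))"
proof -
  have [measurable]: "(\<lambda>(x, w). wave x w) \<in> borel_measurable (borel \<Otimes>\<^sub>M borel)"
    unfolding wave_def borel_prod case_prod_beta
    by (intro borel_measurable_continuous_onI continuous_intros)
  have [measurable]: "u \<in> borel_measurable borel" "\<phi> \<in> borel_measurable borel"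
    using assms by auto
  have "integrable (lborel \<Otimes>\<^sub>M lborel) (\<lambda>(x, w). u x * (\<phi> w * cnj (wave x w)))"
  proof (rule lborel_pair.Fubini_integrable)
    show "integrable lborel (\<lambda>x. LINT w|lborel. norm (case (x, w) of (x, w) \<Rightarrow> u x * (\<phi> w * cnj (wave x w))))"
      using u by (simp add: norm_mult)
    show "AE x in lborel. integrable lborel (\<lambda>w. case (x, w) of (x, w) \<Rightarrow> u x * (\<phi> w * cnj (wave x w)))"
      by (intro AE_I2) (auto intro!: integrable_mult_right integrable_bounded_mult[OF \<phi>, where C = 1])
  qed measurable
  from lborel_pair.Fubini_integral[OF this]
  have "(LINT w|lborel. (LINT x|lborel. u x * (\<phi> w * cnj (wave x w)))) =
      (LINT x|lborel. (LINT w|lborel. u x * (\<phi> w * cnj (wave x w))))" .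
  moreover have "(\<lambda>w. LINT x|lborel. u x * (\<phi> w * cnj (wave x w))) =
      (\<lambda>w. \<phi> w * (LINT x|lborel. u x * cnj (wave w x)))"
    by (rule ext, subst integral_mult_right_zero[symmetric]) (simp add: wave_commute mult.left_commute)
  ultimately show ?thesis by simp
qed

lemma tendsto_l2_inner:
  assumes "\<And>n. u n \<in> L2" "f \<in> L2" "h \<in> L2" "(\<lambda>n. l2_norm (\<lambda>x. u n x - f x)) \<longlonglongrightarrow> 0"
  shows "(\<lambda>n. l2_inner (u n) h) \<longlonglongrightarrow> l2_inner f h"
proof -
  have "(\<lambda>n. dist (cls (u n)) (cls f)) \<longlonglongrightarrow> 0"
    using assms by (simp add: dist_norm cls_diff norm_cls L2_diff)
  then have "(\<lambda>n. cls (u n)) \<longlonglongrightarrow> cls f" by (simp add: tendsto_dist_iff[of _ "cls f"])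
  from bounded_linear.tendsto[OF bounded_linear_cinner_left this, of "cls h"]
  show ?thesis using assms by (simp add: cinner_cls)
qed

text \<open>Test functions are translates of a Gaussian, whose transform never vanishes.\<close>

lemma has_fourier_L2_gauss:
  assumes "has_fourier_L2 f h"
  shows "(LINT x|lborel. f x * (of_real (gauss_hat x) * cnj (wave y x))) =
    (LINT w|lborel. h w * of_real (gauss (w - y)))"
proof -
  from assms obtain u where fh: "f \<in> L2" "h \<in> L2"
    and u: "\<And>n. u n \<in> L2" "\<And>n. integrable lborel (u n)" "\<And>n. fourier_integral (u n) \<in> L2"
    and lim: "(\<lambda>n. l2_norm (\<lambda>x. u n x - f x)) \<longlonglongrightarrow> 0"
      "(\<lambda>n. l2_norm (\<lambda>w. fourier_integral (u n) w - h w)) \<longlonglongrightarrow> 0"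
    unfolding has_fourier_L2_def by blast
  define \<phi> where "\<phi> w = complex_of_real (gauss (w - y))" for w
  \<comment> \<open>Conjugated because \<open>l2_inner\<close> conjugates its second argument:
    pairing with \<open>\<Phi>\<close> integrates against the transform of
    \<open>\<phi>\<close>.\<close>
  define \<Phi> where "\<Phi> x = cnj (of_real (gauss_hat x) * cnj (wave y x))" for x
  have \<phi>L2: "\<phi> \<in> L2" using L2_translate[OF gauss_L2, of "- y"] by (simp add: \<phi>_def[abs_def])
  have \<Phi>L2: "\<Phi> \<in> L2"
    unfolding \<Phi>_def[abs_def] using L2_bounded_mult[OF gauss_hat_L2, of "\<lambda>x. cnj (wave y x)" 1]
    by (intro L2_cnj) (simp add: mult.commute)
  have \<phi>i: "integrable lborel \<phi>"
    using integrable_translate_iff[of "\<lambda>x. complex_of_real (gauss x)" "- y"] gauss_integrable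
    by (simp add: \<phi>_def[abs_def])
  have \<phi>hat: "(LINT w|lborel. \<phi> w * cnj (wave x w)) = of_real (gauss_hat x) * cnj (wave y x)" for x
  proof -
    have "(LINT w|lborel. \<phi> w * cnj (wave x w)) = (LINT w|lborel. \<phi> (w + y) * cnj (wave x (w + y)))"
      by (rule integral_translate[symmetric]) (auto simp: \<phi>_def)
    also have "\<dots> = (LINT w|lborel. of_real (gauss w) * cnj (wave x w) * cnj (wave x y))"
      by (simp add: \<phi>_def wave_add_right mult.assoc)
    also have "\<dots> = of_real (gauss_hat x) * cnj (wave x y)"
      by (subst integral_mult_left_zero) (simp add: gauss_fourier)
    finally show ?thesis by (simp add: wave_commute)
  qed
  have eq: "l2_inner (u n) \<Phi> = l2_inner (fourier_integral (u n)) \<phi>" for n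
  proof -
    have "l2_inner (u n) \<Phi> = (LINT x|lborel. u n x * (LINT w|lborel. \<phi> w * cnj (wave x w)))"
      by (simp only: l2_inner_def \<phi>hat \<Phi>_def complex_cnj_cnj)
    also have "\<dots> = (LINT w|lborel. \<phi> w * (LINT x|lborel. u n x * cnj (wave w x)))"
      by (rule fourier_multiplication[OF u(2) \<phi>i])
    also have "\<dots> = l2_inner (fourier_integral (u n)) \<phi>"
      by (simp add: l2_inner_def fourier_integral_wave \<phi>_def mult.commute)
    finally show ?thesis .
  qed
  have "(\<lambda>n. l2_inner (u n) \<Phi>) \<longlonglongrightarrow> l2_inner f \<Phi>"
    by (rule tendsto_l2_inner[OF u(1) fh(1) \<Phi>L2 lim(1)])
  moreover have "(\<lambda>n. l2_inner (u n) \<Phi>) \<longlonglongrightarrow> l2_inner h \<phi>"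
    unfolding eq by (rule tendsto_l2_inner[OF u(3) fh(2) \<phi>L2 lim(2)])
  ultimately have "l2_inner f \<Phi> = l2_inner h \<phi>" by (rule LIMSEQ_unique)
  then show ?thesis by (simp add: l2_inner_def \<Phi>_def \<phi>_def)
qed

text \<open>By \<open>has_fourier_L2_gauss\<close> the transform of \<open>g\<close> times
  \<open>gauss_hat\<close> is \<open>h\<close> integrated against translated Gaussians, hence real.
  A real transform is also that of the reflected conjugate, and \<open>fourier_uniqueness\<close>
  applies to the difference.\<close>

lemma real_fourier_imp_hermitian:
  fixes g h :: "real ^ 'd \<Rightarrow> complex"
  assumes F: "has_fourier_L2 g h" and real: "AE w in lborel. h w = cnj (h w)"
  shows "AE x in lborel. g (- x) = cnj (g x)"
proof -
  have g: "g \<in> L2" and h: "h \<in> L2" using F unfolding has_fourier_L2_def by blast+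
  have [measurable]: "g \<in> borel_measurable borel" "h \<in> borel_measurable borel"
    by (rule L2_measurable[OF g] L2_measurable[OF h])+
  \<comment> \<open>The factor \<open>gauss_hat\<close> makes \<open>W\<close> integrable, although
    \<open>g\<close> is only in \<open>L2\<close>; being positive, it can be divided out at the
    end.\<close>
  define W where "W x = g x * of_real (gauss_hat x) - cnj (g (- x)) * of_real (gauss_hat x)" for x
  have i: "integrable lborel (\<lambda>x. g x * of_real (gauss_hat x))"
    "integrable lborel (\<lambda>x. cnj (g (- x)) * of_real (gauss_hat x))"
    by (rule L2_mult_integrable[OF g gauss_hat_L2]
        L2_mult_integrable[OF L2_cnj[OF L2_uminus_arg[OF g]] gauss_hat_L2])+
  have "(LINT x|lborel. W x * cnj (wave y x)) = 0" for y
  proof -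
    let ?J = "LINT x|lborel. g x * (of_real (gauss_hat x) * cnj (wave y x))"
    have "cnj ?J = (LINT w|lborel. cnj (h w) * of_real (gauss (w - y)))"
      unfolding has_fourier_L2_gauss[OF F] by (subst Bochner_Integration.integral_cnj[symmetric]) simp
    also have "\<dots> = (LINT w|lborel. h w * of_real (gauss (w - y)))"
      using real by (intro integral_cong_AE) (auto elim!: eventually_mono)
    also have "\<dots> = ?J" by (rule has_fourier_L2_gauss[OF F, symmetric])
    finally have Jr: "cnj ?J = ?J" .
    have "cnj ?J = (LINT x|lborel. cnj (g x) * (of_real (gauss_hat x) * wave y x))"
      by (subst Bochner_Integration.integral_cnj[symmetric]) simp
    also have "\<dots> = (LINT x|lborel. cnj (g (- x)) * (of_real (gauss_hat (- x)) * wave y (- x)))"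
      by (rule integral_uminus_vec[symmetric]) measurable
    finally have "?J = (LINT x|lborel. cnj (g (- x)) * (of_real (gauss_hat x) * cnj (wave y x)))"
      unfolding Jr by (simp only: gauss_hat_even wave_minus_right)
    moreover have "integrable lborel (\<lambda>x. g x * of_real (gauss_hat x) * cnj (wave y x))"
      "integrable lborel (\<lambda>x. cnj (g (- x)) * of_real (gauss_hat x) * cnj (wave y x))"
      by (intro integrable_bounded_mult[where C = 1] i; simp)+
    ultimately show ?thesis
      by (simp add: W_def left_diff_distrib mult.assoc)
  qed
  from this[of "- _"] have "(LINT x|lborel. W x * wave y x) = 0" for y
    by (simp add: wave_minus_left)
  then have "AE x in lborel. W x = 0"
    by (intro fourier_uniqueness) (use i in \<open>auto simp: W_def[abs_def]\<close>)
  then show ?thesis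
  proof eventually_elim
    case (elim x)
    then have "g x = cnj (g (- x))"
      using gauss_hat_pos[of x] by (simp add: W_def)
    then show ?case by simp
  qed
qed

section \<open>Parseval's formula\<close>

text \<open>The frame operator of an orthonormal family is the projection onto its closed span; what
  \<open>parseval_cube\<close> exploits is that the residual is orthogonal to the family.\<close>

lemma orthonormal_frame_op:
  assumes o: "\<And>i j. i \<in> J \<Longrightarrow> j \<in> J \<Longrightarrow> cinner (\<phi> i) (\<phi> j) = of_bool (i = j)"
  shows orthonormal_bessel: "bessel J \<phi> 1"
    and cinner_orthonormal_frame_op: "j \<in> J \<Longrightarrow> cinner (frame_op J \<phi> x) (\<phi> j) = cinner x (\<phi> j)"
proof -
  have "riesz_seq J \<phi> 1 1" using o by (simp add: riesz_one_iff_orthonormal)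
  then show B: "bessel J \<phi> 1"
    by (intro synthesis_le_imp_bessel) (auto simp: riesz_seq_def)
  assume j: "j \<in> J"
  have "((\<lambda>i. cinner x (\<phi> i) * cinner (\<phi> i) (\<phi> j)) has_sum cinner (frame_op J \<phi> x) (\<phi> j)) J"
    by (rule frame_op_form[OF B]) simp
  moreover have "((\<lambda>i. cinner x (\<phi> i) * cinner (\<phi> i) (\<phi> j)) has_sum cinner x (\<phi> j)) J \<longleftrightarrow>
      ((\<lambda>i. cinner x (\<phi> j)) has_sum cinner x (\<phi> j)) {j}"
    using j by (intro has_sum_cong_neutral) (auto simp: o)
  moreover have "((\<lambda>i. cinner x (\<phi> j)) has_sum cinner x (\<phi> j)) {j}"
    by (rule has_sum_finiteI) auto
  ultimately show "cinner (frame_op J \<phi> x) (\<phi> j) = cinner x (\<phi> j)"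
    using has_sum_unique by blast
qed

lemma unit_interval_wave:
  "(LINT t|lborel. indicator {- 1/2..1/2} t *\<^sub>R cis (2 * pi * of_int n * t)) = of_bool (n = 0)"
proof (cases "n = 0")
  case True
  have "(LINT t|lborel. indicator {- 1/2..1/2::real} t *\<^sub>R (1 :: complex)) = of_real (LINT t|lborel. indicator {- 1/2..1/2::real} t)"
    by (subst integral_complex_of_real[symmetric]) (simp add: scaleR_conv_of_real)
  with True show ?thesis by simp
next
  case False
  define c where "c = 2 * pi * real_of_int n"
  have c: "c \<noteq> 0" using False by (simp add: c_def)
  define F where "F t = cis (c * t) / (\<i> * c)" for t
  have "(F has_vector_derivative cis (c * t)) (at t within A)" for t A
  proof -
    have "((\<lambda>z. exp (\<i> * c * z) / (\<i> * c)) has_field_derivative exp (\<i> * c * of_real t)) (at (of_real t))"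
      using c by (auto intro!: derivative_eq_intros)
    from has_vector_derivative_real_field[OF this, of A]
    show ?thesis by (simp add: F_def[abs_def] cis_conv_exp mult.assoc)
  qed
  then have "(LINT t|lborel. indicator {- 1/2..1/2} t *\<^sub>R cis (c * t)) = F (1/2) - F (- 1/2)"
    by (intro integral_FTC_atLeastAtMost continuous_intros) auto
  also have "\<dots> = 0"
  proof -
    have "c * (1/2) = c * (- 1/2) + 2 * pi * real_of_int n" by (simp add: c_def)
    then have "cis (c * (1/2)) = cis (c * (- 1/2)) * cis (2 * pi * real_of_int n)"
      by (simp only: cis_mult)
    also have "\<dots> = cis (c * (- 1/2))" by (simp add: cis_multiple_2pi)
    finally show ?thesis by (simp only: F_def diff_self)
  qed
  finally show ?thesis using False by (simp add: c_def)
qed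

lemma Basis_vec_real: "(Basis :: (real ^ 'd) set) = (\<lambda>i. axis i 1) ` UNIV"
  by (auto simp: Basis_vec_def)

lemma prod_Basis_vec: "(\<Prod>b\<in>(Basis :: (real ^ 'd) set). f b) = (\<Prod>i\<in>UNIV. f (axis i 1))"
proof -
  have inj: "inj (\<lambda>i::'d. axis i (1::real))" by (auto simp: inj_on_def axis_eq_axis)
  show ?thesis unfolding Basis_vec_real by (subst prod.reindex[OF inj]) simp
qed

lemma indicator_ccube: "indicator (ccube 1) x = (\<Prod>b\<in>Basis. indicator {- 1/2..1/2} (x \<bullet> b) :: complex)"
proof -
  have "(\<Prod>b\<in>Basis. indicator {- 1/2..1/2} (x \<bullet> b) :: complex) =
      (\<Prod>i\<in>UNIV. indicator {- 1/2..1/2} (x $ i))"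
    by (simp add: prod_Basis_vec inner_axis)
  also have "\<dots> = indicator (ccube 1) x"
    by (auto simp: indicator_def mem_box_cart prod_zero_iff split: if_splits intro!: prod.neutral) 
  finally show ?thesis ..
qed

lemma integral_cube_wave:
  "(LINT x|lborel. indicator (ccube 1) x * wave (real_vec \<gamma>) x) = of_bool (\<gamma> = 0)"
proof -
  have cont: "integrable lborel (\<lambda>t. indicator {- 1/2..1/2} t *\<^sub>R cis (c * t))" for c
    by (rule borel_integrable_atLeastAtMost'[unfolded set_integrable_def]) (intro continuous_intros)
  have "(LINT x|lborel. indicator (ccube 1) x * wave (real_vec \<gamma>) x) =
      (LINT x|lborel. (\<Prod>b\<in>Basis. (\<lambda>t. indicator {- 1/2..1/2} t *\<^sub>R cis (2 * pi * (real_vec \<gamma> \<bullet> b) * t)) (x \<bullet> b)))"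
  proof (intro Bochner_Integration.integral_cong refl)
    fix x :: "real ^ 'a"
    have sc: "indicator A t *\<^sub>R z = indicator A t * z" for A and t :: real and z :: complex
      by (simp add: indicator_def)
    show "indicator (ccube 1) x * wave (real_vec \<gamma>) x =
        (\<Prod>b\<in>Basis. (\<lambda>t. indicator {- 1/2..1/2} t *\<^sub>R cis (2 * pi * (real_vec \<gamma> \<bullet> b) * t)) (x \<bullet> b))"
      unfolding indicator_ccube wave_prod prod.distrib[symmetric] sc ..
  qed
  also have "\<dots> = (\<Prod>b\<in>Basis. (LINT t|lborel. indicator {- 1/2..1/2} t *\<^sub>R cis (2 * pi * (real_vec \<gamma> \<bullet> b) * t)))"
    by (rule integral_lborel_product) (rule cont)
  also have "\<dots> = (\<Prod>i\<in>UNIV. of_bool (\<gamma> $ i = 0))"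
  proof -
    have "real_vec \<gamma> \<bullet> axis i 1 = of_int (\<gamma> $ i)" for i by (simp add: inner_axis)
    then show ?thesis by (simp only: prod_Basis_vec unit_interval_wave)
  qed
  also have "\<dots> = of_bool (\<gamma> = 0)"
    by (auto simp: vec_eq_iff of_bool_def prod_zero_iff split: if_splits)
  finally show ?thesis .
qed

text \<open>For integer frequencies this is both a value of the Fourier transform of
  \<open>v\<close> and a Fourier coefficient of its periodisation; the second reading explains
  \<open>fcoef_translate_int\<close>.\<close>

definition fcoef :: "(real ^ 'd \<Rightarrow> complex) \<Rightarrow> int ^ 'd \<Rightarrow> complex" where
  "fcoef v \<gamma> = (LINT x|lborel. v x * cnj (wave (real_vec \<gamma>) x))"

definition cube_wave :: "int ^ 'd \<Rightarrow> real ^ 'd \<Rightarrow> complex" where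
  "cube_wave \<gamma> x = indicator (ccube 1) x * wave (real_vec \<gamma>) x"

lemma test_fun_cube_wave: "test_fun (cube_wave \<gamma>)"
proof -
  obtain M where M: "\<And>x :: real ^ 'a. x \<in> ccube 1 \<Longrightarrow> norm x \<le> M"
    using bounded_cbox unfolding bounded_iff by blast
  show ?thesis
    unfolding test_fun_def
  proof (intro conjI exI allI impI)
    show "cube_wave \<gamma> \<in> borel_measurable borel"
      unfolding cube_wave_def[abs_def] by measurable
    show "cmod (cube_wave \<gamma> x) \<le> 1" for x by (simp add: cube_wave_def norm_mult indicator_def)
    show "norm x \<le> M" if "cube_wave \<gamma> x \<noteq> 0" for x
      using that M by (auto simp: cube_wave_def indicator_def split: if_splits)
  qed
qed

lemmas cube_wave_L2 [simp, intro] = test_fun_L2[OF test_fun_cube_wave]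

lemma cube_wave_inner: "l2_inner (cube_wave \<gamma>) (cube_wave \<delta>) = of_bool (\<gamma> = \<delta>)"
proof -
  have "l2_inner (cube_wave \<gamma>) (cube_wave \<delta>) =
      (LINT x|lborel. indicator (ccube 1) x * wave (real_vec (\<gamma> - \<delta>)) x)"
    unfolding l2_inner_def
    by (intro Bochner_Integration.integral_cong refl)
      (simp add: cube_wave_def real_vec_diff wave_diff_left indicator_def)
  then show ?thesis by (simp only: integral_cube_wave right_minus_eq)
qed

lemma fcoef_cube:
  assumes "\<And>x. x \<notin> ccube 1 \<Longrightarrow> v x = 0"
  shows "l2_inner v (cube_wave \<gamma>) = fcoef v \<gamma>"
  unfolding l2_inner_def fcoef_def
  by (intro Bochner_Integration.integral_cong refl) (use assms in \<open>auto simp: cube_wave_def indicator_def\<close>)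

text \<open>Let p be the projection of u onto the span of the cube waves. The residual has vanishing
  coefficients on the cube, so it is 0 there by \<open>torus_uniqueness\<close>; since v lives on
  the cube, u and p have the same inner product with v, and for p the series is known.\<close>

lemma parseval_cube:
  assumes u: "u \<in> L2" "\<And>x. x \<notin> ccube 1 \<Longrightarrow> u x = 0"
    and v: "v \<in> L2" "\<And>x. x \<notin> ccube 1 \<Longrightarrow> v x = 0"
  shows "((\<lambda>\<gamma>. fcoef u \<gamma> * cnj (fcoef v \<gamma>)) has_sum l2_inner u v) UNIV"
proof -
  define \<phi> where "\<phi> \<gamma> = cls (cube_wave \<gamma> :: real ^ 'a \<Rightarrow> complex)" for \<gamma>
  have o: "cinner (\<phi> i) (\<phi> j) = of_bool (i = j)" for i j
    by (simp add: \<phi>_def cinner_cls cube_wave_inner)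
  note B = orthonormal_bessel[of UNIV \<phi>, OF o]
  define p where "p = frame_op UNIV \<phi> (cls u)"
  have p: "cinner p (\<phi> j) = cinner (cls u) (\<phi> j)" for j
    unfolding p_def by (rule cinner_orthonormal_frame_op[OF o]) auto
  define w where "w = rep (cls u - p)"
  have wL2: "w \<in> L2" by (simp add: w_def)
  have [measurable]: "w \<in> borel_measurable borel" using wL2 by (rule L2_measurable)
  have wz: "l2_inner w (cube_wave \<gamma>) = 0" for \<gamma>
  proof -
    have "l2_inner w (cube_wave \<gamma>) = cinner (cls w) (\<phi> \<gamma>)"
      by (simp add: \<phi>_def cinner_cls wL2)
    also have "\<dots> = 0" by (simp add: w_def cinner_diff_left p)
    finally show ?thesis .
  qed
  have i1: "integrable lborel (\<lambda>x. indicator (ccube 1) x * w x)"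
    using L2_mult_integrable[OF cube_wave_L2[of 0] wL2] by (simp add: cube_wave_def)
  have ann: "annihilates 1 (\<lambda>x. indicator (ccube 1) x * w x)"
    unfolding annihilates_def
  proof (intro conjI allI i1)
    fix \<gamma>
    have "(LINT x|lborel. indicator (ccube 1) x * w x * wave (real_vec \<gamma> /\<^sub>R 1) x) =
        l2_inner w (cube_wave (- \<gamma>))"
      unfolding l2_inner_def
      by (intro Bochner_Integration.integral_cong refl)
        (simp add: cube_wave_def real_vec_minus wave_minus_left indicator_def)
    then show "(LINT x|lborel. indicator (ccube 1) x * w x * wave (real_vec \<gamma> /\<^sub>R 1) x) = 0"
      using wz by simp
  qed
  have "AE x in lborel. indicator (ccube 1) x * w x = 0"
    by (rule torus_uniqueness[OF ann]) (simp add: indicator_def)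
  then have "l2_inner w v = 0"
    unfolding l2_inner_def
  proof (intro integral_eq_zero_AE)
    assume "AE x in lborel. indicator (ccube 1) x * w x = 0"
    then show "AE x in lborel. w x * cnj (v x) = 0"
      by eventually_elim (use v in \<open>auto simp: indicator_def split: if_splits\<close>)
  qed
  then have "cinner (cls u - p) (cls v) = 0"
    using cinner_cls[OF wL2 v(1)] by (simp add: w_def)
  then have "cinner p (cls v) = l2_inner u v"
    by (simp add: cinner_diff_left cinner_cls u v)
  moreover have "((\<lambda>\<gamma>. cinner (cls u) (\<phi> \<gamma>) * cinner (\<phi> \<gamma>) (cls v)) has_sum cinner p (cls v)) UNIV"
    unfolding p_def by (rule frame_op_form[OF B]) simp
  moreover have "cinner (cls u) (\<phi> \<gamma>) * cinner (\<phi> \<gamma>) (cls v) = fcoef u \<gamma> * cnj (fcoef v \<gamma>)" for \<gamma>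
  proof -
    have "cinner (\<phi> \<gamma>) (cls v) = cnj (cinner (cls v) (\<phi> \<gamma>))" by (simp add: cnj_cinner)
    moreover have "l2_inner u (cube_wave \<gamma>) = fcoef u \<gamma>" by (rule fcoef_cube) (rule u(2))
    moreover have "l2_inner v (cube_wave \<gamma>) = fcoef v \<gamma>" by (rule fcoef_cube) (rule v(2))
    ultimately show ?thesis
      using u v by (simp add: \<phi>_def cinner_cls)
  qed
  ultimately show ?thesis by simp
qed

lemma fcoef_translate:
  assumes "u \<in> L2"
  shows "fcoef (\<lambda>x. u (x + t)) \<gamma> = wave (real_vec \<gamma>) t * fcoef u \<gamma>"
proof -
  have [measurable]: "u \<in> borel_measurable borel" using assms by (rule L2_measurable)
  have "fcoef (\<lambda>x. u (x + t)) \<gamma> =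
      (LINT x|lborel. u (x + t) * cnj (wave (real_vec \<gamma>) (x + t)) * wave (real_vec \<gamma>) t)"
    unfolding fcoef_def
    by (intro Bochner_Integration.integral_cong refl) (simp add: wave_add_right mult.assoc)
  also have "\<dots> = (LINT x|lborel. u x * cnj (wave (real_vec \<gamma>) x) * wave (real_vec \<gamma>) t)"
    by (rule integral_translate) measurable
  also have "\<dots> = wave (real_vec \<gamma>) t * fcoef u \<gamma>"
    by (simp add: fcoef_def mult.commute)
  finally show ?thesis .
qed

lemma fcoef_translate_int:
  assumes "u \<in> L2"
  shows "fcoef (\<lambda>x. u (x + real_vec m)) \<gamma> = fcoef u \<gamma>"
  by (simp add: fcoef_translate[OF assms] wave_of_int real_vec_inner_Ints)

lemma parseval_translated_cube:
  assumes u: "u \<in> L2" "\<And>x. x - t \<notin> ccube 1 \<Longrightarrow> u x = 0"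
    and v: "v \<in> L2" "\<And>x. x - t \<notin> ccube 1 \<Longrightarrow> v x = 0"
  shows "((\<lambda>\<gamma>. fcoef u \<gamma> * cnj (fcoef v \<gamma>)) has_sum l2_inner u v) UNIV"
proof -
  have "((\<lambda>\<gamma>. fcoef (\<lambda>x. u (x + t)) \<gamma> * cnj (fcoef (\<lambda>x. v (x + t)) \<gamma>)) has_sum
      l2_inner (\<lambda>x. u (x + t)) (\<lambda>x. v (x + t))) UNIV"
    using u(2)[of "_ + t"] v(2)[of "_ + t"] by (intro parseval_cube L2_translate u v) auto
  moreover have "fcoef (\<lambda>x. u (x + t)) \<gamma> * cnj (fcoef (\<lambda>x. v (x + t)) \<gamma>) = fcoef u \<gamma> * cnj (fcoef v \<gamma>)" for \<gamma>
    using wave_mult_cnj(1)[of "real_vec \<gamma>" t]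
    by (simp add: fcoef_translate u v mult_ac)
  ultimately show ?thesis by (simp add: l2_inner_translate u v)
qed

section \<open>Parseval's formula for bounded supports\<close>

definition cell :: "real ^ 'd \<Rightarrow> int ^ 'd" where
  "cell x = (\<chi> i. \<lfloor>x $ i + 1 / 2\<rfloor>)"

lemma cell_add_int: "cell (x + real_vec m) = cell x + m"
  by (auto simp: cell_def vec_eq_iff) linarith

lemma cell_in_ccube: "x - real_vec (cell x) \<in> ccube 1"
  by (auto simp: mem_box_cart cell_def) linarith+

lemma cell_measurable [measurable]: "{x. cell x = m} \<in> sets borel"
proof -
  have "{x. cell x = m} = (\<Inter>i. {x. real_of_int (m $ i) \<le> x $ i + 1 / 2 \<and> x $ i + 1 / 2 < real_of_int (m $ i) + 1})"
    by (auto simp: cell_def vec_eq_iff floor_eq_iff)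
  also have "\<dots> \<in> sets borel" by (intro sets.countable_INT' countableI_type) (auto)
  finally show ?thesis .
qed

lemma finite_int_box: "finite {m :: int ^ 'd. \<forall>i. \<bar>m $ i\<bar> \<le> K}"
proof -
  have "{m :: int ^ 'd. \<forall>i. \<bar>m $ i\<bar> \<le> K} \<subseteq> vec_lambda ` (UNIV \<rightarrow>\<^sub>E {- K..K})"
  proof
    fix m :: "int ^ 'd" assume "m \<in> {m. \<forall>i. \<bar>m $ i\<bar> \<le> K}"
    then have "vec_nth m \<in> UNIV \<rightarrow>\<^sub>E {- K..K}" by (auto simp: abs_le_iff minus_le_iff)
    then show "m \<in> vec_lambda ` (UNIV \<rightarrow>\<^sub>E {- K..K})"
      by (metis image_eqI vec_nth_inverse)
  qed
  then show ?thesis by (rule finite_subset) (intro finite_imageI finite_PiE, auto)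
qed

lemma cell_bounded:
  assumes "norm x \<le> M"
  shows "\<forall>i. \<bar>cell x $ i\<bar> \<le> \<lceil>M\<rceil> + 1"
proof
  fix i
  have "\<bar>x $ i\<bar> \<le> M" using component_le_norm_cart[of x i] assms by linarith
  then show "\<bar>cell x $ i\<bar> \<le> \<lceil>M\<rceil> + 1" by (simp add: cell_def) linarith
qed

lemma has_sum_finite_sum:
  fixes f :: "'i \<Rightarrow> 'j \<Rightarrow> 'b::topological_comm_monoid_add"
  assumes "\<And>i. i \<in> A \<Longrightarrow> (f i has_sum s i) B"
  shows "((\<lambda>x. \<Sum>i\<in>A. f i x) has_sum (\<Sum>i\<in>A. s i)) B"
  using assms by (induction A rule: infinite_finite_induct) (auto intro!: has_sum_add)

lemma fcoef_sum:
  assumes "\<And>i. i \<in> A \<Longrightarrow> integrable lborel (u i)"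
  shows "fcoef (\<lambda>x. \<Sum>i\<in>A. u i x) \<gamma> = (\<Sum>i\<in>A. fcoef (u i) \<gamma>)"
  unfolding fcoef_def sum_distrib_right
  by (intro Bochner_Integration.integral_sum integrable_bounded_mult[where C = 1] assms) auto

lemma test_fun_indicator: "test_fun (indicator (cball (0::'a::euclidean_space) M))"
  unfolding test_fun_def
proof (intro conjI)
  show "\<exists>C. \<forall>x::'a. cmod (indicator (cball 0 M) x) \<le> C"
    by (rule exI[of _ 1]) (simp add: indicator_def)
  show "\<exists>M'. \<forall>x::'a. indicator (cball 0 M) x \<noteq> (0 :: complex) \<longrightarrow> norm x \<le> M'"
    by (rule exI[of _ M]) (simp add: indicator_def)
qed (simp add: borel_measurable_indicator)

lemma L2_bounded_support_integrable:
  fixes f :: "'a::euclidean_space \<Rightarrow> complex"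
  assumes "f \<in> L2" "\<And>x. f x \<noteq> 0 \<Longrightarrow> norm x \<le> M"
  shows "integrable lborel f"
proof -
  have "(\<lambda>x. indicator (cball 0 M) x * f x) = f"
    using assms(2) by (auto simp: indicator_def fun_eq_iff)
  then show ?thesis
    using L2_mult_integrable[OF test_fun_L2[OF test_fun_indicator[of M]] assms(1)] by simp
qed

text \<open>Cut u and v into their finitely many pieces over integer cells. Moving a piece to the
  unit cube does not change its coefficients, so \<open>parseval_cube\<close> applies to each pair
  of pieces; the series over k collects the same pairs (m, n) according to k = n - m.\<close>

lemma parseval_bounded_support:
  assumes u: "u \<in> L2" "\<And>x. u x \<noteq> 0 \<Longrightarrow> norm x \<le> M"
    and v: "v \<in> L2" "\<And>x. v x \<noteq> 0 \<Longrightarrow> norm x \<le> M"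
  shows "\<exists>S. ((\<lambda>\<gamma>. fcoef u \<gamma> * cnj (fcoef v \<gamma>)) has_sum S) UNIV \<and>
    ((\<lambda>k. LINT x|lborel. u x * cnj (v (x + real_vec k))) has_sum S) UNIV"
proof -
  define A where "A = {m :: int ^ 'a. \<forall>i. \<bar>m $ i\<bar> \<le> \<lceil>M\<rceil> + 1}"
  have A: "finite A" unfolding A_def by (rule finite_int_box)
  have cellA: "cell x \<in> A" if "norm x \<le> M" for x
    using cell_bounded[OF that] by (simp add: A_def)
  define c where "c m x = (indicator {x. cell x = m} x :: complex)" for m :: "int ^ 'a" and x
  define um where "um m x = c m x * u x" for m x
  define vm where "vm m x = c m x * v x" for m x
  have umL2: "um m \<in> L2" and vmL2: "vm m \<in> L2" for m
    unfolding um_def[abs_def] vm_def[abs_def] c_def by (intro L2_indicator u v cell_measurable)+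
  have umi: "integrable lborel (um m)" and vmi: "integrable lborel (vm m)" for m
    using u(2) v(2) by (auto intro!: L2_bounded_support_integrable[of _ M] umL2 vmL2 simp: um_def vm_def)
  have usum: "u = (\<lambda>x. \<Sum>m\<in>A. um m x)"
  proof
    fix x
    have "(\<Sum>m\<in>A. um m x) = (\<Sum>m\<in>A. if cell x = m then u x else 0)"
      by (intro sum.cong refl) (auto simp: um_def c_def indicator_def)
    then show "u x = (\<Sum>m\<in>A. um m x)"
      using A cellA[of x] u(2)[of x] by (cases "u x = 0") auto
  qed
  have vsum: "v = (\<lambda>x. \<Sum>m\<in>A. vm m x)"
  proof
    fix x
    have "(\<Sum>m\<in>A. vm m x) = (\<Sum>m\<in>A. if cell x = m then v x else 0)"
      by (intro sum.cong refl) (auto simp: vm_def c_def indicator_def)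
    then show "v x = (\<Sum>m\<in>A. vm m x)"
      using A cellA[of x] v(2)[of x] by (cases "v x = 0") auto
  qed
  \<comment> \<open>When both pieces are moved to the unit cube, the relative translation of piece m
    of \<open>u\<close> and piece n of \<open>v\<close> is n - m.\<close>
  define J where "J m n = (LINT x|lborel. um m x * cnj (vm n (x + real_vec (n - m))))" for m n
  have part: "((\<lambda>\<gamma>. fcoef (um m) \<gamma> * cnj (fcoef (vm n) \<gamma>)) has_sum J m n) UNIV" for m n
  proof -
    have cc: "cell (x + real_vec m) = m \<Longrightarrow> x \<in> ccube 1" for x and m :: "int ^ 'a"
      using cell_in_ccube[of x] by (simp add: cell_add_int)
    have "((\<lambda>\<gamma>. fcoef (\<lambda>x. um m (x + real_vec m)) \<gamma> * cnj (fcoef (\<lambda>x. vm n (x + real_vec n)) \<gamma>)) has_sum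
        l2_inner (\<lambda>x. um m (x + real_vec m)) (\<lambda>x. vm n (x + real_vec n))) UNIV"
      using cc by (intro parseval_cube L2_translate umL2 vmL2) (auto simp: um_def vm_def c_def indicator_def)
    moreover have "l2_inner (\<lambda>x. um m (x + real_vec m)) (\<lambda>x. vm n (x + real_vec n)) = J m n"
    proof -
      have [measurable]: "um m \<in> borel_measurable borel" "vm n \<in> borel_measurable borel"
        by (rule L2_measurable[OF umL2] L2_measurable[OF vmL2])+
      have "J m n = (LINT x|lborel. um m (x + real_vec m) * cnj (vm n (x + real_vec m + real_vec (n - m))))"
        unfolding J_def by (rule integral_translate[symmetric]) measurable
      then show ?thesis by (simp add: l2_inner_def real_vec_diff add.assoc)
    qed
    ultimately show ?thesis by (simp add: fcoef_translate_int umL2 vmL2)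
  qed
  define S where "S = (\<Sum>m\<in>A. \<Sum>n\<in>A. J m n)"
  have "((\<lambda>\<gamma>. \<Sum>m\<in>A. \<Sum>n\<in>A. fcoef (um m) \<gamma> * cnj (fcoef (vm n) \<gamma>)) has_sum S) UNIV"
    unfolding S_def by (intro has_sum_finite_sum part)
  moreover have "(\<Sum>m\<in>A. \<Sum>n\<in>A. fcoef (um m) \<gamma> * cnj (fcoef (vm n) \<gamma>)) = fcoef u \<gamma> * cnj (fcoef v \<gamma>)" for \<gamma>
    by (subst usum, subst vsum, subst (1 2) fcoef_sum)
      (simp_all add: umi vmi sum_product)
  ultimately have 1: "((\<lambda>\<gamma>. fcoef u \<gamma> * cnj (fcoef v \<gamma>)) has_sum S) UNIV" by simp
  \<comment> \<open>For a fixed piece m of \<open>u\<close>, only the finitely many k = n - m with n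
    in \<open>A\<close> contribute.\<close>
  define L where "L m k = (LINT x|lborel. um m x * cnj (v (x + real_vec k)))" for m k
  have Lint: "integrable lborel (\<lambda>x. um m x * cnj (v (x + real_vec k)))" for m k
    using L2_inner_integrable[OF umL2 L2_translate[OF v(1)]] by simp
  have Lm: "((\<lambda>k. L m k) has_sum (\<Sum>n\<in>A. J m n)) UNIV" for m
  proof -
    have LJ: "L m (n - m) = (if n \<in> A then J m n else 0)" for n
    proof -
      have "um m x * cnj (v (x + real_vec (n - m))) =
          (if n \<in> A then um m x * cnj (vm n (x + real_vec (n - m))) else 0)" for x
        using cellA[of "x + real_vec (n - m)"] v(2)[of "x + real_vec (n - m)"]
        by (auto simp: um_def vm_def c_def indicator_def cell_add_int)
      then show ?thesis by (simp add: L_def J_def)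
    qed
    have "((\<lambda>n. L m (n - m)) has_sum (\<Sum>n\<in>A. J m n)) UNIV \<longleftrightarrow> ((\<lambda>n. J m n) has_sum (\<Sum>n\<in>A. J m n)) A"
      by (intro has_sum_cong_neutral) (auto simp: LJ)
    then have "((\<lambda>n. L m (n - m)) has_sum (\<Sum>n\<in>A. J m n)) UNIV"
      using A by simp
    moreover have "bij_betw (\<lambda>n. n - m) UNIV UNIV"
      by (rule bij_betw_byWitness[where f' = "\<lambda>n. n + m"]) auto
    ultimately show ?thesis
      using has_sum_reindex_bij_betw[of "\<lambda>n. n - m" UNIV UNIV "L m"] by simp
  qed
  have "((\<lambda>k. \<Sum>m\<in>A. L m k) has_sum S) UNIV"
    unfolding S_def by (intro has_sum_finite_sum Lm)
  moreover have "(\<Sum>m\<in>A. L m k) = (LINT x|lborel. u x * cnj (v (x + real_vec k)))" for k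
    unfolding L_def by (subst Bochner_Integration.integral_sum[symmetric])
      (auto simp: Lint sum_distrib_right[symmetric] usum[symmetric] fun_cong[OF usum, symmetric])
  ultimately show ?thesis using 1 by auto
qed

section \<open>Separable groups and their characters\<close>

lemma bit_vec_double [simp]: "(x :: bit ^ 'd) + x = 0"
proof -
  have "b + b = 0" for b :: bit by (cases b) auto
  then show ?thesis by (simp add: vec_eq_iff)
qed

lemma bit_vec_add_cancel [simp]: "x + (x + y) = (y :: bit ^ 'd)"
  by (simp add: add.assoc[symmetric])

lemma group_add_grp: "group (add_grp (UNIV :: 'a::ab_group_add set))"
  by (rule groupI) (auto simp: add_grp_def add.assoc intro: exI[of _ "- _"])

lemma inv_add_grp_bit: "inv\<^bsub>add_grp UNIV\<^esub> (x :: bit ^ 'd) = x"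
  by (rule group.inv_equality[OF group_add_grp]) (auto simp: add_grp_def)

text \<open>In a group of exponent 2, a word in commuting generators is determined by the set of
  those that occur an odd number of times.\<close>

definition combination :: "nat \<Rightarrow> (nat \<Rightarrow> bit ^ 'd) \<Rightarrow> nat set \<Rightarrow> bit ^ 'd" where
  "combination k s A = (\<Sum>i\<in>{1..k}. if i \<in> A then s i else 0)"

lemma combination_add:
  "combination k s A + combination k s B = combination k s ((A - B) \<union> (B - A))"
  unfolding combination_def sum.distrib[symmetric] by (intro sum.cong) auto

lemma separable_group_eq:
  assumes "separable_group G k s"
  shows "G = combination k s ` Pow {1..k}"
proof
  have G: "G = generate (add_grp UNIV) (s ` {1..k})"
    using assms by (simp add: separable_group_def)
  have single: "combination k s {i} = s i" if "i \<in> {1..k}" for i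
    using that by (simp add: combination_def)
  have all: "combination k s A \<in> combination k s ` Pow {1..k}" for A
    by (rule image_eqI[of _ _ "A \<inter> {1..k}"]) (auto simp: combination_def intro!: sum.cong)
  show "G \<subseteq> combination k s ` Pow {1..k}"
  proof
    fix x assume "x \<in> G"
    then show "x \<in> combination k s ` Pow {1..k}"
      unfolding G
    proof (induction rule: generate.induct)
      case one
      have "combination k s {} = 0" by (simp add: combination_def)
      then show ?case using all[of "{}"] by (simp add: add_grp_def)
    next
      case (incl h)
      then show ?case using all single by (metis imageE)
    next
      case (inv h)
      then show ?case using all single by (metis imageE inv_add_grp_bit)
    next
      case (eng h1 h2)
      then show ?case using all by (auto simp: add_grp_def combination_add)
    qed
  qed
  have add: "x \<in> G \<Longrightarrow> y \<in> G \<Longrightarrow> x + y \<in> G" for x y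
    using generate.eng[of x "add_grp UNIV" "s ` {1..k}" y] by (simp add: G add_grp_def)
  have zero: "0 \<in> G"
    using generate.one[of "add_grp UNIV" "s ` {1..k}"] by (simp add: G add_grp_def)
  have gen: "s i \<in> G" if "i \<in> {1..k}" for i
    using that generate.incl[of "s i" "s ` {1..k}" "add_grp UNIV"] by (simp add: G)
  have "(\<Sum>i\<in>B. if i \<in> A then s i else 0) \<in> G" if "B \<subseteq> {1..k}" for A B
    using finite_subset[OF that finite_atLeastAtMost] that
    by (induction B rule: finite_induct) (auto simp: zero intro!: add gen)
  then show "combination k s ` Pow {1..k} \<subseteq> G"
    by (auto simp: combination_def)
qed

lemma combination_nth:
  assumes "separable_group G k s" "i \<in> {1..k}" "j \<in> supp (s i)" "A \<subseteq> {1..k}"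
  shows "combination k s A $ j = of_bool (i \<in> A)"
proof -
  have "s l $ j = 0" if "l \<in> {1..k}" "l \<noteq> i" for l
  proof -
    have "supp (s i) \<inter> supp (s l) = {}"
      using assms(1,2) that unfolding separable_group_def by blast
    then show ?thesis using assms(3) by (auto simp: supp_def)
  qed
  then have "combination k s A $ j = (\<Sum>l\<in>{1..k}. if l = i then of_bool (i \<in> A) else 0)"
    unfolding combination_def sum_component using assms(3)
    by (intro sum.cong refl) (auto simp: supp_def)
  then show ?thesis using assms(2) by simp
qed

text \<open>Disjoint nonempty supports make the generators independent: a coordinate in the support
  of \<open>s i\<close> shows whether i was used.\<close>

lemma card_separable_group:
  assumes "separable_group G k s"
  shows "card G = 2 ^ k" "finite G"
proof -
  have "inj_on (combination k s) (Pow {1..k})"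
  proof (rule inj_onI)
    fix A B assume AB: "A \<in> Pow {1..k}" "B \<in> Pow {1..k}" "combination k s A = combination k s B"
    have "i \<in> A \<longleftrightarrow> i \<in> B" if i: "i \<in> {1..k}" for i
    proof -
      have "supp (s i) \<noteq> {}" using assms i unfolding separable_group_def by blast
      then obtain j where j: "j \<in> supp (s i)" by auto
      then have "of_bool (i \<in> A) = (of_bool (i \<in> B) :: bit)"
        using combination_nth[OF assms i j, of A] combination_nth[OF assms i j, of B] AB by simp
      then show ?thesis by (auto simp: of_bool_def split: if_splits)
    qed
    then show "A = B" using AB by auto
  qed
  then show "card G = 2 ^ k"
    unfolding separable_group_eq[OF assms] by (simp add: card_image card_Pow)
  show "finite G" unfolding separable_group_eq[OF assms] by simp
qed

lemma separable_group_closed: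
  assumes "separable_group G k s"
  shows "0 \<in> G" "x \<in> G \<Longrightarrow> y \<in> G \<Longrightarrow> x + y \<in> G" "i \<in> {1..k} \<Longrightarrow> s i \<in> G"
proof -
  have sg: "subgroup G (add_grp UNIV)" and G: "G = generate (add_grp UNIV) (s ` {1..k})"
    using assms by (auto simp: separable_group_def)
  show "0 \<in> G" using subgroup.one_closed[OF sg] by (simp add: add_grp_def)
  show "x \<in> G \<Longrightarrow> y \<in> G \<Longrightarrow> x + y \<in> G" using subgroup.m_closed[OF sg] by (simp add: add_grp_def)
  show "s i \<in> G" if "i \<in> {1..k}"
    unfolding G using that by (intro generate.incl) auto
qed

lemma bit_rep_add: "even (bit_rep (\<sigma> + \<tau>) $ i - (bit_rep \<sigma> $ i + bit_rep \<tau> $ i))"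
  by (cases "\<sigma> $ i"; cases "\<tau> $ i") (auto simp: bit_rep_def)

lemma pairing_add_left: "pairing (\<alpha> + \<beta>) \<sigma> = pairing \<alpha> \<sigma> + pairing \<beta> \<sigma>"
  by (simp add: pairing_def distrib_right sum.distrib)

text \<open>Only the parity is additive in the second argument, as the representative of a sum is
  the sum of the representatives reduced modulo 2.\<close>

lemma pairing_add_right: "even (pairing \<alpha> (\<sigma> + \<tau>) - (pairing \<alpha> \<sigma> + pairing \<alpha> \<tau>))"
proof -
  have "pairing \<alpha> (\<sigma> + \<tau>) - (pairing \<alpha> \<sigma> + pairing \<alpha> \<tau>) =
      (\<Sum>i\<in>UNIV. \<alpha> $ i * (bit_rep (\<sigma> + \<tau>) $ i - (bit_rep \<sigma> $ i + bit_rep \<tau> $ i)))"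
    by (simp add: pairing_def sum.distrib sum_subtractf algebra_simps)
  also have "even \<dots>" using bit_rep_add by (intro dvd_sum) auto
  finally show ?thesis .
qed

section \<open>Characters and signs\<close>

definition chi :: "int ^ 'd \<Rightarrow> bit ^ 'd \<Rightarrow> complex" where
  "chi \<alpha> \<sigma> = (if even (pairing \<alpha> \<sigma>) then 1 else - 1)"

lemma minus_one_powi_pairing: "(- 1) powi pairing \<alpha> \<sigma> = chi \<alpha> \<sigma>"
  by (simp add: chi_def)

lemma chi_add_left: "chi (\<alpha> + \<beta>) \<sigma> = chi \<alpha> \<sigma> * chi \<beta> \<sigma>"
  by (simp add: chi_def pairing_add_left)

lemma chi_add_right: "chi \<alpha> (\<sigma> + \<tau>) = chi \<alpha> \<sigma> * chi \<alpha> \<tau>"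
  using pairing_add_right[of \<alpha> \<sigma> \<tau>] by (auto simp: chi_def)

lemma chi_mult_self [simp]: "chi \<alpha> \<sigma> * chi \<alpha> \<sigma> = 1"
  and chi_zero_right [simp]: "chi \<alpha> 0 = 1"
  and cnj_chi [simp]: "cnj (chi \<alpha> \<sigma>) = chi \<alpha> \<sigma>"
  and norm_chi [simp]: "cmod (chi \<alpha> \<sigma>) = 1"
  by (auto simp: chi_def pairing_def bit_rep_def)

lemma reflect_nth: "reflect \<sigma> x $ i = (if \<sigma> $ i = 1 then - (x $ i) else x $ i)"
  by (cases "\<sigma> $ i") (auto simp: reflect_def)

lemma reflect_add: "reflect (\<sigma> + \<tau>) x = reflect \<sigma> (reflect \<tau> x)"
proof -
  have "reflect (\<sigma> + \<tau>) x $ i = reflect \<sigma> (reflect \<tau> x) $ i" for i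
    by (cases "\<sigma> $ i"; cases "\<tau> $ i") (auto simp: reflect_nth)
  then show ?thesis by (simp add: vec_eq_iff)
qed

lemma reflect_zero [simp]: "reflect 0 x = x"
  by (simp add: vec_eq_iff reflect_nth)

lemma reflect_reflect [simp]: "reflect \<sigma> (reflect \<sigma> x) = x"
  by (simp flip: reflect_add)

lemma reflect_vec_add: "reflect \<sigma> (x + y) = reflect \<sigma> x + reflect \<sigma> y"
  by (simp add: vec_eq_iff reflect_nth)

lemma reflect_vec_diff: "reflect \<sigma> (x - y) = reflect \<sigma> x - reflect \<sigma> y"
  by (simp add: vec_eq_iff reflect_nth)

lemma real_vec_reflect: "real_vec (reflect \<sigma> \<gamma>) = reflect \<sigma> (real_vec \<gamma>)"
  by (simp add: vec_eq_iff reflect_nth)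

lemma reflect_inner: "reflect \<sigma> x \<bullet> y = x \<bullet> reflect \<sigma> (y :: real ^ 'd)"
  by (auto simp: inner_vec_def reflect_nth intro!: sum.cong)

lemma reflect_sign_map: "reflect \<sigma> = sign_map (\<lambda>i. (- 1) ^ of_bit (\<sigma> $ i))"
  by (simp add: fun_eq_iff reflect_def sign_map_def)

lemma norm_reflect [simp]: "norm (reflect \<sigma> x :: real ^ 'd) = norm x"
  by (simp add: norm_eq_sqrt_inner reflect_inner)

lemma reflect_measurable [measurable]: "(reflect \<sigma> :: real ^ 'd \<Rightarrow> _) \<in> borel_measurable borel"
  unfolding reflect_sign_map by measurable

lemma AE_reflect: "AE x in lborel. P x \<Longrightarrow> AE x in lborel. P (reflect \<sigma> x :: real ^ 'd)"
  unfolding reflect_sign_map by (rule AE_sign_map) simp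

lemma integral_reflect:
  fixes f :: "real ^ 'd \<Rightarrow> 'b::{banach, second_countable_topology}"
  assumes "f \<in> borel_measurable borel"
  shows "(LINT x|lborel. f (reflect \<sigma> x)) = (LINT x|lborel. f x)"
  unfolding reflect_sign_map by (rule integral_sign_map) (use assms in simp_all)

lemma L2_reflect: "f \<in> L2 \<Longrightarrow> (\<lambda>x. f (reflect \<sigma> x :: real ^ 'd)) \<in> L2"
  unfolding reflect_sign_map by (rule L2_sign_map) simp_all

text \<open>A reflection changes each entry by an even number. All frequencies of an orbit therefore
  carry the same signs.\<close>

lemma chi_reflect: "chi (reflect \<tau> \<alpha>) \<sigma> = chi \<alpha> \<sigma>"
proof -
  have "pairing \<alpha> \<sigma> - pairing (reflect \<tau> \<alpha>) \<sigma> =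
      (\<Sum>i\<in>UNIV. (\<alpha> $ i - reflect \<tau> \<alpha> $ i) * bit_rep \<sigma> $ i)"
    by (simp add: pairing_def sum_subtractf left_diff_distrib)
  also have "even \<dots>" by (intro dvd_sum) (auto simp: reflect_nth)
  finally show ?thesis by (auto simp: chi_def)
qed

lemma pairing_inner: "real_of_int (pairing \<alpha> \<sigma>) = real_vec \<alpha> \<bullet> real_vec (bit_rep \<sigma>)"
  by (simp add: pairing_def inner_vec_def)

text \<open>Half of a bit vector turns the phase 2 * pi into pi times an integer: translation by
  half the lattice acts on integer frequencies by signs.\<close>

lemma wave_half_bit: "wave (real_vec \<gamma>) ((1/2) *\<^sub>R real_vec (bit_rep \<tau>)) = chi \<gamma> \<tau>"
proof -
  have "wave (real_vec \<gamma>) ((1/2) *\<^sub>R real_vec (bit_rep \<tau>)) = cis (pi * real_of_int (pairing \<gamma> \<tau>))"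
    by (simp add: wave_def pairing_inner)
  also have "\<dots> = chi \<gamma> \<tau>"
  proof (cases "even (pairing \<gamma> \<tau>)")
    case True
    then obtain m where "pairing \<gamma> \<tau> = 2 * m" by (rule evenE)
    then have "cis (pi * real_of_int (pairing \<gamma> \<tau>)) = cis (2 * pi * real_of_int m)"
      by (simp add: mult.commute mult.left_commute)
    then show ?thesis using True by (simp add: chi_def cis_multiple_2pi)
  next
    case False
    then obtain m where "pairing \<gamma> \<tau> = 2 * m + 1" by (rule oddE)
    then have "pi * real_of_int (pairing \<gamma> \<tau>) = 2 * pi * real_of_int m + pi"
      by (simp add: algebra_simps)
    then have "cis (pi * real_of_int (pairing \<gamma> \<tau>)) = cis (2 * pi * real_of_int m) * cis pi"
      by (simp only: cis_mult)
    then show ?thesis using False by (simp add: chi_def cis_multiple_2pi)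
  qed
  finally show ?thesis .
qed

text \<open>This makes the character of a class in the dual group independent of the representative,
  see \<open>chi_coset\<close>.\<close>

lemma twice_dual_even:
  assumes "\<alpha> \<in> twice_dual G" "\<sigma> \<in> G"
  shows "even (pairing \<alpha> \<sigma>)"
proof -
  obtain \<beta> where \<beta>: "\<beta> \<in> dual_lattice (lattice G)" "real_vec \<alpha> = 2 *\<^sub>R \<beta>"
    using assms(1) by (auto simp: twice_dual_def)
  have "real_vec (bit_rep \<sigma>) = real_vec (bit_rep \<sigma>) + 2 *\<^sub>R real_vec 0" by simp
  then have "real_vec (bit_rep \<sigma>) \<in> lattice G"
    using assms(2) unfolding lattice_def by blast
  then obtain n where "\<beta> \<bullet> real_vec (bit_rep \<sigma>) = real_of_int n"
    using \<beta>(1) by (auto simp: dual_lattice_def elim!: Ints_cases)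
  then have "real_of_int (pairing \<alpha> \<sigma>) = real_of_int (2 * n)"
    unfolding pairing_inner \<beta>(2) by simp
  then have "pairing \<alpha> \<sigma> = 2 * n" by (rule of_int_eq_iff[THEN iffD1])
  then show ?thesis by simp
qed

context
  fixes G :: "(bit ^ 'd) set" and k :: nat and s :: "nat \<Rightarrow> bit ^ 'd"
    and I :: "bit ^ 'd \<Rightarrow> (int ^ 'd) set" and \<rho> :: "(int ^ 'd) set \<Rightarrow> int ^ 'd"
  assumes sep: "separable_group G k s" and iso: "is_dual_iso G k s I"
    and rep: "\<forall>c\<in>carrier (dual_group G). \<rho> c \<in> c"
begin

lemma chi_coset:
  assumes "h \<in> G" "\<sigma> \<in> G" "a \<in> I h" "b \<in> I h"
  shows "chi a \<sigma> = chi b \<sigma>"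
proof -
  have "I h \<in> carrier (dual_group G)"
    using iso assms(1) by (auto simp: is_dual_iso_def iso_def hom_def add_grp_def)
  then obtain c where c: "I h = twice_dual G #>\<^bsub>add_grp UNIV\<^esub> c"
    unfolding dual_group_def carrier_FactGroup by auto
  obtain a' b' where ab: "a = a' + c" "a' \<in> twice_dual G" "b = b' + c" "b' \<in> twice_dual G"
    using assms(3,4) unfolding c by (auto simp: r_coset_def add_grp_def)
  then show ?thesis
    using twice_dual_even[OF _ assms(2)] by (auto simp: chi_def pairing_add_left)
qed

lemma rep_I_in: "h \<in> G \<Longrightarrow> \<rho> (I h) \<in> I h"
  using rep iso by (auto simp: is_dual_iso_def iso_def hom_def add_grp_def)

text \<open>Of the generators in the combination, only \<open>s i\<close> has an odd pairing with
  \<open>b\<close>.\<close>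

lemma chi_dual_generator:
  assumes "i \<in> A" "A \<subseteq> {1..k}" "b \<in> I (s i)"
  shows "chi b (combination k s A) = - 1"
proof -
  have gen: "chi b (s j) = (if i = j then - 1 else 1)" if "j \<in> {1..k}" for j
  proof -
    have "pairing b (s j) mod 2 = of_bool (i = j)"
      using iso assms that unfolding is_dual_iso_def by blast
    then show ?thesis by (auto simp: chi_def even_iff_mod_2_eq_zero)
  qed
  have "chi b (\<Sum>j\<in>B. if j \<in> A then s j else 0) = (if i \<in> B then - 1 else 1)" if "B \<subseteq> {1..k}" for B
    using finite_subset[OF that finite_atLeastAtMost] that
    by (induction B rule: finite_induct) (use assms in \<open>auto simp: chi_add_right gen\<close>)
  then show ?thesis using assms by (auto simp: combination_def)
qed

text \<open>Take a generator that occurs in \<open>\<tau>\<close>. Adding it to \<open>h\<close>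
  multiplies the character of \<open>I h\<close> by that of \<open>I (s i)\<close>, which is -1 at
  \<open>\<tau>\<close>; disjointness of the supports puts the block of this generator inside the
  support of \<open>\<tau>\<close>.\<close>

lemma sign_flip:
  assumes \<tau>: "\<tau> \<in> G" "\<tau> \<noteq> 0"
  obtains i where "i \<in> {1..k}" "\<And>j. j \<in> supp (s i) \<Longrightarrow> \<tau> $ j = 1"
    "\<And>h. h \<in> G \<Longrightarrow> chi (\<rho> (I (h + s i))) \<tau> = - chi (\<rho> (I h)) \<tau>"
proof -
  obtain A where A: "A \<subseteq> {1..k}" "\<tau> = combination k s A"
    using \<tau> separable_group_eq[OF sep] by auto
  have "A \<noteq> {}" using \<tau> A by (auto simp: combination_def)
  then obtain i where i: "i \<in> A" by auto
  with A have ik: "i \<in> {1..k}" by auto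
  show ?thesis
  proof (rule that[OF ik])
    show "\<tau> $ j = 1" if "j \<in> supp (s i)" for j
      using combination_nth[OF sep ik that A(1)] i A by simp
    fix h assume h: "h \<in> G"
    have si: "s i \<in> G" using separable_group_closed(3)[OF sep ik] .
    have hs: "h + s i \<in> G" using separable_group_closed(2)[OF sep h si] .
    have "I (h + s i) = I h <#>\<^bsub>add_grp UNIV\<^esub> I (s i)"
      using iso h si by (auto simp: is_dual_iso_def iso_def hom_def add_grp_def dual_group_def FactGroup_def)
    \<comment> \<open>The representative of a sum need not be the sum of the chosen representatives.
      It is split inside the two cosets, and \<open>chi_coset\<close> compares \<open>a\<close> with
      the chosen representative of \<open>I h\<close>.\<close>
    then obtain a b where ab: "a \<in> I h" "b \<in> I (s i)" "\<rho> (I (h + s i)) = a + b"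
      using rep_I_in[OF hs] by (auto simp: set_mult_def add_grp_def)
    have "chi (\<rho> (I (h + s i))) \<tau> = chi a \<tau> * chi b \<tau>" by (simp add: ab chi_add_left)
    also have "chi b \<tau> = - 1" using chi_dual_generator[OF i A(1) ab(2)] A(2) by simp
    also have "chi a \<tau> = chi (\<rho> (I h)) \<tau>" by (rule chi_coset[OF h \<tau>(1) ab(1) rep_I_in[OF h]])
    finally show "chi (\<rho> (I (h + s i))) \<tau> = - chi (\<rho> (I h)) \<tau>" by simp
  qed
qed

lemma bij_shift: "\<tau> \<in> G \<Longrightarrow> bij_betw (\<lambda>\<sigma>. \<tau> + \<sigma>) G G"
  using separable_group_closed(2)[OF sep]
  by (intro bij_betw_byWitness[where f' = "\<lambda>\<sigma>. \<tau> + \<sigma>"]) auto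

lemma sum_shift: "\<tau> \<in> G \<Longrightarrow> (\<Sum>\<sigma>\<in>G. f (\<tau> + \<sigma>)) = (\<Sum>\<sigma>\<in>G. f \<sigma>)"
  using sum.reindex_bij_betw[OF bij_shift] .

definition stabilizer :: "int ^ 'd \<Rightarrow> (bit ^ 'd) set" where
  "stabilizer \<gamma> = {\<sigma> \<in> G. reflect \<sigma> \<gamma> = \<gamma>}"

lemma card_orbit_stabilizer: "card (orbit G \<gamma>) * card (stabilizer \<gamma>) = 2 ^ k"
proof -
  have fin: "finite G" using card_separable_group[OF sep] by auto
  have orb: "orbit G \<gamma> = (\<lambda>\<sigma>. reflect \<sigma> \<gamma>) ` G" by (auto simp: orbit_def)
  have "card G = (\<Sum>x\<in>orbit G \<gamma>. card {\<sigma> \<in> G. reflect \<sigma> \<gamma> = x})"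
    unfolding orb using fin by (subst sum.image_gen[OF fin, of "\<lambda>_. 1::nat", simplified]) auto
  also have "\<dots> = (\<Sum>x\<in>orbit G \<gamma>. card (stabilizer \<gamma>))"
  proof (intro sum.cong refl)
    fix x assume "x \<in> orbit G \<gamma>"
    then obtain \<tau> where \<tau>: "\<tau> \<in> G" "x = reflect \<tau> \<gamma>" by (auto simp: orbit_def)
    have "bij_betw (\<lambda>\<sigma>. \<tau> + \<sigma>) {\<sigma> \<in> G. reflect \<sigma> \<gamma> = x} (stabilizer \<gamma>)"
      using separable_group_closed(2)[OF sep] \<tau>
      by (intro bij_betw_byWitness[where f' = "\<lambda>\<sigma>. \<tau> + \<sigma>"]) (auto simp: stabilizer_def reflect_add)
    then show "card {\<sigma> \<in> G. reflect \<sigma> \<gamma> = x} = card (stabilizer \<gamma>)" by (rule bij_betw_same_card)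
  qed
  finally show ?thesis using card_separable_group[OF sep] by simp
qed

text \<open>If the character is -1 at some element of the stabilizer, translating the summation
  index by that element reverses the sign of the sum.\<close>

lemma sum_chi_stabilizer:
  "(\<Sum>\<sigma>\<in>stabilizer \<gamma>. chi \<alpha> \<sigma>) = 0 \<or> (\<Sum>\<sigma>\<in>stabilizer \<gamma>. chi \<alpha> \<sigma>) = of_nat (card (stabilizer \<gamma>))"
proof (cases "\<forall>\<sigma>\<in>stabilizer \<gamma>. chi \<alpha> \<sigma> = 1")
  case False
  then obtain \<tau> where \<tau>: "\<tau> \<in> stabilizer \<gamma>" "chi \<alpha> \<tau> = - 1" by (auto simp: chi_def split: if_splits)
  have "bij_betw (\<lambda>\<sigma>. \<tau> + \<sigma>) (stabilizer \<gamma>) (stabilizer \<gamma>)"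
    using separable_group_closed(2)[OF sep] \<tau>(1)
    by (intro bij_betw_byWitness[where f' = "\<lambda>\<sigma>. \<tau> + \<sigma>"]) (auto simp: stabilizer_def reflect_add)
  from sum.reindex_bij_betw[OF this, of "chi \<alpha>"]
  have "(\<Sum>\<sigma>\<in>stabilizer \<gamma>. chi \<alpha> \<sigma>) = (\<Sum>\<sigma>\<in>stabilizer \<gamma>. chi \<alpha> \<tau> * chi \<alpha> \<sigma>)"
    by (simp add: chi_add_right)
  then have "(\<Sum>\<sigma>\<in>stabilizer \<gamma>. chi \<alpha> \<sigma>) = - (\<Sum>\<sigma>\<in>stabilizer \<gamma>. chi \<alpha> \<sigma>)"
    by (simp add: \<tau>(2) sum_negf)
  then show ?thesis by simp
qed simp

end

lemma orbit_reflect: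
  assumes "separable_group G k s" "\<sigma> \<in> G"
  shows "orbit G (reflect \<sigma> x) = orbit G x"
proof -
  have "reflect \<tau> (reflect \<sigma> x) = reflect (\<tau> + \<sigma>) x" for \<tau> by (simp add: reflect_add)
  moreover have "reflect \<tau> x = reflect (\<tau> + \<sigma>) (reflect \<sigma> x)" for \<tau>
    by (simp flip: reflect_add add: add.assoc)
  ultimately show ?thesis
    using separable_group_closed(2)[OF assms(1) _ assms(2)] unfolding orbit_def by blast
qed

lemma orbit_transversal:
  fixes N :: "(int ^ 'd) set"
  assumes sep: "separable_group G k s" and N: "\<forall>x :: int ^ 'd. card (N \<inter> orbit G x) = 1"
  shows "bij_betw snd (Sigma N (orbit G)) UNIV"
proof -
  have self: "x \<in> orbit G x" for x :: "int ^ 'd"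
    using separable_group_closed(1)[OF sep] unfolding orbit_def by force
  have sym: "orbit G x = orbit G y" if "y \<in> orbit G x" for x y :: "int ^ 'd"
    using that orbit_reflect[OF sep] unfolding orbit_def by force
  show ?thesis
  proof (rule bij_betw_imageI)
    show "inj_on snd (Sigma N (orbit G))"
    proof (rule inj_onI)
      fix p q assume p: "p \<in> Sigma N (orbit G)" and q: "q \<in> Sigma N (orbit G)" and eq: "snd p = snd q"
      have "orbit G (fst p) = orbit G (snd p)" "orbit G (fst q) = orbit G (snd p)"
        using p q eq by (auto intro!: sym)
      then have "fst p \<in> N \<inter> orbit G (snd p)" "fst q \<in> N \<inter> orbit G (snd p)"
        using p q self[of "fst p"] self[of "fst q"] by auto
      then have "fst p = fst q"
        using N by (metis card_1_singletonE singletonD)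
      with eq show "p = q" by (simp add: prod_eq_iff)
    qed
    have "x \<in> snd ` Sigma N (orbit G)" for x
    proof -
      obtain y where y: "y \<in> N" "y \<in> orbit G x"
        using N[rule_format, of x] by (metis IntE card_1_singletonE singletonI)
      then have "x \<in> orbit G y" using sym[OF y(2)] self[of x] by simp
      with y show ?thesis by force
    qed
    then show "snd ` Sigma N (orbit G) = UNIV" by auto
  qed
qed

section \<open>Hermitian separable windows\<close>

definition mix :: "'d set \<Rightarrow> real ^ 'd \<Rightarrow> real ^ 'd \<Rightarrow> real ^ 'd" where
  "mix S x z = (\<chi> j. if j \<in> S then x $ j else z $ j)"

lemma mix_nth: "mix S x z $ j = (if j \<in> S then x $ j else z $ j)"
  by (simp add: mix_def)

text \<open>The linear involution \<open>T\<close> of pairs exchanges the coordinates outside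
  \<open>S\<close>. It maps the null cylinder over the exceptional set to a null set, which Fubini's
  theorem then slices.\<close>

lemma AE_mix:
  assumes "AE y in lborel. P (y :: real ^ 'd)"
  shows "AE x in lborel. AE z in lborel. P (mix S x z)"
proof -
  obtain X where X: "{y. \<not> P y} \<subseteq> X" "X \<in> null_sets lborel"
    using assms unfolding eventually_ae_filter by auto
  define T where "T p = (mix S (fst p) (snd p), mix S (snd p) (fst p))" for p :: "(real ^ 'd) \<times> (real ^ 'd)"
  have TT: "T (T p) = p" for p
    by (simp add: T_def prod_eq_iff vec_eq_iff mix_nth)
  have "linear T"
    by (rule linearI) (auto simp: T_def vec_eq_iff mix_nth)
  then have dT: "T differentiable_on A" and cT: "continuous_on A T" for A
    by (auto intro: linear_imp_differentiable_on linear_continuous_on linear_conv_bounded_linear[THEN iffD1])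
  have Tm: "T \<in> borel_measurable borel" by (rule borel_measurable_continuous_onI[OF cT])
  have "X \<times> UNIV \<in> null_sets (lborel \<Otimes>\<^sub>M lborel)"
    using X(2) by (intro lborel.times_in_null_sets1) auto
  then have n: "X \<times> UNIV \<in> null_sets (lborel :: ((real ^ 'd) \<times> (real ^ 'd)) measure)"
    by (simp only: lborel_prod)
  then have "negligible (X \<times> (UNIV :: (real ^ 'd) set))"
    unfolding negligible_iff_null_sets by (rule null_sets_completionI)
  then have "negligible (T ` (X \<times> UNIV))"
    by (rule negligible_differentiable_image_negligible[OF order_refl _ dT])
  moreover have im: "T ` (X \<times> UNIV) = T -` (X \<times> UNIV)"
  proof (rule subset_antisym; rule subsetI)
    show "x \<in> T -` (X \<times> UNIV)" if "x \<in> T ` (X \<times> UNIV)" for x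
      using that TT by (metis imageE vimageI2)
    show "x \<in> T ` (X \<times> UNIV)" if "x \<in> T -` (X \<times> UNIV)" for x
      using that TT by (metis image_eqI vimageD)
  qed
  moreover have "T -` (X \<times> UNIV) \<in> sets lborel"
    using measurable_sets[OF Tm, of "X \<times> UNIV"] n by (auto simp: null_sets_def)
  ultimately have "T -` (X \<times> UNIV) \<in> null_sets lborel"
    by (simp add: negligible_iff_null_sets null_sets_completion_iff)
  then have "AE p in lborel. p \<notin> T -` (X \<times> UNIV)" by (rule AE_not_in)
  then have "AE p in lborel. P (mix S (fst p) (snd p))"
    by eventually_elim (use X(1) in \<open>auto simp: T_def\<close>)
  then have "AE p in lborel \<Otimes>\<^sub>M lborel. P (mix S (fst p) (snd p))"
    by (simp only: lborel_prod)
  from lborel_pair.AE_pair[OF this] show ?thesis by simp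
qed

lemma AE_mix':
  assumes "AE y in lborel. P (y :: real ^ 'd)"
  shows "AE z in lborel. AE x in lborel. P (mix S x z)"
proof -
  have "mix (- S) z x = mix S x z" for x z by (simp add: vec_eq_iff mix_nth)
  then show ?thesis using AE_mix[OF assms, of "- S"] by simp
qed

text \<open>
  Hermitian symmetry passes to each tensor factor up to a constant: freeze the other variables at a
  point \<open>z\<close> where the remaining factor does not vanish.
\<close>

lemma tensor_hermitian:
  fixes g p q :: "real ^ 'd \<Rightarrow> complex"
  assumes g: "\<And>x. g x = p x * q x"
    and p: "\<And>x y. (\<And>j. j \<in> S \<Longrightarrow> x $ j = y $ j) \<Longrightarrow> p x = p y"
    and q: "\<And>x y. (\<And>j. j \<notin> S \<Longrightarrow> x $ j = y $ j) \<Longrightarrow> q x = q y"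
    and herm: "AE x in lborel. g (- x) = cnj (g x)"
    and nz: "\<not> (AE x in lborel. g x = 0)"
  obtains c where "AE x in lborel. p (- x) = c * cnj (p x)"
proof -
  have pm: "p (mix S x z) = p x" "p (- mix S x z) = p (- x)" for x z
    by (rule p, simp add: mix_nth)+
  have qm: "q (mix S x z) = q z" "q (- mix S x z) = q (- z)" for x z
    by (rule q, simp add: mix_nth)+
  have "AE z in lborel. AE x in lborel. p (- x) * q (- z) = cnj (p x) * cnj (q z)"
    using AE_mix'[OF herm, of S] by (simp add: g pm qm)
  moreover have "\<not> (AE z in lborel. q z = 0)"
  proof
    assume "AE z in lborel. q z = 0"
    then have "AE x in lborel. g x = 0" by eventually_elim (simp add: g)
    with nz show False by simp
  qed
  ultimately obtain z where z: "AE x in lborel. p (- x) * q (- z) = cnj (p x) * cnj (q z)" "q z \<noteq> 0"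
    by (metis (mono_tags, lifting) eventually_mono)
  have "q (- z) \<noteq> 0"
  proof
    assume "q (- z) = 0"
    with z have "AE x in lborel. g x = 0"
      by (auto simp: g elim!: eventually_mono)
    with nz show False by simp
  qed
  with z(1) have "AE x in lborel. p (- x) = (cnj (q z) / q (- z)) * cnj (p x)"
    by (auto simp: field_simps elim!: eventually_mono)
  then show ?thesis by (rule that)
qed

definition restr :: "'d set \<Rightarrow> real ^ 'd \<Rightarrow> real ^ 'd" where
  "restr S w = (\<chi> j. if j \<in> S then w $ j else 0)"

lemma restr_nth: "restr S w $ j = (if j \<in> S then w $ j else 0)"
  by (simp add: restr_def)

text \<open>Split g as p * q with p living on the block. There the reflection is negation, so
  Hermitian symmetry turns its second occurrence into a conjugate, and the product of the two values
  of p becomes symmetric in x and x + w. The factor q does not see the exchange of block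
  coordinates.\<close>

lemma block_swap:
  fixes g :: "real ^ 'd \<Rightarrow> complex"
  assumes sep: "separable_group G k s" and i: "i \<in> {1..k}"
    and \<tau>: "\<And>j. j \<in> supp (s i) \<Longrightarrow> \<tau> $ j = 1"
    and gsep: "\<exists>g'. separable_fun k s g' \<and> (AE x in lborel. g x = g' x)"
    and herm: "AE x in lborel. g (- x) = cnj (g x)"
  shows "AE x in lborel. cnj (g x) * g (reflect \<tau> (x + w)) =
    cnj (g (x + restr (supp (s i)) w)) * g (reflect \<tau> (x + w - restr (supp (s i)) w))"
proof -
  define S where "S = supp (s i)"
  define wS where "wS = restr S w"
  obtain g' where g': "separable_fun k s g'" and gg: "AE x in lborel. g x = g' x"
    using gsep by blast
  have tr: "AE x in lborel. g (reflect \<tau> (x + v)) = g' (reflect \<tau> (x + v))" for v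
    using AE_translate[OF AE_reflect[OF gg, of \<tau>], of v] by simp
  have all: "AE x in lborel. g x = g' x \<and> g (reflect \<tau> (x + w)) = g' (reflect \<tau> (x + w)) \<and>
      g (x + wS) = g' (x + wS) \<and> g (reflect \<tau> (x + (w - wS))) = g' (reflect \<tau> (x + (w - wS)))"
    using gg tr[of w] AE_translate[OF gg, of wS] tr[of "w - wS"] by eventually_elim simp
  have "AE x in lborel. cnj (g' x) * g' (reflect \<tau> (x + w)) =
      cnj (g' (x + wS)) * g' (reflect \<tau> (x + (w - wS)))"
  \<comment> \<open>The Hermitian constant of the factor p is obtained by freezing the other
    variables, which needs a window that is not zero almost everywhere.\<close>
  proof (cases "AE x in lborel. g' x = 0")
    case True
    from True AE_translate[OF True, of wS] show ?thesis by eventually_elim simp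
  next
    case False
    obtain gs where gs: "\<And>x. g' x = (\<Prod>l\<in>{0..k}. gs l (proj (block k s l) x))"
      using g' unfolding separable_fun_def by blast
    define p where "p x = gs i (proj (block k s i) x)" for x
    define q where "q x = (\<Prod>l\<in>{0..k} - {i}. gs l (proj (block k s l) x))" for x
    have pq: "g' x = p x * q x" for x
      using i by (simp add: gs p_def q_def prod.remove[of _ i])
    have bS: "block k s i = S" using i by (simp add: block_def S_def)
    have disj: "block k s l \<inter> S = {}" if "l \<in> {0..k} - {i}" for l
    proof (cases "l = 0")
      case True
      then show ?thesis using i by (auto simp: block_def S_def)
    next
      case False
      then have "supp (s l) \<inter> supp (s i) = {}"
        using sep that i unfolding separable_group_def by auto
      then show ?thesis using False by (simp add: block_def S_def)
    qed
    have p: "p x = p y" if "\<And>j. j \<in> S \<Longrightarrow> x $ j = y $ j" for x y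
    proof -
      have "proj S x = proj S y" using that by (auto simp: proj_def restrict_def)
      then show ?thesis by (simp add: p_def bS)
    qed
    have q: "q x = q y" if "\<And>j. j \<notin> S \<Longrightarrow> x $ j = y $ j" for x y
    proof -
      have "proj (block k s l) x = proj (block k s l) y" if "l \<in> {0..k} - {i}" for l
        using disj[OF that] \<open>\<And>j. j \<notin> S \<Longrightarrow> x $ j = y $ j\<close>
        by (auto simp: proj_def restrict_def fun_eq_iff disjoint_iff)
      then show ?thesis by (simp add: q_def)
    qed
    have herm': "AE x in lborel. g' (- x) = cnj (g' x)"
      using herm gg AE_uminus_vec[OF gg] by eventually_elim simp
    obtain c where c: "AE x in lborel. p (- x) = c * cnj (p x)"
      by (rule tensor_hermitian[OF pq p q herm' False])
    have "AE x in lborel. p (- x) = c * cnj (p x) \<and> p (- (x + w)) = c * cnj (p (x + w))"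
      using c AE_translate[OF c, of w] by eventually_elim simp
    then show ?thesis
    proof eventually_elim
      case (elim x)
      have 1: "p (reflect \<tau> (x + w)) = p (- (x + w))"
        by (rule p) (use \<tau> in \<open>auto simp: reflect_nth S_def\<close>)
      have 2: "p (x + wS) = p (x + w)" by (rule p) (simp add: wS_def restr_nth)
      have 3: "q (x + wS) = q x" by (rule q) (simp add: wS_def restr_nth)
      have 4: "p (reflect \<tau> (x + (w - wS))) = p (- x)"
        by (rule p) (use \<tau> in \<open>auto simp: reflect_nth S_def wS_def restr_nth\<close>)
      have 5: "q (reflect \<tau> (x + (w - wS))) = q (reflect \<tau> (x + w))"
        by (rule q) (auto simp: reflect_nth wS_def restr_nth)
      \<comment> \<open>Both sides contain c * cnj (p x) * cnj (p (x + w)), so the value of the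
        constant c never has to be known.\<close>
      show ?case unfolding pq 1 2 3 4 5 using elim by simp
    qed
  qed
  then show ?thesis using all
    by eventually_elim (simp add: wS_def S_def add_diff_eq)
qed

section \<open>Cancellation of the cross terms\<close>

text \<open>The points of half the lattice, in coordinates that are unique because
  \<open>bit_rep\<close> has entries 0 and 1.\<close>

definition half_shift :: "int ^ 'd \<Rightarrow> bit ^ 'd \<Rightarrow> real ^ 'd" where
  "half_shift l h = real_vec l + (1/2) *\<^sub>R real_vec (bit_rep h)"

lemma half_shift_nth: "half_shift l h $ j = real_of_int (l $ j) + (if h $ j = 1 then 1/2 else 0)"
  by (cases "h $ j") (auto simp: half_shift_def bit_rep_def)

lemma half_shift_eq_iff: "half_shift l h = half_shift l' h' \<longleftrightarrow> l = l' \<and> h = h'"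
proof
  assume eq: "half_shift l h = half_shift l' h'"
  have "l $ j = l' $ j \<and> h $ j = h' $ j" for j
  proof -
    have "half_shift l h $ j = half_shift l' h' $ j" by (simp add: eq)
    then have "real_of_int (2 * (l $ j) + (if h $ j = 1 then 1 else 0)) =
        real_of_int (2 * (l' $ j) + (if h' $ j = 1 then 1 else 0))"
      by (auto simp: half_shift_nth split: if_splits)
    then have "2 * (l $ j) + (if h $ j = 1 then 1 else 0) = 2 * (l' $ j) + (if h' $ j = 1 then 1 else 0)"
      by (simp only: of_int_eq_iff)
    then show ?thesis
      by (cases "h $ j"; cases "h' $ j") (auto, presburger+)
  qed
  then show "l = l' \<and> h = h'" by (simp add: vec_eq_iff)
qed simp

text \<open>
  The involution on the index set that exchanges the two arguments of \<open>g\<close> on the block \<open>supp \<sigma>\<close>.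
\<close>

definition swap_index ::
    "bit ^ 'd \<Rightarrow> (int ^ 'd) \<times> (bit ^ 'd) \<times> (int ^ 'd) \<Rightarrow> (int ^ 'd) \<times> (bit ^ 'd) \<times> (int ^ 'd)" where
  "swap_index \<sigma> = (\<lambda>(l, h, n).
     ((\<chi> j. if \<sigma> $ j = 1 then l $ j - n $ j - 1 + (if h $ j = 1 then 1 else 0) else l $ j),
      h + \<sigma>,
      (\<chi> j. if \<sigma> $ j = 1 then - n $ j - 1 else n $ j)))"

lemma swap_index_swap_index: "swap_index \<sigma> (swap_index \<sigma> x) = x"
proof -
  have "\<sigma> $ j = 0 \<or> \<sigma> $ j = 1" for j by (cases "\<sigma> $ j") auto
  then show ?thesis
    by (cases x) (auto simp: swap_index_def vec_eq_iff add.assoc)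
qed

text \<open>This explains the offsets in \<open>swap_index\<close>. On the block
  \<open>\<tau>\<close> is 1, so the negative of n + 1/2 is (- n - 1) + 1/2. Subtracting n + 1/2
  from the translation flips the bit h and borrows 1 from the integer part, unless h was 1.\<close>

lemma swap_index_shift:
  assumes "swap_index \<sigma> (l, h, n) = (l', h', n')" "\<And>j. \<sigma> $ j = 1 \<Longrightarrow> \<tau> $ j = 1"
  shows "half_shift l' h' = half_shift l h - restr (supp \<sigma>) (half_shift n \<tau>)"
    "half_shift n' \<tau> = half_shift n \<tau> - 2 *\<^sub>R restr (supp \<sigma>) (half_shift n \<tau>)"
proof -
  have b: "\<sigma> $ j = 0 \<or> \<sigma> $ j = 1" for j by (cases "\<sigma> $ j") auto
  have l': "l' $ j = (if \<sigma> $ j = 1 then l $ j - n $ j - 1 + (if h $ j = 1 then 1 else 0) else l $ j)"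
    and h': "h' $ j = h $ j + \<sigma> $ j"
    and n': "n' $ j = (if \<sigma> $ j = 1 then - n $ j - 1 else n $ j)" for j
    using assms(1) by (auto simp: swap_index_def)
  show "half_shift l' h' = half_shift l h - restr (supp \<sigma>) (half_shift n \<tau>)"
  proof (rule vec_eq_iff[THEN iffD2, rule_format])
    fix j show "half_shift l' h' $ j = (half_shift l h - restr (supp \<sigma>) (half_shift n \<tau>)) $ j"
      using b[of j] assms(2)[of j]
      by (auto simp: half_shift_nth restr_nth supp_def l' h')
  qed
  show "half_shift n' \<tau> = half_shift n \<tau> - 2 *\<^sub>R restr (supp \<sigma>) (half_shift n \<tau>)"
  proof (rule vec_eq_iff[THEN iffD2, rule_format])
    fix j show "half_shift n' \<tau> $ j = (half_shift n \<tau> - 2 *\<^sub>R restr (supp \<sigma>) (half_shift n \<tau>)) $ j"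
      using b[of j] assms(2)[of j]
      by (auto simp: half_shift_nth restr_nth supp_def n')
  qed
qed

section \<open>Uniform counts of translates\<close>

lemma count_translates:
  "\<exists>c. \<forall>z :: real ^ 'd. finite {n. norm (z + real_vec n) \<le> M} \<and> card {n. norm (z + real_vec n) \<le> M} \<le> c"
proof -
  define A where "A = {m :: int ^ 'd. \<forall>i. \<bar>m $ i\<bar> \<le> \<lceil>M\<rceil> + 1}"
  have A: "finite A" unfolding A_def by (rule finite_int_box)
  have sub: "{n. norm (z + real_vec n) \<le> M} \<subseteq> (\<lambda>a. a - cell z) ` A" for z :: "real ^ 'd"
  proof
    fix n assume "n \<in> {n. norm (z + real_vec n) \<le> M}"
    then have "cell z + n \<in> A"
      using cell_bounded[of "z + real_vec n" M] by (simp add: A_def cell_add_int)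
    then show "n \<in> (\<lambda>a. a - cell z) ` A" by (intro image_eqI[of _ _ "cell z + n"]) auto
  qed
  have "finite {n. norm (z + real_vec n) \<le> M} \<and> card {n. norm (z + real_vec n) \<le> M} \<le> card A" for z :: "real ^ 'd"
    using finite_subset[OF sub finite_imageI[OF A]] card_mono[OF finite_imageI[OF A] sub]
      card_image_le[OF A, of "\<lambda>a. a - cell z"] by (meson order_trans)
  then show ?thesis by blast
qed

instance bit :: finite
proof
  have "(UNIV :: bit set) = {0, 1}" by auto
  then show "finite (UNIV :: bit set)" by (metis finite.emptyI finite.insertI)
qed

text \<open>The centre of the second ball may depend on (l, h) through \<open>r\<close>: for each of
  the boundedly many admissible (l, h), the count of n is bounded uniformly in the centre.\<close>

lemma count_pairs:
  "\<exists>c. \<forall>z :: real ^ 'd. \<forall>X r. finite X \<longrightarrow>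
    card {(l, h, n) \<in> X. norm (z + half_shift l h) \<le> M \<and> norm (r l h + real_vec n :: real ^ 'd) \<le> M} \<le> c"
proof -
  obtain c where c: "\<And>z :: real ^ 'd. finite {n. norm (z + real_vec n) \<le> M}"
      "\<And>z :: real ^ 'd. card {n. norm (z + real_vec n) \<le> M} \<le> c"
    using count_translates[of M] by blast
  have "card {(l, h, n) \<in> X. norm (z + half_shift l h) \<le> M \<and> norm (r l h + real_vec n) \<le> M} \<le>
      CARD(bit ^ 'd) * (c * c)" if "finite X" for z :: "real ^ 'd" and X and r :: "int ^ 'd \<Rightarrow> bit ^ 'd \<Rightarrow> real ^ 'd"
  proof -
    define L where "L h = {l. norm (z + half_shift l h) \<le> M}" for h
    have L: "finite (L h)" "card (L h) \<le> c" for h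
      using c(1)[of "z + (1/2) *\<^sub>R real_vec (bit_rep h)"] c(2)[of "z + (1/2) *\<^sub>R real_vec (bit_rep h)"]
      by (simp_all add: L_def half_shift_def add_ac)
    define Q where "Q = Sigma UNIV (\<lambda>h. Sigma (L h) (\<lambda>l. {n. norm (r l h + real_vec n) \<le> M}))"
    have finQ: "finite Q" unfolding Q_def by (intro finite_SigmaI L c) auto
    have "card Q = (\<Sum>h\<in>UNIV. \<Sum>l\<in>L h. card {n. norm (r l h + real_vec n) \<le> M})"
    proof -
      have "card (Sigma (L h) (\<lambda>l. {n. norm (r l h + real_vec n) \<le> M})) =
          (\<Sum>l\<in>L h. card {n. norm (r l h + real_vec n) \<le> M})" for h
        by (rule card_SigmaI) (auto intro: L c)
      then show ?thesis
        unfolding Q_def by (subst card_SigmaI) (auto intro!: finite_SigmaI L c)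
    qed
    also have "\<dots> \<le> (\<Sum>h\<in>(UNIV :: (bit ^ 'd) set). c * c)"
    proof (rule sum_mono)
      fix h
      have "(\<Sum>l\<in>L h. card {n. norm (r l h + real_vec n) \<le> M}) \<le> (\<Sum>l\<in>L h. c)"
        by (intro sum_mono c)
      also have "\<dots> \<le> c * c" using L(2) by simp
      finally show "(\<Sum>l\<in>L h. card {n. norm (r l h + real_vec n) \<le> M}) \<le> c * c" .
    qed
    also have "\<dots> = CARD(bit ^ 'd) * (c * c)" by simp
    finally have cQ: "card Q \<le> CARD(bit ^ 'd) * (c * c)" .
    have "{(l, h, n) \<in> X. norm (z + half_shift l h) \<le> M \<and> norm (r l h + real_vec n) \<le> M} \<subseteq>
        (\<lambda>(h, l, n). (l, h, n)) ` Q"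
      by (force simp: Q_def L_def)
    then have "card {(l, h, n) \<in> X. norm (z + half_shift l h) \<le> M \<and> norm (r l h + real_vec n) \<le> M} \<le> card Q"
      using finQ by (meson card_image_le card_mono finite_imageI order_trans)
    with cQ show ?thesis by linarith
  qed
  then show ?thesis by blast
qed

section \<open>Gabor coefficients and cross terms\<close>

lemma gabor_eq: "gabor g (l, \<gamma>) x = wave (real_vec \<gamma>) (x - l) * g (x - l)"
  by (simp add: gabor_def translate_def modulate_def wave_def cis_conv_exp inner_commute mult.commute[of _ \<i>])

lemma gabor_L2 [simp, intro]:
  assumes "g \<in> L2"
  shows "gabor g j \<in> L2"
proof -
  obtain l \<gamma> where j: "j = (l, \<gamma>)" by (cases j)
  have "(\<lambda>x. wave (real_vec \<gamma>) x * g x) \<in> L2"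
    by (rule L2_bounded_mult[OF assms, where C = 1]) auto
  from L2_translate[OF this, of "- l"] show ?thesis
    unfolding j gabor_eq[abs_def] by simp
qed

text \<open>Its Fourier coefficients at integer frequencies are the Gabor coefficients of
  \<open>f\<close> at translation \<open>l\<close>, see \<open>gabor_coef\<close>.\<close>

definition window_product :: "(real ^ 'd \<Rightarrow> complex) \<Rightarrow> (real ^ 'd \<Rightarrow> complex) \<Rightarrow> real ^ 'd \<Rightarrow> real ^ 'd \<Rightarrow> complex" where
  "window_product f g l x = f (x + l) * cnj (g x)"

lemma gabor_coef:
  assumes "f \<in> L2" "g \<in> L2"
  shows "l2_inner f (gabor g (l, \<gamma>)) = fcoef (window_product f g l) \<gamma>"
proof -
  have [measurable]: "f \<in> borel_measurable borel" "g \<in> borel_measurable borel"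
    by (rule L2_measurable[OF assms(1)] L2_measurable[OF assms(2)])+
  have "l2_inner f (gabor g (l, \<gamma>)) = (LINT x|lborel. f (x + l) * cnj (gabor g (l, \<gamma>) (x + l)))"
    unfolding l2_inner_def
    by (rule integral_translate[symmetric]) (rule L2_mult_cnj_measurable[OF assms(1) gabor_L2[OF assms(2)]])
  then show ?thesis
    by (simp add: fcoef_def window_product_def gabor_eq mult_ac)
qed

lemma window_product_test:
  assumes f: "test_fun f" and g: "g \<in> L2"
  shows "window_product f g l \<in> L2"
proof -
  obtain C where C: "\<And>x. cmod (f x) \<le> C" using f by (auto simp: test_fun_def)
  have fm: "f \<in> borel_measurable borel" using f by (simp add: test_fun_def)
  show ?thesis
    unfolding window_product_def[abs_def]
    by (rule L2_bounded_mult[OF L2_cnj[OF g], of _ C]) (use C measurable_translate[OF fm] in auto)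
qed

definition cross_term ::
    "(real ^ 'd \<Rightarrow> complex) \<Rightarrow> (real ^ 'd \<Rightarrow> complex) \<Rightarrow> bit ^ 'd
       \<Rightarrow> (int ^ 'd) \<times> (bit ^ 'd) \<times> (int ^ 'd) \<Rightarrow> complex" where
  "cross_term f g \<tau> = (\<lambda>(l, h, n). LINT x|lborel.
     window_product f g (half_shift l h) x *
     cnj (window_product f g (half_shift l h) (reflect \<tau> (x + half_shift n \<tau>))))"

text \<open>Reflecting the argument of \<open>u\<close> reflects the frequency of its coefficients,
  and translating by half of \<open>\<tau>\<close> multiplies them by the sign
  \<open>chi \<gamma> \<tau>\<close>. With both done to the second factor, Parseval's formula has
  exactly the shifts \<open>half_shift n \<tau>\<close> on its other side.\<close>

lemma gabor_cross_sum:
  assumes f: "test_fun f" and g: "g \<in> L2"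
  shows "\<exists>S. ((\<lambda>\<gamma>. chi \<gamma> \<tau> * (l2_inner f (gabor g (half_shift l h, \<gamma>)) *
        cnj (l2_inner f (gabor g (half_shift l h, reflect \<tau> \<gamma>))))) has_sum S) UNIV \<and>
    ((\<lambda>n. cross_term f g \<tau> (l, h, n)) has_sum S) UNIV"
proof -
  define u where "u = window_product f g (half_shift l h)"
  define t where "t = (1/2) *\<^sub>R real_vec (bit_rep \<tau>)"
  define v where "v x = u (reflect \<tau> (x + t))" for x
  obtain M where M: "\<And>x. f x \<noteq> 0 \<Longrightarrow> norm x \<le> M" using f by (auto simp: test_fun_def)
  have uL2: "u \<in> L2" unfolding u_def by (rule window_product_test[OF f g])
  have urL2: "(\<lambda>x. u (reflect \<tau> x)) \<in> L2" by (rule L2_reflect[OF uL2])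
  have vL2: "v \<in> L2" unfolding v_def[abs_def] by (rule L2_translate[OF urL2])
  have us: "norm x \<le> M + norm (half_shift l h)" if "u x \<noteq> 0" for x
  proof -
    have "norm (x + half_shift l h) \<le> M" using that M by (simp add: u_def window_product_def)
    then show ?thesis using norm_triangle_ineq4[of "x + half_shift l h" "half_shift l h"] by simp
  qed
  have vs: "norm x \<le> M + norm (half_shift l h) + norm t" if "v x \<noteq> 0" for x
    using us[of "reflect \<tau> (x + t)"] norm_triangle_ineq4[of "x + t" t] that by (simp add: v_def)
  have us': "norm x \<le> M + norm (half_shift l h) + norm t" if "u x \<noteq> 0" for x
    using us[OF that] norm_ge_zero[of t] by linarith
  obtain S where S: "((\<lambda>\<gamma>. fcoef u \<gamma> * cnj (fcoef v \<gamma>)) has_sum S) UNIV"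
    "((\<lambda>k. LINT x|lborel. u x * cnj (v (x + real_vec k))) has_sum S) UNIV"
    using parseval_bounded_support[OF uL2 us' vL2 vs] by blast
  have um: "u \<in> borel_measurable borel" by (rule L2_measurable[OF uL2])
  have "fcoef v \<gamma> = chi \<gamma> \<tau> * fcoef u (reflect \<tau> \<gamma>)" for \<gamma>
  proof -
    have "fcoef v \<gamma> = chi \<gamma> \<tau> * fcoef (\<lambda>x. u (reflect \<tau> x)) \<gamma>"
      unfolding v_def[abs_def] by (simp only: fcoef_translate[OF urL2]) (simp only: t_def wave_half_bit)
    also have "fcoef (\<lambda>x. u (reflect \<tau> x)) \<gamma> =
        (LINT x|lborel. u (reflect \<tau> x) * cnj (wave (real_vec (reflect \<tau> \<gamma>)) (reflect \<tau> x)))"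
      unfolding fcoef_def by (simp add: wave_def real_vec_reflect reflect_inner)
    also have "\<dots> = fcoef u (reflect \<tau> \<gamma>)"
      unfolding fcoef_def by (rule integral_reflect) (use um in measurable)
    finally show ?thesis .
  qed
  then have "fcoef u \<gamma> * cnj (fcoef v \<gamma>) = chi \<gamma> \<tau> * (l2_inner f (gabor g (half_shift l h, \<gamma>)) *
        cnj (l2_inner f (gabor g (half_shift l h, reflect \<tau> \<gamma>))))" for \<gamma>
    by (simp add: gabor_coef[OF test_fun_L2[OF f] g] u_def)
  moreover have "(LINT x|lborel. u x * cnj (v (x + real_vec n))) = cross_term f g \<tau> (l, h, n)" for n
    by (simp add: cross_term_def u_def v_def t_def half_shift_def add.assoc)
  ultimately show ?thesis using S by auto
qed

text \<open>The inequality a * b \<le> a^2 + b^2 separates the two window values, leaving integrals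
  of |g|^2 against cutoffs that come from the support of \<open>f\<close>. At each point at most c
  index triples pass both cutoffs, so after exchanging finite sums and integrals all partial sums
  have a common bound.\<close>

lemma cross_term_summable:
  assumes f: "test_fun f" and g: "g \<in> L2"
  shows "(\<lambda>p. norm (cross_term f g \<tau> p)) summable_on UNIV"
proof -
  obtain C M where C: "\<And>x. cmod (f x) \<le> C" and M: "\<And>x. f x \<noteq> 0 \<Longrightarrow> norm x \<le> M"
    using f by (auto simp: test_fun_def)
  have C0: "0 \<le> C" using C[of 0] norm_ge_zero order_trans by blast
  define K where "K x = (if norm x \<le> M then 1 else 0 :: real)" for x :: "real ^ 'a"
  have [measurable]: "K \<in> borel_measurable borel" unfolding K_def[abs_def] by measurable
  have gm [measurable]: "g \<in> borel_measurable borel" by (rule L2_measurable[OF g])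
  have fm [measurable]: "f \<in> borel_measurable borel" using f by (simp add: test_fun_def)
  have fK: "cmod (f x) \<le> C * K x" for x using C[of x] M[of x] C0 by (auto simp: K_def)
  have K01: "0 \<le> K x" "K x \<le> 1" for x by (auto simp: K_def)
  \<comment> \<open>Up to a reflection, which keeps norms, the second argument of \<open>f\<close>
    is \<open>r x l h\<close> plus an integer vector, the form treated by
    \<open>count_pairs\<close>.\<close>
  define r where "r x l h = x + (1/2) *\<^sub>R real_vec (bit_rep \<tau>) + reflect \<tau> (half_shift l h)" for x l h
  \<comment> \<open>The analogue after the substitution y = reflect \<tau> (x + w), which centres
    the second window value: the first argument of \<open>f\<close> is then minus the sum of
    \<open>r' y l h\<close> and an integer vector.\<close>
  define r' where "r' y l h = (1/2) *\<^sub>R real_vec (bit_rep \<tau>) - reflect \<tau> y - half_shift l h" for y l h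
  define E where "E = (\<lambda>x (l, h, n). K (x + half_shift l h) * K (r x l h + real_vec n))"
  define E' where "E' = (\<lambda>y (l, h, n). K (y + half_shift l h) * K (r' y l h + real_vec n))"
  have [measurable]: "(\<lambda>x. E x p) \<in> borel_measurable borel" "(\<lambda>x. E' x p) \<in> borel_measurable borel" for p
    unfolding E_def E'_def r_def r'_def by (cases p; simp; measurable)+
  have E01: "0 \<le> E x p" "E x p \<le> 1" "0 \<le> E' x p" "E' x p \<le> 1" for x p
    unfolding E_def E'_def by (cases p; simp add: K01 mult_le_one)+
  define G2 where "G2 x = (cmod (g x))\<^sup>2" for x
  have G2i: "integrable lborel G2" unfolding G2_def[abs_def] by (rule L2_integrable_square[OF g])
  have [measurable]: "G2 \<in> borel_measurable borel" unfolding G2_def[abs_def] by measurable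
  have G20: "0 \<le> G2 x" for x by (simp add: G2_def)
  have iE: "integrable lborel (\<lambda>x. G2 x * E x p)" "integrable lborel (\<lambda>x. G2 x * E' x p)" for p
  proof -
    have 1: "AE x in lborel. norm (G2 x * E x p) \<le> norm (G2 x)"
      by (intro AE_I2) (simp add: abs_mult abs_of_nonneg[OF G20] abs_of_nonneg[OF E01(1)] mult_left_le G20 E01(2))
    have 2: "AE x in lborel. norm (G2 x * E' x p) \<le> norm (G2 x)"
      by (intro AE_I2) (simp add: abs_mult abs_of_nonneg[OF G20] abs_of_nonneg[OF E01(3)] mult_left_le G20 E01(4))
    show "integrable lborel (\<lambda>x. G2 x * E x p)" "integrable lborel (\<lambda>x. G2 x * E' x p)"
      by (rule Bochner_Integration.integrable_bound[OF G2i _ 1], measurable)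
        (rule Bochner_Integration.integrable_bound[OF G2i _ 2], measurable)
  qed
  have Kr: "K (reflect \<tau> (x + half_shift n \<tau>) + half_shift l h) = K (r x l h + real_vec n)" for x l h n
  proof -
    have "reflect \<tau> (x + half_shift n \<tau>) + half_shift l h = reflect \<tau> (r x l h + real_vec n)"
      by (simp add: r_def half_shift_def reflect_vec_add add_ac)
    then show ?thesis by (simp add: K_def)
  qed
  have Kr': "K (reflect \<tau> y - half_shift n \<tau> + half_shift l h) = K (r' y l h + real_vec n)" for y l h n
  proof -
    have "reflect \<tau> y - half_shift n \<tau> + half_shift l h = - (r' y l h + real_vec n)"
      by (simp add: r'_def half_shift_def[of n])
    then show ?thesis by (simp only: K_def norm_minus_cancel)
  qed
  have bound: "norm (cross_term f g \<tau> p) \<le> C\<^sup>2 * ((LINT x|lborel. G2 x * E x p) + (LINT x|lborel. G2 x * E' x p))" for p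
  proof -
    obtain l h n where p: "p = (l, h, n)" by (cases p)
    define w where "w = half_shift n \<tau>"
    \<comment> \<open>The squared second window value with both cutoffs, written in the substituted
      variable; reflections and translations preserve its integral.\<close>
    define H where "H y = G2 y * (K (reflect \<tau> y - w + half_shift l h) * K (y + half_shift l h))" for y
    have [measurable]: "H \<in> borel_measurable borel" unfolding H_def[abs_def] by measurable
    have HE: "H y = G2 y * E' y p" for y by (simp add: H_def E'_def p w_def Kr' mult_ac)
    have EK: "E x p = K (x + half_shift l h) * K (reflect \<tau> (x + w) + half_shift l h)" for x
      by (simp add: E_def p w_def Kr)
    have H_shift: "H (reflect \<tau> (x + w)) = G2 (reflect \<tau> (x + w)) * E x p" for x
      by (simp add: H_def E_def p w_def Kr[symmetric])
    have iHr: "integrable lborel (\<lambda>x. H (reflect \<tau> (x + w)))"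
    proof -
      have "integrable lborel (\<lambda>x. H (reflect \<tau> x))"
        unfolding reflect_sign_map using iE(2)[of p]
        by (subst integrable_sign_map_iff) (auto simp: HE[abs_def])
      then show ?thesis by (subst integrable_translate_iff[of "\<lambda>x. H (reflect \<tau> x)"]) auto
    qed
    have Hint: "(LINT x|lborel. H (reflect \<tau> (x + w))) = (LINT x|lborel. G2 x * E' x p)"
    proof -
      have "(LINT x|lborel. H (reflect \<tau> (x + w))) = (LINT x|lborel. H (reflect \<tau> x))"
        by (rule integral_translate[of "\<lambda>x. H (reflect \<tau> x)"]) measurable
      also have "\<dots> = (LINT x|lborel. H x)" by (rule integral_reflect) measurable
      finally show ?thesis by (simp add: HE)
    qed
    let ?F = "\<lambda>x. window_product f g (half_shift l h) x *
      cnj (window_product f g (half_shift l h) (reflect \<tau> (x + w)))"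
    have pt: "norm (?F x) \<le> C\<^sup>2 * (G2 x * E x p + H (reflect \<tau> (x + w)))" for x
    proof -
      define a b where "a = cmod (g x)" and "b = cmod (g (reflect \<tau> (x + w)))"
      have "norm (?F x) = (cmod (f (x + half_shift l h)) * cmod (f (reflect \<tau> (x + w) + half_shift l h))) * (a * b)"
        by (simp add: window_product_def norm_mult a_def b_def mult_ac)
      also have "\<dots> \<le> ((C * K (x + half_shift l h)) * (C * K (reflect \<tau> (x + w) + half_shift l h))) * (a\<^sup>2 + b\<^sup>2)"
      proof (intro mult_mono fK)
        show "a * b \<le> a\<^sup>2 + b\<^sup>2"
        proof -
          have "0 \<le> a * b" by (simp add: a_def b_def)
          then show ?thesis using sum_squares_bound[of a b] by linarith
        qed
      qed (auto simp: a_def b_def C0 K01)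
      also have "\<dots> = C\<^sup>2 * (G2 x * E x p + H (reflect \<tau> (x + w)))"
        unfolding H_shift EK G2_def a_def b_def by (simp add: power2_eq_square algebra_simps)
      finally show ?thesis .
    qed
    have cross_eq: "cross_term f g \<tau> p = (LINT x|lborel. ?F x)"
      by (simp add: cross_term_def p w_def)
    have iB: "integrable lborel (\<lambda>x. C\<^sup>2 * (G2 x * E x p + H (reflect \<tau> (x + w))))"
      using iE(1)[of p] iHr by simp
    have iF: "integrable lborel ?F"
    proof (rule Bochner_Integration.integrable_bound[OF iB])
      show "?F \<in> borel_measurable lborel" unfolding window_product_def by measurable
      show "AE x in lborel. norm (?F x) \<le> norm (C\<^sup>2 * (G2 x * E x p + H (reflect \<tau> (x + w))))"
        unfolding real_norm_def by (intro AE_I2 order_trans[OF pt] abs_ge_self)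
    qed
    have "norm (cross_term f g \<tau> p) \<le> (LINT x|lborel. C\<^sup>2 * (G2 x * E x p + H (reflect \<tau> (x + w))))"
      unfolding cross_eq by (rule Bochner_Integration.integral_norm_bound_integral[OF iF iB pt])
    also have "\<dots> = C\<^sup>2 * ((LINT x|lborel. G2 x * E x p) + (LINT x|lborel. G2 x * E' x p))"
      using iE(1)[of p] iHr by (simp add: Hint)
    finally show ?thesis .
  qed
  obtain c where c: "\<And>(z :: real ^ 'a) X r. finite X \<Longrightarrow>
      card {(l, h, n) \<in> X. norm (z + half_shift l h) \<le> M \<and> norm (r l h + real_vec n :: real ^ 'a) \<le> M} \<le> c"
    using count_pairs[of M] by blast
  have Esum: "(\<Sum>p\<in>X. E x p) \<le> real c" "(\<Sum>p\<in>X. E' x p) \<le> real c" if X: "finite X" for X x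
  proof -
    have gen: "(\<Sum>p\<in>X. (\<lambda>(l, h, n). K (x + half_shift l h) * K (q l h + real_vec n)) p) \<le> real c"
      for q :: "int ^ 'a \<Rightarrow> bit ^ 'a \<Rightarrow> real ^ 'a"
    proof -
      let ?Y = "{(l, h, n) \<in> X. norm (x + half_shift l h) \<le> M \<and> norm (q l h + real_vec n) \<le> M}"
      have "(\<Sum>p\<in>X. (\<lambda>(l, h, n). K (x + half_shift l h) * K (q l h + real_vec n)) p) = (\<Sum>p\<in>?Y. 1)"
        using X by (intro sum.mono_neutral_cong_right) (auto simp: K_def split: if_splits)
      also have "\<dots> = real (card ?Y)" by simp
      also have "\<dots> \<le> real c" using c[OF X] by simp
      finally show ?thesis .
    qed
    show "(\<Sum>p\<in>X. E x p) \<le> real c" "(\<Sum>p\<in>X. E' x p) \<le> real c"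
      unfolding E_def E'_def by (rule gen)+
  qed
  have intsum: "(\<Sum>p\<in>X. LINT x|lborel. G2 x * D x p) \<le> real c * (LINT x|lborel. G2 x)"
    if X: "finite X" and D: "\<And>p. integrable lborel (\<lambda>x. G2 x * D x p)" "\<And>x. (\<Sum>p\<in>X. D x p) \<le> real c"
    for X D
  proof -
    have "(\<Sum>p\<in>X. LINT x|lborel. G2 x * D x p) = (LINT x|lborel. (\<Sum>p\<in>X. G2 x * D x p))"
      by (rule Bochner_Integration.integral_sum[symmetric]) (rule D)
    also have "\<dots> \<le> (LINT x|lborel. real c * G2 x)"
    proof (rule integral_mono)
      show "(\<Sum>p\<in>X. G2 x * D x p) \<le> real c * G2 x" for x
        using mult_left_mono[OF D(2)[of x] G20[of x]] by (simp add: sum_distrib_left mult.commute)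
    qed (use D G2i in auto)
    also have "\<dots> = real c * (LINT x|lborel. G2 x)" by simp
    finally show ?thesis .
  qed
  have "(\<Sum>p\<in>X. norm (cross_term f g \<tau> p)) \<le> C\<^sup>2 * (2 * (real c * (LINT x|lborel. G2 x)))" if X: "finite X" for X
  proof -
    have "(\<Sum>p\<in>X. norm (cross_term f g \<tau> p)) \<le>
        (\<Sum>p\<in>X. C\<^sup>2 * ((LINT x|lborel. G2 x * E x p) + (LINT x|lborel. G2 x * E' x p)))"
      by (intro sum_mono bound)
    also have "\<dots> = C\<^sup>2 * ((\<Sum>p\<in>X. LINT x|lborel. G2 x * E x p) + (\<Sum>p\<in>X. LINT x|lborel. G2 x * E' x p))"
      by (simp add: sum_distrib_left sum.distrib distrib_left)
    also have "\<dots> \<le> C\<^sup>2 * (real c * (LINT x|lborel. G2 x) + real c * (LINT x|lborel. G2 x))"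
      by (intro mult_left_mono add_mono intsum X iE Esum) auto
    finally show ?thesis by simp
  qed
  then show ?thesis
    by (intro nonneg_bdd_above_summable_on bdd_aboveI2) auto
qed

text \<open>Translating the integration variable by the block part \<open>wS\<close> restores the
  two arguments of \<open>f\<close>, while those of \<open>g\<close> have exchanged their block
  coordinates, which is the situation of \<open>block_swap\<close>.\<close>

lemma cross_term_swap:
  assumes sep: "separable_group G k s" and i: "i \<in> {1..k}"
    and \<tau>: "\<And>j. j \<in> supp (s i) \<Longrightarrow> \<tau> $ j = 1"
    and gsep: "\<exists>g'. separable_fun k s g' \<and> (AE x in lborel. g x = g' x)"
    and herm: "AE x in lborel. g (- x) = cnj (g x)"
    and f: "f \<in> borel_measurable borel" and g: "g \<in> borel_measurable borel"
  shows "cross_term f g \<tau> (swap_index (s i) p) = cross_term f g \<tau> p"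
proof -
  note [measurable] = f g
  obtain l h n where p: "p = (l, h, n)" by (cases p)
  obtain l' h' n' where p': "swap_index (s i) p = (l', h', n')" by (cases "swap_index (s i) p")
  define S where "S = supp (s i)"
  define w where "w = half_shift n \<tau>"
  define wS where "wS = restr S w"
  have \<tau>': "s i $ j = 1 \<Longrightarrow> \<tau> $ j = 1" for j using \<tau> by (simp add: supp_def)
  have l': "half_shift l' h' = half_shift l h - wS" and n': "half_shift n' \<tau> = w - 2 *\<^sub>R wS"
    using swap_index_shift[OF p'[unfolded p] \<tau>'] by (simp_all add: wS_def w_def S_def)
  have RwS: "reflect \<tau> wS = - wS"
    using \<tau> by (auto simp: vec_eq_iff reflect_nth wS_def restr_nth S_def)
  have swap: "AE x in lborel. cnj (g x) * g (reflect \<tau> (x + w)) =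
      cnj (g (x + restr (supp (s i)) w)) * g (reflect \<tau> (x + w - restr (supp (s i)) w))"
    by (rule block_swap[OF sep i _ gsep herm]) (rule \<tau>)
  define F' where "F' x = window_product f g (half_shift l' h') x *
     cnj (window_product f g (half_shift l' h') (reflect \<tau> (x + half_shift n' \<tau>)))" for x
  have F'm: "F' \<in> borel_measurable borel"
    unfolding F'_def[abs_def] window_product_def by measurable
  have "cross_term f g \<tau> (swap_index (s i) p) = (LINT x|lborel. F' (x + wS))"
    unfolding p' cross_term_def prod.case F'_def[symmetric] by (rule integral_translate[OF F'm, symmetric])
  also have "\<dots> = (LINT x|lborel. window_product f g (half_shift l h) x *
     cnj (window_product f g (half_shift l h) (reflect \<tau> (x + w))))"
  proof (rule integral_cong_AE)
    show "(\<lambda>x. F' (x + wS)) \<in> borel_measurable lborel"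
      using measurable_translate[OF F'm] by simp
    show "(\<lambda>x. window_product f g (half_shift l h) x *
        cnj (window_product f g (half_shift l h) (reflect \<tau> (x + w)))) \<in> borel_measurable lborel"
      unfolding window_product_def by measurable
    show "AE x in lborel. F' (x + wS) = window_product f g (half_shift l h) x *
        cnj (window_product f g (half_shift l h) (reflect \<tau> (x + w)))"
      using swap
    proof eventually_elim
      case (elim x)
      have 1: "x + wS + half_shift l' h' = x + half_shift l h" by (simp add: l')
      have 2: "x + wS + half_shift n' \<tau> = x + w - wS" by (simp add: n' scaleR_2)
      have 3: "reflect \<tau> (x + w - wS) + half_shift l' h' = reflect \<tau> (x + w) + half_shift l h"
        by (simp add: reflect_vec_diff RwS l')
      show ?case
        using elim unfolding F'_def window_product_def 1 2 3
        by (simp add: wS_def S_def mult.assoc mult.left_commute mult.commute)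
    qed
  qed
  finally show ?thesis by (simp add: p cross_term_def w_def)
qed

section \<open>The energy identity\<close>

locale wilson_system =
  fixes G :: "(bit ^ 'd) set" and k :: nat and s :: "nat \<Rightarrow> bit ^ 'd"
    and I :: "bit ^ 'd \<Rightarrow> (int ^ 'd) set" and \<rho> :: "(int ^ 'd) set \<Rightarrow> int ^ 'd"
    and g :: "real ^ 'd \<Rightarrow> complex" and N :: "(int ^ 'd) set"
  assumes sep: "separable_group G k s"
    and iso: "is_dual_iso G k s I"
    and rep: "\<forall>c\<in>carrier (dual_group G). \<rho> c \<in> c"
    and gL2: "g \<in> L2"
    and N: "\<forall>x :: int ^ 'd. card (N \<inter> orbit G x) = 1"
    and gsep: "\<exists>g'. separable_fun k s g' \<and> (AE x in lborel. g x = g' x)"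
    and herm: "AE x in lborel. g (- x) = cnj (g x)"
begin

lemma finite_G: "finite G" and card_G: "card G = 2 ^ k"
  using card_separable_group[OF sep] by auto

lemma zero_G: "0 \<in> G" and add_G: "\<sigma> \<in> G \<Longrightarrow> \<tau> \<in> G \<Longrightarrow> \<sigma> + \<tau> \<in> G"
  using separable_group_closed[OF sep] by auto

lemmas sum_shift_G = sum_shift[OF sep iso rep]

text \<open>The index sets are rearranged as \<open>((l, h), \<gamma>)\<close>, with translation parameter \<open>l + h / 2\<close>.\<close>

definition coef :: "(real ^ 'd \<Rightarrow> complex) \<Rightarrow> ((int ^ 'd) \<times> (bit ^ 'd)) \<times> (int ^ 'd) \<Rightarrow> complex" where
  "coef f = (\<lambda>((l, h), \<gamma>). l2_inner f (gabor g (half_shift l h, \<gamma>)))"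

abbreviation sgn_char :: "bit ^ 'd \<Rightarrow> int ^ 'd \<Rightarrow> bit ^ 'd \<Rightarrow> complex" where
  "sgn_char h \<gamma> \<sigma> \<equiv> chi (\<rho> (I h) + \<gamma>) \<sigma>"

text \<open>In the expanded square of a Wilson coefficient, reflecting the frequency by the first
  summation index leaves a term that depends on the two indices only through their sum
  \<open>\<tau>\<close>.\<close>

definition twisted ::
    "(real ^ 'd \<Rightarrow> complex) \<Rightarrow> bit ^ 'd \<Rightarrow> ((int ^ 'd) \<times> (bit ^ 'd)) \<times> (int ^ 'd) \<Rightarrow> complex" where
  "twisted f \<tau> = (\<lambda>(p, \<gamma>). sgn_char (snd p) \<gamma> \<tau> * (coef f (p, \<gamma>) * cnj (coef f (p, reflect \<tau> \<gamma>))))"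

lemma bij_reflect: "bij_betw (\<lambda>(p, \<gamma>). (p, reflect \<sigma> \<gamma>)) (A \<times> (UNIV :: (int ^ 'd) set)) (A \<times> UNIV)"
  by (rule bij_betw_byWitness[where f' = "\<lambda>(p, \<gamma>). (p, reflect \<sigma> \<gamma>)"]) auto

lemma bij_assoc: "bij_betw (\<lambda>((l, h), n). (l, h, n)) ((A \<times> B) \<times> C) (A \<times> B \<times> C)"
  by (rule bij_betw_byWitness[where f' = "\<lambda>(l, h, n). ((l, h), n)"]) auto

context
  fixes f :: "real ^ 'd \<Rightarrow> complex"
  assumes f: "test_fun f"
begin

definition cross :: "bit ^ 'd \<Rightarrow> ((int ^ 'd) \<times> (bit ^ 'd)) \<times> (int ^ 'd) \<Rightarrow> complex" where
  "cross \<tau> = (\<lambda>((l, h), n). cross_term f g \<tau> (l, h, n))"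

lemma cross_abs_summable: "(\<lambda>q. norm (cross \<tau> q)) summable_on UNIV"
proof -
  have "(\<lambda>x. norm (cross_term f g \<tau> ((\<lambda>((l, h), n). (l, h, n)) x))) summable_on UNIV"
    using summable_on_reindex_bij_betw[OF bij_assoc[of UNIV UNIV UNIV], of "\<lambda>p. norm (cross_term f g \<tau> p)"]
      cross_term_summable[OF f gL2] by simp
  then show ?thesis by (simp add: cross_def case_prod_unfold)
qed

text \<open>The character of \<open>I h\<close> is left out, because it is constant for a fixed
  translation \<open>p\<close>; it returns as \<open>\<eta>\<close> in
  \<open>twisted_cancel\<close>.\<close>

lemma fibre_sum:
  obtains S where
    "\<And>p. ((\<lambda>\<gamma>. chi \<gamma> \<tau> * (coef f (p, \<gamma>) * cnj (coef f (p, reflect \<tau> \<gamma>)))) has_sum S p) UNIV"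
    "\<And>p. ((\<lambda>n. cross \<tau> (p, n)) has_sum S p) UNIV"
proof -
  have "\<exists>S. ((\<lambda>\<gamma>. chi \<gamma> \<tau> * (coef f (p, \<gamma>) * cnj (coef f (p, reflect \<tau> \<gamma>)))) has_sum S) UNIV \<and>
      ((\<lambda>n. cross \<tau> (p, n)) has_sum S) UNIV" for p
    using gabor_cross_sum[OF f gL2, of \<tau> "fst p" "snd p"]
    by (simp add: coef_def cross_def case_prod_unfold)
  then have "\<forall>p. \<exists>S. ((\<lambda>\<gamma>. chi \<gamma> \<tau> * (coef f (p, \<gamma>) * cnj (coef f (p, reflect \<tau> \<gamma>)))) has_sum S) UNIV \<and>
      ((\<lambda>n. cross \<tau> (p, n)) has_sum S) UNIV" by blast
  from choice[OF this] show ?thesis using that by blast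
qed

text \<open>The case \<open>\<tau> = 0\<close>: absolute summability of the cross side makes the
  fibre sums \<open>S p\<close> summable, and since these are sums of nonnegative terms, the double
  series converges. No Bessel bound is involved.\<close>

lemma coef_square_summable: "(\<lambda>q. (cmod (coef f q))\<^sup>2) summable_on UNIV"
proof -
  obtain S where S: "\<And>p. ((\<lambda>\<gamma>. chi \<gamma> 0 * (coef f (p, \<gamma>) * cnj (coef f (p, reflect 0 \<gamma>)))) has_sum S p) UNIV"
    "\<And>p. ((\<lambda>n. cross 0 (p, n)) has_sum S p) UNIV"
    by (rule fibre_sum[of 0]) blast
  have "((\<lambda>\<gamma>. complex_of_real ((cmod (coef f (p, \<gamma>)))\<^sup>2)) has_sum S p) UNIV" for p
    using S(1)[of p] unfolding complex_norm_square by simp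
  from has_sum_Re[OF this]
  have 1: "((\<lambda>\<gamma>. (cmod (coef f (p, \<gamma>)))\<^sup>2) has_sum Re (S p)) UNIV" for p by simp
  have "cross 0 summable_on UNIV \<times> UNIV"
    using abs_summable_summable[OF cross_abs_summable] by simp
  then have "(cross 0 has_sum infsum (cross 0) (UNIV \<times> UNIV)) (UNIV \<times> UNIV)"
    by (rule has_sum_infsum)
  from has_sum_SigmaD[OF this S(2)]
  have "(S has_sum infsum (cross 0) (UNIV \<times> UNIV)) UNIV" .
  from has_sum_imp_summable[OF has_sum_Re[OF this]] have "(\<lambda>p. Re (S p)) summable_on UNIV" .
  from summable_on_SigmaI[OF 1 this] show ?thesis by simp
qed

text \<open>The product of two coefficients is dominated by the sum of their squares, and reflecting
  frequencies only permutes the finite Gabor energy. This justifies the fibrewise summation in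
  \<open>twisted_cancel\<close>.\<close>

lemma twisted_summable: "twisted f \<tau> summable_on A"
proof -
  have 1: "(\<lambda>q. (cmod (coef f q))\<^sup>2) summable_on UNIV \<times> UNIV"
    using coef_square_summable by simp
  have "(\<lambda>x. (cmod (coef f ((\<lambda>(p, \<gamma>). (p, reflect \<tau> \<gamma>)) x)))\<^sup>2) summable_on UNIV \<times> UNIV"
    using summable_on_reindex_bij_betw[OF bij_reflect[of \<tau> UNIV], of "\<lambda>q. (cmod (coef f q))\<^sup>2"] 1 by simp
  from summable_on_add[OF 1 this]
  have "(\<lambda>x. (cmod (coef f x))\<^sup>2 + (cmod (coef f (fst x, reflect \<tau> (snd x))))\<^sup>2) summable_on UNIV"
    by (simp add: case_prod_unfold)
  then have "(\<lambda>x. norm (twisted f \<tau> x)) summable_on UNIV"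
  proof (rule Infinite_Sum.abs_summable_on_comparison_test')
    fix x :: "((int ^ 'd) \<times> (bit ^ 'd)) \<times> (int ^ 'd)"
    have "norm (twisted f \<tau> x) = cmod (coef f x) * cmod (coef f (fst x, reflect \<tau> (snd x)))"
      by (simp add: twisted_def case_prod_unfold norm_mult)
    also have "\<dots> \<le> (cmod (coef f x))\<^sup>2 + (cmod (coef f (fst x, reflect \<tau> (snd x))))\<^sup>2"
      using sum_squares_bound[of "cmod (coef f x)" "cmod (coef f (fst x, reflect \<tau> (snd x)))"]
        mult_nonneg_nonneg[OF norm_ge_zero norm_ge_zero, of "coef f x" "coef f (fst x, reflect \<tau> (snd x))"]
      by linarith
    finally show "norm (twisted f \<tau> x) \<le> (cmod (coef f x))\<^sup>2 + (cmod (coef f (fst x, reflect \<tau> (snd x))))\<^sup>2" .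
  qed
  then have "twisted f \<tau> summable_on UNIV" by (rule abs_summable_summable)
  then show ?thesis by (rule summable_on_subset) simp
qed

lemma twisted_cancel:
  assumes \<tau>: "\<tau> \<in> G" "\<tau> \<noteq> 0"
  shows "(twisted f \<tau> has_sum 0) ((UNIV \<times> G) \<times> UNIV)"
proof -
  define \<eta> where "\<eta> h = chi (\<rho> (I h)) \<tau>" for h
  obtain i where i: "i \<in> {1..k}" and blk: "\<And>j. j \<in> supp (s i) \<Longrightarrow> \<tau> $ j = 1"
    and flip: "\<And>h. h \<in> G \<Longrightarrow> \<eta> (h + s i) = - \<eta> h"
    using sign_flip[OF sep iso rep \<tau>] unfolding \<eta>_def by metis
  obtain S where S: "\<And>p. ((\<lambda>\<gamma>. chi \<gamma> \<tau> * (coef f (p, \<gamma>) * cnj (coef f (p, reflect \<tau> \<gamma>)))) has_sum S p) UNIV"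
    "\<And>p. ((\<lambda>n. cross \<tau> (p, n)) has_sum S p) UNIV"
    by (rule fibre_sum[of \<tau>]) blast
  define Q where "Q = (UNIV :: (int ^ 'd) set) \<times> G"
  define w where "w = (\<lambda>(p, n). \<eta> (snd p) * cross \<tau> (p, n))"
  have "(\<lambda>x. norm (w x)) summable_on UNIV"
    using cross_abs_summable by (simp add: w_def case_prod_unfold norm_mult \<eta>_def)
  then have "w summable_on UNIV" by (rule abs_summable_summable)
  then have ws: "w summable_on Q \<times> UNIV" by (rule summable_on_subset) simp
  define Z where "Z = infsum w (Q \<times> UNIV)"
  have wZ: "(w has_sum Z) (Q \<times> UNIV)" unfolding Z_def by (rule has_sum_infsum[OF ws])
  have "((\<lambda>n. w (p, n)) has_sum \<eta> (snd p) * S p) UNIV" for p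
    using has_sum_cmult_right[OF S(2), of "\<eta> (snd p)" p] by (simp add: w_def)
  from has_sum_SigmaD[OF wZ this] have SZ: "((\<lambda>p. \<eta> (snd p) * S p) has_sum Z) Q" .
  have "((\<lambda>\<gamma>. twisted f \<tau> (p, \<gamma>)) has_sum \<eta> (snd p) * S p) UNIV" for p
    using has_sum_cmult_right[OF S(1), of "\<eta> (snd p)" p]
    by (simp add: twisted_def \<eta>_def chi_add_left mult.assoc)
  from has_sum_SigmaI[OF this SZ twisted_summable]
  have tZ: "(twisted f \<tau> has_sum Z) (Q \<times> UNIV)" .
  define sw where "sw = (\<lambda>((l, h), n). case swap_index (s i) (l, h, n) of (l', h', n') \<Rightarrow> ((l' :: int ^ 'd, h' :: bit ^ 'd), n' :: int ^ 'd))"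
  have sG: "s i \<in> G" by (rule separable_group_closed(3)[OF sep i])
  have swsw: "sw (sw x) = x" for x
    using swap_index_swap_index[of "s i" "(fst (fst x), snd (fst x), snd x)"]
    by (simp add: sw_def case_prod_unfold)
  have swQ: "sw x \<in> Q \<times> UNIV" if "x \<in> Q \<times> UNIV" for x
    using that add_G sG by (auto simp: sw_def swap_index_def Q_def)
  have "bij_betw sw (Q \<times> UNIV) (Q \<times> UNIV)"
    by (intro bij_betw_byWitness[where f' = sw] ballI swsw image_subsetI swQ)
  then have "((\<lambda>x. w (sw x)) has_sum Z) (Q \<times> UNIV)"
    using has_sum_reindex_bij_betw[of sw _ _ w Z] wZ by blast
  moreover have "w (sw x) = - w x" if x: "x \<in> Q \<times> UNIV" for x
  proof -
    obtain l h n where lhn: "x = ((l, h), n)" by (cases x) auto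
    obtain l' h' n' where sl: "swap_index (s i) (l, h, n) = (l', h', n')"
      by (cases "swap_index (s i) (l, h, n)")
    have h: "h' = h + s i" using sl by (simp add: swap_index_def)
    have "cross_term f g \<tau> (l', h', n') = cross_term f g \<tau> (l, h, n)"
      unfolding sl[symmetric]
      by (rule cross_term_swap[OF sep i _ gsep herm _ L2_measurable[OF gL2]])
        (use blk f in \<open>auto simp: test_fun_def\<close>)
    then show ?thesis
      using x flip[of h] by (simp add: w_def sw_def lhn sl cross_def h Q_def)
  qed
  \<comment> \<open>Reindexing by the involution keeps the sum Z, yet every term has changed
    sign.\<close>
  ultimately have "((\<lambda>x. - w x) has_sum Z) (Q \<times> UNIV)"
    by (simp cong: has_sum_cong)
  moreover have "((\<lambda>x. - w x) has_sum - Z) (Q \<times> UNIV)"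
    using has_sum_cmult_right[OF wZ, of "- 1"] by simp
  ultimately have "Z = - Z" by (rule has_sum_unique)
  then have "Z = 0" by simp
  with tZ show ?thesis by (simp add: Q_def)
qed

definition amplitude :: "((int ^ 'd) \<times> (bit ^ 'd)) \<times> (int ^ 'd) \<Rightarrow> real" where
  "amplitude = (\<lambda>(p, \<gamma>). (cmod (\<Sum>\<sigma>\<in>G. sgn_char (snd p) \<gamma> \<sigma> * coef f (p, reflect \<sigma> \<gamma>)))\<^sup>2)"

lemma amplitude_expand:
  "complex_of_real (amplitude (p, \<gamma>)) = (\<Sum>\<sigma>\<in>G. \<Sum>\<tau>\<in>G. twisted f (\<sigma> + \<tau>) (p, reflect \<sigma> \<gamma>))"
proof -
  have "complex_of_real (amplitude (p, \<gamma>)) =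
      (\<Sum>\<sigma>\<in>G. sgn_char (snd p) \<gamma> \<sigma> * coef f (p, reflect \<sigma> \<gamma>)) *
      cnj (\<Sum>\<sigma>\<in>G. sgn_char (snd p) \<gamma> \<sigma> * coef f (p, reflect \<sigma> \<gamma>))"
    unfolding amplitude_def prod.case by (rule complex_norm_square)
  also have "\<dots> = (\<Sum>\<sigma>\<in>G. \<Sum>\<tau>\<in>G. (sgn_char (snd p) \<gamma> \<sigma> * coef f (p, reflect \<sigma> \<gamma>)) *
      cnj (sgn_char (snd p) \<gamma> \<tau> * coef f (p, reflect \<tau> \<gamma>)))"
    unfolding cnj_sum by (rule sum_product)
  also have "\<dots> = (\<Sum>\<sigma>\<in>G. \<Sum>\<tau>\<in>G. twisted f (\<sigma> + \<tau>) (p, reflect \<sigma> \<gamma>))"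
  proof (intro sum.cong refl)
    fix \<sigma> \<tau>
    have "reflect (\<sigma> + \<tau>) (reflect \<sigma> \<gamma>) = reflect \<tau> \<gamma>"
      by (simp flip: reflect_add add: add.assoc add.commute[of \<tau>])
    then show "(sgn_char (snd p) \<gamma> \<sigma> * coef f (p, reflect \<sigma> \<gamma>)) *
        cnj (sgn_char (snd p) \<gamma> \<tau> * coef f (p, reflect \<tau> \<gamma>)) = twisted f (\<sigma> + \<tau>) (p, reflect \<sigma> \<gamma>)"
      by (simp add: twisted_def chi_add_left chi_add_right chi_reflect mult_ac)
  qed
  finally show ?thesis .
qed

lemma coef_energy_has_sum:
  "((\<lambda>q. (cmod (coef f q))\<^sup>2) has_sum infsum (\<lambda>q. (cmod (coef f q))\<^sup>2) ((UNIV \<times> G) \<times> UNIV)) ((UNIV \<times> G) \<times> UNIV)"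
  by (intro has_sum_infsum summable_on_subset[OF coef_square_summable]) simp

text \<open>Only the pairs with \<sigma> + \<tau> = 0 survive \<open>twisted_cancel\<close>; there
  are 2^k of them, and each contributes the whole Gabor energy.\<close>

lemma amplitude_has_sum:
  "(amplitude has_sum 2 ^ k * infsum (\<lambda>q. (cmod (coef f q))\<^sup>2) ((UNIV \<times> G) \<times> UNIV)) ((UNIV \<times> G) \<times> UNIV)"
proof -
  define Q where "Q = ((UNIV :: (int ^ 'd) set) \<times> G) \<times> (UNIV :: (int ^ 'd) set)"
  define E where "E = infsum (\<lambda>q. (cmod (coef f q))\<^sup>2) Q"
  define Z where "Z \<tau> = (if \<tau> = 0 then complex_of_real E else 0)" for \<tau> :: "bit ^ 'd"
  have Z: "(twisted f \<tau> has_sum Z \<tau>) Q" if "\<tau> \<in> G" for \<tau>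
  proof (cases "\<tau> = 0")
    case True
    have "((\<lambda>q. complex_of_real ((cmod (coef f q))\<^sup>2)) has_sum of_real E) Q"
      using coef_energy_has_sum unfolding E_def Q_def by (rule has_sum_of_real)
    moreover have "complex_of_real ((cmod (coef f q))\<^sup>2) = twisted f \<tau> q" for q
      unfolding complex_norm_square by (simp add: twisted_def True case_prod_unfold)
    ultimately show ?thesis by (simp add: Z_def True)
  qed (use twisted_cancel that in \<open>simp add: Z_def Q_def\<close>)
  have "((\<lambda>(p, \<gamma>). twisted f (\<sigma> + \<tau>) (p, reflect \<sigma> \<gamma>)) has_sum Z (\<sigma> + \<tau>)) Q"
    if "\<sigma> \<in> G" "\<tau> \<in> G" for \<sigma> \<tau>
    using has_sum_reindex_bij_betw[OF bij_reflect[of \<sigma> "UNIV \<times> G"], of "twisted f (\<sigma> + \<tau>)" "Z (\<sigma> + \<tau>)"]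
      Z[OF add_G[OF that]] by (simp add: Q_def case_prod_unfold)
  then have "((\<lambda>x. \<Sum>\<sigma>\<in>G. \<Sum>\<tau>\<in>G. (\<lambda>(p, \<gamma>). twisted f (\<sigma> + \<tau>) (p, reflect \<sigma> \<gamma>)) x) has_sum
      (\<Sum>\<sigma>\<in>G. \<Sum>\<tau>\<in>G. Z (\<sigma> + \<tau>))) Q"
    by (intro has_sum_finite_sum)
  moreover have "(\<Sum>\<sigma>\<in>G. \<Sum>\<tau>\<in>G. Z (\<sigma> + \<tau>)) = of_real (2 ^ k * E)"
  proof -
    have "(\<Sum>\<sigma>\<in>G. \<Sum>\<tau>\<in>G. Z (\<sigma> + \<tau>)) = (\<Sum>\<sigma>\<in>G. \<Sum>\<tau>\<in>G. Z \<tau>)"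
      by (intro sum.cong refl sum_shift_G)
    also have "(\<Sum>\<tau>\<in>G. Z \<tau>) = of_real E"
      using zero_G finite_G by (simp add: Z_def)
    finally show ?thesis by (simp add: card_G)
  qed
  moreover have "(\<Sum>\<sigma>\<in>G. \<Sum>\<tau>\<in>G. (\<lambda>(p, \<gamma>). twisted f (\<sigma> + \<tau>) (p, reflect \<sigma> \<gamma>)) x) = of_real (amplitude x)" for x
    by (cases x) (simp add: amplitude_expand)
  ultimately have "((\<lambda>x. complex_of_real (amplitude x)) has_sum of_real (2 ^ k * E)) Q"
    by simp
  from has_sum_Re[OF this] show ?thesis by (simp add: Q_def E_def)
qed

text \<open>Reflecting the frequency and shifting the summation index accordingly multiplies the
  inner sum by a sign.\<close>

lemma amplitude_reflect:
  assumes "\<tau> \<in> G"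
  shows "amplitude (p, reflect \<tau> \<gamma>) = amplitude (p, \<gamma>)"
proof -
  have "(\<Sum>\<sigma>\<in>G. sgn_char (snd p) (reflect \<tau> \<gamma>) \<sigma> * coef f (p, reflect \<sigma> (reflect \<tau> \<gamma>))) =
      (\<Sum>\<sigma>\<in>G. sgn_char (snd p) \<gamma> \<tau> * (sgn_char (snd p) \<gamma> (\<tau> + \<sigma>) * coef f (p, reflect (\<tau> + \<sigma>) \<gamma>)))"
  proof (intro sum.cong refl)
    fix \<sigma>
    have "sgn_char (snd p) \<gamma> \<tau> * sgn_char (snd p) \<gamma> (\<tau> + \<sigma>) = sgn_char (snd p) \<gamma> \<sigma>"
      by (simp add: chi_add_right mult.assoc[symmetric])
    then show "sgn_char (snd p) (reflect \<tau> \<gamma>) \<sigma> * coef f (p, reflect \<sigma> (reflect \<tau> \<gamma>)) =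
        sgn_char (snd p) \<gamma> \<tau> * (sgn_char (snd p) \<gamma> (\<tau> + \<sigma>) * coef f (p, reflect (\<tau> + \<sigma>) \<gamma>))"
      by (simp add: chi_add_left chi_reflect mult.assoc[symmetric] add.commute[of \<tau>] flip: reflect_add)
  qed
  also have "\<dots> = sgn_char (snd p) \<gamma> \<tau> * (\<Sum>\<sigma>\<in>G. sgn_char (snd p) \<gamma> \<sigma> * coef f (p, reflect \<sigma> \<gamma>))"
    unfolding sum_distrib_left[symmetric]
    by (subst sum_shift_G[OF assms, of "\<lambda>\<sigma>. sgn_char (snd p) \<gamma> \<sigma> * coef f (p, reflect \<sigma> \<gamma>)"]) (rule refl)
  finally show ?thesis
    by (simp add: amplitude_def norm_mult)
qed

lemma finite_orbit: "finite (orbit G x)"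
proof -
  have "orbit G x = (\<lambda>\<sigma>. reflect \<sigma> x) ` G" by (auto simp: orbit_def)
  then show ?thesis using finite_G by simp
qed

text \<open>The orbits of the points of \<open>N\<close> partition the frequencies, and
  \<open>amplitude\<close> is constant on each. The weight produced in this way is the orbit length
  in the squared normalising factor.\<close>

lemma amplitude_transversal_has_sum:
  "((\<lambda>(p, \<gamma>). card (orbit G \<gamma>) * amplitude (p, \<gamma>)) has_sum
     2 ^ k * infsum (\<lambda>q. (cmod (coef f q))\<^sup>2) ((UNIV \<times> G) \<times> UNIV)) ((UNIV \<times> G) \<times> N)"
proof -
  define A where "A = (UNIV :: (int ^ 'd) set) \<times> G"
  note bij = orbit_transversal[OF sep N]
  have "bij_betw (\<lambda>((p, \<gamma>), \<delta>). (p, \<delta>)) (Sigma (A \<times> N) (\<lambda>(p, \<gamma>). orbit G \<gamma>)) (A \<times> UNIV)"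
  proof (rule bij_betw_imageI)
    show "inj_on (\<lambda>((p, \<gamma>), \<delta>). (p, \<delta>)) (Sigma (A \<times> N) (\<lambda>(p, \<gamma>). orbit G \<gamma>))"
    proof (rule inj_onI, clarsimp)
      fix \<gamma> \<gamma>' \<delta> assume "\<gamma> \<in> N" "\<gamma>' \<in> N" "\<delta> \<in> orbit G \<gamma>" "\<delta> \<in> orbit G \<gamma>'"
      then show "\<gamma> = \<gamma>'"
        using inj_onD[OF bij_betw_imp_inj_on[OF bij], of "(\<gamma>, \<delta>)" "(\<gamma>', \<delta>)"] by simp
    qed
    show "(\<lambda>((p, \<gamma>), \<delta>). (p, \<delta>)) ` Sigma (A \<times> N) (\<lambda>(p, \<gamma>). orbit G \<gamma>) = A \<times> UNIV"
    proof (intro equalityI subsetI)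
      fix x assume x: "x \<in> A \<times> (UNIV :: (int ^ 'd) set)"
      obtain p \<delta> where pd: "x = (p, \<delta>)" by (cases x)
      have "\<delta> \<in> snd ` Sigma N (orbit G)" using bij_betw_imp_surj_on[OF bij] by simp
      then obtain \<gamma> where "\<gamma> \<in> N" "\<delta> \<in> orbit G \<gamma>" by auto
      then have "((p, \<gamma>), \<delta>) \<in> Sigma (A \<times> N) (\<lambda>(p, \<gamma>). orbit G \<gamma>)" using x pd by auto
      then show "x \<in> (\<lambda>((p, \<gamma>), \<delta>). (p, \<delta>)) ` Sigma (A \<times> N) (\<lambda>(p, \<gamma>). orbit G \<gamma>)"
        unfolding pd by (rule rev_image_eqI) simp
    qed auto
  qed
  then have "((\<lambda>x. amplitude ((\<lambda>((p, \<gamma>), \<delta>). (p, \<delta>)) x)) has_sum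
      2 ^ k * infsum (\<lambda>q. (cmod (coef f q))\<^sup>2) (A \<times> UNIV)) (Sigma (A \<times> N) (\<lambda>(p, \<gamma>). orbit G \<gamma>))"
    using amplitude_has_sum unfolding A_def by (subst has_sum_reindex_bij_betw)
  moreover have "((\<lambda>\<delta>. amplitude ((\<lambda>((p, \<gamma>), \<delta>). (p, \<delta>)) (x, \<delta>))) has_sum
      (\<lambda>(p, \<gamma>). card (orbit G \<gamma>) * amplitude (p, \<gamma>)) x) ((\<lambda>(p, \<gamma>). orbit G \<gamma>) x)" for x
  proof -
    obtain p \<gamma> where x: "x = (p, \<gamma>)" by (cases x)
    have "amplitude (p, \<delta>) = amplitude (p, \<gamma>)" if "\<delta> \<in> orbit G \<gamma>" for \<delta>
      using that amplitude_reflect[of _ p \<gamma>] by (auto simp: orbit_def)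
    then have "(\<Sum>\<delta>\<in>orbit G \<gamma>. amplitude (p, \<delta>)) = card (orbit G \<gamma>) * amplitude (p, \<gamma>)"
      by simp
    then show ?thesis
      unfolding x using finite_orbit by (intro has_sum_finiteI) auto
  qed
  ultimately show ?thesis
    unfolding A_def by (rule has_sum_SigmaD)
qed

end

lemma wilson_eq:
  "wilson G k I \<rho> u (l, h, \<gamma>) = (\<lambda>x. of_real (sqrt (card (orbit G \<gamma>)) / 2 ^ k) *
     (\<Sum>\<sigma>\<in>G. sgn_char h \<gamma> \<sigma> * gabor u (half_shift l h, reflect \<sigma> \<gamma>) x))"
  unfolding wilson_def prod.case minus_one_powi_pairing
  by (rule ext) (simp add: translate_def gabor_def half_shift_def diff_diff_eq)

lemma wilson_L2: "u \<in> L2 \<Longrightarrow> wilson G k I \<rho> u j \<in> L2"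
  by (cases j) (simp only: wilson_eq, intro L2_scale L2_sum gabor_L2)

lemma cls_wilson:
  assumes "u \<in> L2"
  shows "cls (wilson G k I \<rho> u (l, h, \<gamma>)) = of_real (sqrt (card (orbit G \<gamma>)) / 2 ^ k) *\<^sub>C
     (\<Sum>\<sigma>\<in>G. sgn_char h \<gamma> \<sigma> *\<^sub>C cls (gabor u (half_shift l h, reflect \<sigma> \<gamma>)))"
  unfolding wilson_eq using assms by (simp add: cls_scaleC cls_sum)

lemma countable_gabor_index: "countable (gabor_index G)"
  and gabor_index_bij: "bij_betw (\<lambda>((l, h), \<gamma>). (half_shift l h, \<gamma>)) ((UNIV \<times> G) \<times> UNIV) (gabor_index G)"
proof -
  show bij: "bij_betw (\<lambda>((l, h), \<gamma>). (half_shift l h, \<gamma>)) ((UNIV \<times> G) \<times> UNIV) (gabor_index G)"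
  proof (rule bij_betw_imageI)
    show "inj_on (\<lambda>((l, h), \<gamma>). (half_shift l h, \<gamma>)) ((UNIV \<times> G) \<times> UNIV)"
      by (auto simp: inj_on_def half_shift_eq_iff)
    have "{(1/2) *\<^sub>R l |l. l \<in> lattice G} = (\<lambda>(l, h). half_shift l h) ` (UNIV \<times> G)"
    proof -
      have h: "(1/2) *\<^sub>R (real_vec (bit_rep \<sigma>) + 2 *\<^sub>R real_vec n) = half_shift n \<sigma>" for \<sigma> :: "bit ^ 'd" and n
        by (simp add: half_shift_def scaleR_add_right)
      have "{(1/2) *\<^sub>R l |l. l \<in> lattice G} =
          {(1/2) *\<^sub>R (real_vec (bit_rep \<sigma>) + 2 *\<^sub>R real_vec n) | n \<sigma>. \<sigma> \<in> G}"
        unfolding lattice_def by blast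
      then show ?thesis unfolding h by auto
    qed
    then show "(\<lambda>((l, h), \<gamma>). (half_shift l h, \<gamma>)) ` ((UNIV \<times> G) \<times> UNIV) = gabor_index G"
      unfolding gabor_index_def by (auto simp: image_iff) blast
  qed
  have "countable ((\<lambda>((l, h), \<gamma>). (half_shift l h, \<gamma>)) ` ((UNIV \<times> G) \<times> (UNIV :: (int ^ 'd) set)))"
    by (intro countable_image countableI_type)
  then show "countable (gabor_index G)"
    using bij_betw_imp_surj_on[OF bij] by simp
qed

lemma gabor_family: "u \<in> L2 \<Longrightarrow> L2_family (gabor_index G) (gabor u)"
  by (auto simp: L2_family_def countable_gabor_index)

lemma wilson_family: "L2_family (wilson_index G k I \<rho> g N) (wilson G k I \<rho> g)"
  by (auto simp: L2_family_def wilson_L2 gL2 countableI_type)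

text \<open>The squared normalising factor is the orbit length over 4^k, so the Wilson energy is 2^k
  * E / 4^k, while the Gabor energy is E.\<close>

lemma energy_identity:
  assumes f: "test_fun f"
  shows "(\<lambda>j. (cmod (cinner (cls f) (cls (gabor g j))))\<^sup>2) summable_on gabor_index G"
    "(\<lambda>j. (cmod (cinner (cls f) (cls (wilson G k I \<rho> g j))))\<^sup>2) summable_on wilson_index G k I \<rho> g N"
    "frame_energy (gabor_index G) (\<lambda>j. cls (gabor g j)) (cls f) =
      2 ^ k * frame_energy (wilson_index G k I \<rho> g N) (\<lambda>j. cls (wilson G k I \<rho> g j)) (cls f)"
proof -
  define E where "E = infsum (\<lambda>q. (cmod (coef f q))\<^sup>2) ((UNIV \<times> G) \<times> UNIV)"
  have fL2: "f \<in> L2" by (rule test_fun_L2[OF f])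
  let ?cg = "\<lambda>j. (cmod (cinner (cls f) (cls (gabor g j))))\<^sup>2"
  let ?cw = "\<lambda>j. (cmod (cinner (cls f) (cls (wilson G k I \<rho> g j))))\<^sup>2"
  have "((\<lambda>q. (cmod (coef f q))\<^sup>2) has_sum E) ((UNIV \<times> G) \<times> UNIV)"
    unfolding E_def by (rule coef_energy_has_sum[OF f])
  moreover have "?cg ((\<lambda>((l, h), \<gamma>). (half_shift l h, \<gamma>)) q) = (cmod (coef f q))\<^sup>2" for q
    by (simp add: coef_def case_prod_unfold cinner_cls fL2 gL2)
  ultimately have gs: "(?cg has_sum E) (gabor_index G)"
    using has_sum_reindex_bij_betw[OF gabor_index_bij, of ?cg E] by simp
  have cw: "?cw (l, h, \<gamma>) = (card (orbit G \<gamma>) * amplitude f ((l, h), \<gamma>)) / (2 ^ k * 2 ^ k)" for l h \<gamma>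
  proof -
    have "cinner (cls f) (cls (wilson G k I \<rho> g (l, h, \<gamma>))) = of_real (sqrt (card (orbit G \<gamma>)) / 2 ^ k) *
        (\<Sum>\<sigma>\<in>G. sgn_char h \<gamma> \<sigma> * coef f ((l, h), reflect \<sigma> \<gamma>))"
      by (simp add: cls_wilson gL2 cinner_scaleC_right cinner_sum_right coef_def cinner_cls fL2)
    moreover have "(cmod (complex_of_real (sqrt (card (orbit G \<gamma>)) / 2 ^ k)))\<^sup>2 =
        card (orbit G \<gamma>) / (2 ^ k * 2 ^ k)"
      by (simp only: norm_of_real power2_abs power_divide real_sqrt_pow2 of_nat_0_le_iff)
        (simp add: power2_eq_square)
    ultimately show ?thesis
      by (simp only: norm_mult power_mult_distrib amplitude_def[OF f] prod.case snd_conv times_divide_eq_left)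
  qed
  have "((\<lambda>(p, \<gamma>). (card (orbit G \<gamma>) * amplitude f (p, \<gamma>)) / (2 ^ k * 2 ^ k)) has_sum
      (2 ^ k * E) / (2 ^ k * 2 ^ k)) ((UNIV \<times> G) \<times> N)"
    using has_sum_cmult_right[OF amplitude_transversal_has_sum[OF f], of "1 / (2 ^ k * 2 ^ k)"]
    by (simp add: E_def case_prod_unfold)
  then have "((\<lambda>x. ?cw ((\<lambda>((l, h), n). (l, h, n)) x)) has_sum E / 2 ^ k) ((UNIV \<times> G) \<times> N)"
    by (simp add: cw case_prod_unfold)
  then have "(?cw has_sum E / 2 ^ k) (UNIV \<times> G \<times> N)"
    by (subst (asm) has_sum_reindex_bij_betw[OF bij_assoc])
  \<comment> \<open>The removed members are zero in \<open>L2\<close> and carry no energy.\<close>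
  moreover have "(?cw has_sum E / 2 ^ k) (UNIV \<times> G \<times> N) \<longleftrightarrow>
      (?cw has_sum E / 2 ^ k) (wilson_index G k I \<rho> g N)"
  proof (intro has_sum_cong_neutral)
    fix j assume "j \<in> UNIV \<times> G \<times> N - wilson_index G k I \<rho> g N"
    then have "AE x in lborel. wilson G k I \<rho> g j x = 0" by (simp add: wilson_index_def)
    then have "cls (wilson G k I \<rho> g j) = 0"
      by (simp add: zero_L2_space_def cls_eq_iff wilson_L2 gL2)
    then show "?cw j = 0" by simp
  qed (auto simp: wilson_index_def)
  ultimately have ws: "(?cw has_sum E / 2 ^ k) (wilson_index G k I \<rho> g N)" by simp
  show "?cg summable_on gabor_index G" using gs by (rule has_sum_imp_summable)
  show "?cw summable_on wilson_index G k I \<rho> g N" using ws by (rule has_sum_imp_summable)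
  show "frame_energy (gabor_index G) (\<lambda>j. cls (gabor g j)) (cls f) =
      2 ^ k * frame_energy (wilson_index G k I \<rho> g N) (\<lambda>j. cls (wilson G k I \<rho> g j)) (cls f)"
    unfolding frame_energy_def infsumI[OF gs] infsumI[OF ws] by simp
qed

end

section \<open>Biorthogonality of the canonical dual window\<close>

lemma gabor_inner:
  assumes u: "u \<in> L2" and v: "v \<in> L2"
  shows "l2_inner (gabor u (l, \<alpha>)) (gabor v (l, \<beta>)) =
    (LINT x|lborel. wave (real_vec (\<alpha> - \<beta>)) x * (u x * cnj (v x)))"
proof -
  have "l2_inner (gabor u (l, \<alpha>)) (gabor v (l, \<beta>)) =
      (LINT x|lborel. gabor u (l, \<alpha>) (x + l) * cnj (gabor v (l, \<beta>) (x + l)))"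
    unfolding l2_inner_def
    by (rule integral_translate[symmetric]) (rule L2_mult_cnj_measurable[OF gabor_L2[OF u] gabor_L2[OF v]])
  then show ?thesis
    by (simp add: gabor_eq real_vec_diff wave_diff_left mult_ac)
qed

lemma gabor_unitary:
  "u \<in> L2 \<Longrightarrow> v \<in> L2 \<Longrightarrow> l2_inner (gabor u p) (gabor v p) = l2_inner u v"
  by (cases p) (simp only: gabor_inner, simp add: l2_inner_def real_vec_def vec_eq_iff zero_vec_def[symmetric])

text \<open>The composition law of time-frequency shifts: shifting by the difference first and by
  (m, \<alpha>) afterwards costs a unimodular phase.\<close>

lemma gabor_gabor:
  "gabor g (l, \<gamma>) = (\<lambda>x. cnj (wave (real_vec \<alpha>) (l - m)) * gabor (gabor g (l - m, \<gamma> - \<alpha>)) (m, \<alpha>) x)"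
proof
  fix x
  have w: "wave (real_vec \<alpha>) (x - m) = wave (real_vec \<alpha>) (x - l) * wave (real_vec \<alpha>) (l - m)"
    by (simp flip: wave_add_right)
  have "cnj (wave (real_vec \<alpha>) (l - m)) * gabor (gabor g (l - m, \<gamma> - \<alpha>)) (m, \<alpha>) x =
      (cnj (wave (real_vec \<alpha>) (l - m)) * wave (real_vec \<alpha>) (l - m)) *
      (wave (real_vec \<alpha>) (x - l) * cnj (wave (real_vec \<alpha>) (x - l))) * (wave (real_vec \<gamma>) (x - l) * g (x - l))"
    unfolding gabor_eq w by (simp add: real_vec_diff wave_diff_left mult_ac)
  also have "\<dots> = gabor g (l, \<gamma>) x" by (simp only: wave_mult_cnj mult_1 gabor_eq)
  finally show "gabor g (l, \<gamma>) x = cnj (wave (real_vec \<alpha>) (l - m)) * gabor (gabor g (l - m, \<gamma> - \<alpha>)) (m, \<alpha>) x"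
    by (rule sym)
qed

lemma gabor_surj:
  assumes "F \<in> L2"
  obtains v where "v \<in> L2" "F = gabor v (m, \<alpha>)"
proof
  have "(\<lambda>x. F (x + m)) \<in> L2" by (rule L2_translate[OF assms])
  then show "(\<lambda>x. cnj (wave (real_vec \<alpha>) x) * F (x + m)) \<in> L2"
    by (rule L2_bounded_mult[where C = 1]) auto
  show "F = gabor (\<lambda>x. cnj (wave (real_vec \<alpha>) x) * F (x + m)) (m, \<alpha>)"
    by (rule ext) (simp add: gabor_eq mult.assoc[symmetric])
qed

lemma cube_cell_AE: "AE x in lborel. indicator (ccube 1) (x + t) = (of_bool (cell (x + t) = 0) :: complex)"
proof -
  have "emeasure lborel (ccube 1 - ocube 1 :: (real ^ 'a) set) = 0"
    by (subst emeasure_Diff) (auto simp: emeasure_lborel_cbox_eq emeasure_lborel_box_eq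
        intro: subsetD[OF box_subset_cbox])
  then have "AE x in (lborel :: (real ^ 'a) measure). x \<notin> ccube 1 - ocube 1"
    by (intro AE_not_in) (auto simp: null_sets_def)
  then have "AE x in (lborel :: (real ^ 'a) measure). indicator (ccube 1) x = (of_bool (cell x = 0) :: complex)"
  proof eventually_elim
    fix x :: "real ^ 'a" assume x: "x \<notin> ccube 1 - ocube 1"
    show "indicator (ccube 1) x = (of_bool (cell x = 0) :: complex)"
    proof (cases "cell x = 0")
      case True
      then show ?thesis using cell_in_ccube[of x] by (simp add: indicator_def)
    next
      case False
      have "x \<notin> ocube 1"
      proof
        assume o: "x \<in> ocube 1"
        have "cell x $ i = 0" for i
        proof -
          have "- 1 / 2 < x $ i" "x $ i < 1 / 2" using o by (simp_all add: mem_box_cart)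
          then show ?thesis by (simp add: cell_def floor_eq_iff)
        qed
        with False show False by (simp add: vec_eq_iff)
      qed
      with x False show ?thesis by (simp add: indicator_def)
    qed
  qed
  from AE_translate[OF this, of t] show ?thesis .
qed

text \<open>The translated cubes tile space up to null sets, so growing boxes of translations
  exhaust it, and dominated convergence applies to this sequence of boxes.\<close>

lemma tiling_limit:
  fixes W :: "real ^ 'd \<Rightarrow> complex"
  assumes W: "integrable lborel W"
  shows "(\<lambda>m. \<Sum>l\<in>{l :: int ^ 'd. \<forall>i. \<bar>l $ i\<bar> \<le> int m}. LINT x|lborel. indicator (ccube 1) (x + (real_vec l + t)) * W x)
    \<longlonglongrightarrow> (LINT x|lborel. W x)"
proof -
  define A where "A m = {l :: int ^ 'd. \<forall>i. \<bar>l $ i\<bar> \<le> int m}" for m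
  have A: "finite (A m)" for m unfolding A_def by (rule finite_int_box)
  have [measurable]: "W \<in> borel_measurable borel" using borel_measurable_integrable[OF W] by simp
  have ccm: "(\<lambda>x :: real ^ 'd. indicator (ccube 1) (x + c) :: complex) \<in> borel_measurable borel" for c
    by (rule measurable_translate) simp
  have i: "integrable lborel (\<lambda>x. indicator (ccube 1) (x + (real_vec l + t)) * W x)" for l :: "int ^ 'd"
    using integrable_bounded_mult[OF W ccm[of "real_vec l + t"], of 1]
    by (simp add: indicator_def mult.commute)
  have AE: "AE x in lborel. (\<Sum>l\<in>A m. indicator (ccube 1) (x + (real_vec l + t)) * W x) =
      of_bool (- cell (x + t) \<in> A m) * W x" for m
  proof -
    have "AE x in lborel. \<forall>l\<in>A m. indicator (ccube 1) (x + (real_vec l + t)) = (of_bool (cell (x + (real_vec l + t)) = 0) :: complex)"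
      by (intro AE_ball_countable' cube_cell_AE countable_finite A)
    then show ?thesis
    proof eventually_elim
      case (elim x)
      have c: "cell (x + (real_vec l + t)) = 0 \<longleftrightarrow> l = - cell (x + t)" for l
        using cell_add_int[of "x + t" l] by (simp add: add_ac eq_neg_iff_add_eq_0)
      have "(\<Sum>l\<in>A m. indicator (ccube 1) (x + (real_vec l + t)) * W x) =
          (\<Sum>l\<in>A m. if l = - cell (x + t) then W x else 0)"
        using elim by (intro sum.cong refl) (simp add: c)
      then show ?case using A by simp
    qed
  qed
  have "(\<lambda>m. LINT x|lborel. (\<Sum>l\<in>A m. indicator (ccube 1) (x + (real_vec l + t)) * W x)) \<longlonglongrightarrow> (LINT x|lborel. W x)"
  proof (rule integral_dominated_convergence[where w = "\<lambda>x. cmod (W x)"])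
    have "AE x in lborel. \<forall>m. (\<Sum>l\<in>A m. indicator (ccube 1) (x + (real_vec l + t)) * W x) =
        of_bool (- cell (x + t) \<in> A m) * W x"
      using AE by (simp add: AE_all_countable)
    then show "AE x in lborel. (\<lambda>m. \<Sum>l\<in>A m. indicator (ccube 1) (x + (real_vec l + t)) * W x) \<longlonglongrightarrow> W x"
    proof eventually_elim
      case (elim x)
      have "\<forall>\<^sub>F m in sequentially. \<forall>i. \<bar>(- cell (x + t)) $ i\<bar> \<le> int m"
      proof -
        have "\<forall>\<^sub>F m in sequentially. \<bar>(- cell (x + t)) $ i\<bar> \<le> int m" for i
          using eventually_ge_at_top[of "nat \<bar>(- cell (x + t)) $ i\<bar>"] by eventually_elim linarith
        then show ?thesis by (rule eventually_all_finite)
      qed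
      then show ?case
        unfolding elim[rule_format]
        by (intro tendsto_eventually) (auto simp: A_def elim!: eventually_mono)
    qed
    show "AE x in lborel. norm (\<Sum>l\<in>A m. indicator (ccube 1) (x + (real_vec l + t)) * W x) \<le> cmod (W x)" for m
      using AE[of m] by eventually_elim (simp add: norm_mult)
    show "(\<lambda>x. \<Sum>l\<in>A m. indicator (ccube 1) (x + (real_vec l + t)) * W x) \<in> borel_measurable lborel" for m
      using borel_measurable_integrable[OF i] by (intro borel_measurable_sum)
  qed (use W in auto)
  moreover have "(LINT x|lborel. (\<Sum>l\<in>A m. indicator (ccube 1) (x + (real_vec l + t)) * W x)) =
      (\<Sum>l\<in>A m. LINT x|lborel. indicator (ccube 1) (x + (real_vec l + t)) * W x)" for m
    by (rule Bochner_Integration.integral_sum) (rule i)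
  ultimately show ?thesis by (simp add: A_def)
qed

section \<open>The canonical dual window\<close>

context wilson_system
begin

abbreviation "JG \<equiv> gabor_index G"
abbreviation "JW \<equiv> wilson_index G k I \<rho> g N"
abbreviation "gab u j \<equiv> cls (gabor u j)"
abbreviation "wil u j \<equiv> cls (wilson G k I \<rho> u j)"

text \<open>Half the lattice is a group; the correction terms are the borrow and the carry between
  the half-integer and the integer parts.\<close>

lemma half_shift_diff:
  assumes "h \<in> G" "h' \<in> G"
  shows "\<exists>m. half_shift l h - half_shift l' h' = half_shift m (h + h')"
    "\<exists>m. half_shift l h + half_shift l' h' = half_shift m (h + h')"
proof -
  have "half_shift l h - half_shift l' h' =
      half_shift (\<chi> j. l $ j - l' $ j - (if h $ j = 0 \<and> h' $ j = 1 then 1 else 0)) (h + h')"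
  proof (rule vec_eq_iff[THEN iffD2, rule_format])
    fix j show "(half_shift l h - half_shift l' h') $ j =
        half_shift (\<chi> j. l $ j - l' $ j - (if h $ j = 0 \<and> h' $ j = 1 then 1 else 0)) (h + h') $ j"
      by (cases "h $ j"; cases "h' $ j") (simp_all add: half_shift_nth)
  qed
  then show "\<exists>m. half_shift l h - half_shift l' h' = half_shift m (h + h')" by blast
  have "half_shift l h + half_shift l' h' =
      half_shift (\<chi> j. l $ j + l' $ j + (if h $ j = 1 \<and> h' $ j = 1 then 1 else 0)) (h + h')"
  proof (rule vec_eq_iff[THEN iffD2, rule_format])
    fix j show "(half_shift l h + half_shift l' h') $ j =
        half_shift (\<chi> j. l $ j + l' $ j + (if h $ j = 1 \<and> h' $ j = 1 then 1 else 0)) (h + h') $ j"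
      by (cases "h $ j"; cases "h' $ j") (simp_all add: half_shift_nth)
  qed
  then show "\<exists>m. half_shift l h + half_shift l' h' = half_shift m (h + h')" by blast
qed

lemma gabor_index_iff: "(m, \<alpha>) \<in> JG \<longleftrightarrow> (\<exists>l h. h \<in> G \<and> m = half_shift l h)"
  unfolding bij_betw_imp_surj_on[OF gabor_index_bij, symmetric] by (force simp: image_iff)

lemma gabor_index_shift:
  assumes "h \<in> G"
  shows "bij_betw (\<lambda>(m, \<gamma>). (m - half_shift l h, \<gamma> - \<alpha>)) JG JG"
proof (rule bij_betw_byWitness[where f' = "\<lambda>(m, \<gamma>). (m + half_shift l h, \<gamma> + \<alpha>)"])
  show "(\<lambda>(m, \<gamma>). (m - half_shift l h, \<gamma> - \<alpha>)) ` JG \<subseteq> JG"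
  proof clarify
    fix m \<gamma> assume "(m, \<gamma>) \<in> JG"
    then obtain l' h' where "h' \<in> G" "m = half_shift l' h'" unfolding gabor_index_iff by blast
    then show "(m - half_shift l h, \<gamma> - \<alpha>) \<in> JG"
      unfolding gabor_index_iff using half_shift_diff(1)[OF \<open>h' \<in> G\<close> assms] add_G[OF _ assms] by blast
  qed
  show "(\<lambda>(m, \<gamma>). (m + half_shift l h, \<gamma> + \<alpha>)) ` JG \<subseteq> JG"
  proof clarify
    fix m \<gamma> assume "(m, \<gamma>) \<in> JG"
    then obtain l' h' where "h' \<in> G" "m = half_shift l' h'" unfolding gabor_index_iff by blast
    then show "(m + half_shift l h, \<gamma> + \<alpha>) \<in> JG"
      unfolding gabor_index_iff using half_shift_diff(2)[OF \<open>h' \<in> G\<close> assms] add_G[OF _ assms] by blast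
  qed
qed auto

context
  fixes a b :: real and v :: "real ^ 'd \<Rightarrow> complex"
  assumes B: "bessel JG (gab g) b" "0 \<le> b" and a: "0 < a"
    and lower: "\<And>x. a * (norm x)\<^sup>2 \<le> frame_energy JG (gab g) x"
    and v: "v \<in> L2" and Sv: "frame_op JG (gab g) (cls v) = cls g"
begin

text \<open>Shifts with parameters in \<open>JG\<close> permute the Gabor system up to phases. A
  phase cancels in every rank-one term of the frame operator, which therefore commutes with these
  shifts.\<close>

lemma frame_op_dual_atom:
  assumes h: "h \<in> G"
  shows "frame_op JG (gab g) (gab v (half_shift l h, \<alpha>)) = gab g (half_shift l h, \<alpha>)"
proof (rule cinner_ext)
  fix y :: "(real ^ 'd) L2_space"
  define m where "m = half_shift l h"
  obtain F where F: "F \<in> L2" "y = cls F" by (rule L2_space_cases)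
  obtain w where w: "w \<in> L2" "F = gabor w (m, \<alpha>)" by (rule gabor_surj[OF F(1)])
  define sh where "sh = (\<lambda>(l :: real ^ 'd, \<gamma> :: int ^ 'd). (l - m, \<gamma> - \<alpha>))"
  have atom: "cinner (gab v (m, \<alpha>)) (gab g j) * cinner (gab g j) (cls F) =
      cinner (cls v) (gab g (sh j)) * cinner (gab g (sh j)) (cls w)" for j
  proof -
    obtain l \<gamma> where j: "j = (l, \<gamma>)" by (cases j)
    define c where "c = wave (real_vec \<alpha>) (l - m)"
    have gj: "gab g j = cnj c *\<^sub>C cls (gabor (gabor g (sh j)) (m, \<alpha>))"
      unfolding j c_def sh_def prod.case
      by (subst gabor_gabor[of g l \<gamma> \<alpha> m]) (simp add: cls_scaleC gL2)
    have 1: "cinner (gab u (m, \<alpha>)) (gab g j) = c * cinner (cls u) (gab g (sh j))" if "u \<in> L2" for u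
      unfolding gj using that by (simp add: cinner_scaleC_right cinner_cls gL2 gabor_unitary)
    have "cinner (gab g j) (cls F) = cnj (c * cinner (cls w) (gab g (sh j)))"
      using 1[OF w(1)] w(2) by (metis cnj_cinner)
    then have 2: "cinner (gab g j) (cls F) = cnj c * cinner (gab g (sh j)) (cls w)"
      by (simp only: complex_cnj_mult cnj_cinner)
    show ?thesis
      unfolding 1[OF v] 2 using wave_mult_cnj(1)[of "real_vec \<alpha>" "l - m"]
      by (simp add: c_def mult_ac)
  qed
  have "((\<lambda>j. cinner (cls v) (gab g j) * cinner (gab g j) (cls w)) has_sum cinner (cls g) (cls w)) JG"
    using frame_op_form[OF B, of "cls v" "cls w"] by (simp add: Sv)
  then have "((\<lambda>j. cinner (cls v) (gab g (sh j)) * cinner (gab g (sh j)) (cls w)) has_sum cinner (cls g) (cls w)) JG"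
    using has_sum_reindex_bij_betw[OF gabor_index_shift[OF h, of l \<alpha>],
        of "\<lambda>j. cinner (cls v) (gab g j) * cinner (gab g j) (cls w)"]
    unfolding sh_def m_def by blast
  then have "((\<lambda>j. cinner (gab v (m, \<alpha>)) (gab g j) * cinner (gab g j) (cls F)) has_sum cinner (cls g) (cls w)) JG"
    by (simp only: atom)
  then have "cinner (frame_op JG (gab g) (gab v (m, \<alpha>))) (cls F) = cinner (cls g) (cls w)"
    using has_sum_unique[OF frame_op_form[OF B]] by blast
  also have "\<dots> = cinner (gab g (m, \<alpha>)) (cls F)"
    unfolding w(2) by (simp add: cinner_cls gL2 w gabor_unitary)
  finally show "cinner (frame_op JG (gab g) (gab v (half_shift l h, \<alpha>))) y = cinner (gab g (half_shift l h, \<alpha>)) y"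
    by (simp add: F m_def)
qed

text \<open>
  The reconstruction formula, tested against a character of the unit cube and the indicator of the
  cube, determines the Fourier coefficients of \<open>v \<cdot> cnj g\<close> that matter.
\<close>

lemma dual_window_coef:
  assumes \<delta>: "\<And>\<sigma>. \<sigma> \<in> G \<Longrightarrow> chi \<delta> \<sigma> = 1"
  shows "(LINT x|lborel. wave (real_vec \<delta>) x * (g x * cnj (v x))) = of_bool (\<delta> = 0) / 2 ^ k"
proof -
  let ?f1 = "cube_wave \<delta> :: real ^ 'd \<Rightarrow> complex" and ?f2 = "cube_wave 0 :: real ^ 'd \<Rightarrow> complex"
  define W where "W x = wave (real_vec \<delta>) x * (g x * cnj (v x))" for x
  have Wi: "integrable lborel W"
    using integrable_bounded_mult[OF L2_inner_integrable[OF gL2 v], of "wave (real_vec \<delta>)" 1]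
    by (simp add: W_def[abs_def] mult.commute)
  \<comment> \<open>Moving the frame operator across the inner product turns the coefficients of
    \<open>x\<close> against \<open>g\<close> into those of the first test function against the dual
    window.\<close>
  obtain x where x: "frame_op JG (gab g) x = cls ?f1"
    using frame_op_surj[OF B a lower] by blast
  have "((\<lambda>j. cinner x (gab g j) * cinner (gab g j) (cls ?f2)) has_sum cinner (cls ?f1) (cls ?f2)) JG"
    using frame_op_form[OF B, of x "cls ?f2"] by (simp add: x)
  then have "((\<lambda>q. (\<lambda>j. cinner x (gab g j) * cinner (gab g j) (cls ?f2)) ((\<lambda>((l, h), \<gamma>). (half_shift l h, \<gamma>)) q))
      has_sum of_bool (\<delta> = 0)) ((UNIV \<times> G) \<times> UNIV)"
    by (subst has_sum_reindex_bij_betw[OF gabor_index_bij]) (simp add: cinner_cls cube_wave_inner)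
  moreover have "(\<lambda>j. cinner x (gab g j) * cinner (gab g j) (cls ?f2)) ((\<lambda>((l, h), \<gamma>). (half_shift l h, \<gamma>)) (p, \<gamma>)) =
      fcoef (window_product ?f1 v (half_shift (fst p) (snd p))) \<gamma> *
      cnj (fcoef (window_product ?f2 g (half_shift (fst p) (snd p))) \<gamma>)"
    if p: "p \<in> UNIV \<times> G" for p \<gamma>
  proof -
    define m where "m = half_shift (fst p) (snd p)"
    have "cinner x (gab g (m, \<gamma>)) = cinner x (frame_op JG (gab g) (gab v (m, \<gamma>)))"
      using p frame_op_dual_atom[of "snd p" "fst p" \<gamma>] by (auto simp: m_def)
    also have "\<dots> = cinner (cls ?f1) (gab v (m, \<gamma>))"
      by (simp add: frame_op_selfadjoint[OF B, symmetric] x)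
    also have "\<dots> = fcoef (window_product ?f1 v m) \<gamma>"
      by (simp add: cinner_cls v gabor_coef)
    finally have 1: "cinner x (gab g (m, \<gamma>)) = fcoef (window_product ?f1 v m) \<gamma>" .
    have "cinner (gab g (m, \<gamma>)) (cls ?f2) = cnj (cinner (cls ?f2) (gab g (m, \<gamma>)))"
      by (simp add: cnj_cinner)
    also have "\<dots> = cnj (fcoef (window_product ?f2 g m) \<gamma>)"
      by (simp add: cinner_cls gL2 gabor_coef)
    finally show ?thesis using 1 by (simp add: case_prod_unfold m_def)
  qed
  ultimately have tot: "((\<lambda>(p, \<gamma>). fcoef (window_product ?f1 v (half_shift (fst p) (snd p))) \<gamma> *
      cnj (fcoef (window_product ?f2 g (half_shift (fst p) (snd p))) \<gamma>)) has_sum of_bool (\<delta> = 0)) ((UNIV \<times> G) \<times> UNIV)"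
    by (subst has_sum_cong) auto
  define J where "J p = (LINT x|lborel. indicator (ccube 1) (x + half_shift (fst p) (snd p)) * W x)" for p
  have "((\<lambda>\<gamma>. fcoef (window_product ?f1 v (half_shift (fst p) (snd p))) \<gamma> *
      cnj (fcoef (window_product ?f2 g (half_shift (fst p) (snd p))) \<gamma>)) has_sum J p) UNIV"
    if p: "p \<in> UNIV \<times> G" for p
  proof -
    define m where "m = half_shift (fst p) (snd p)"
    \<comment> \<open>Both products live on the same translate of the unit cube, so
      \<open>parseval_translated_cube\<close> expresses the series in the frequency by a single
      integral.\<close>
    have sup: "window_product (cube_wave \<epsilon>) u m x = 0" if "x - (- m) \<notin> ccube 1" for \<epsilon> u x
      using that by (simp add: window_product_def cube_wave_def)
    have "((\<lambda>\<gamma>. fcoef (window_product ?f1 v m) \<gamma> * cnj (fcoef (window_product ?f2 g m) \<gamma>)) has_sum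
        l2_inner (window_product ?f1 v m) (window_product ?f2 g m)) UNIV"
      by (rule parseval_translated_cube[OF
            window_product_test[OF test_fun_cube_wave v] sup window_product_test[OF test_fun_cube_wave gL2] sup])
    \<comment> \<open>Here the hypothesis on \<delta> enters: the half-integer part of the
      translation contributes the sign of \<delta> at an element of \<open>G\<close>.\<close>
    moreover have "wave (real_vec \<delta>) m = 1"
      using p \<delta>[of "snd p"] by (auto simp: m_def half_shift_def wave_add_right wave_half_bit
          wave_of_int real_vec_inner_Ints)
    then have "l2_inner (window_product ?f1 v m) (window_product ?f2 g m) = J p"
      unfolding l2_inner_def J_def m_def[symmetric]
      by (intro Bochner_Integration.integral_cong refl)
        (simp add: window_product_def cube_wave_def W_def wave_add_right indicator_def mult_ac)
    ultimately show ?thesis by (simp add: m_def)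
  qed
  from has_sum_SigmaD[OF tot, of J] this
  have Jsum: "(J has_sum of_bool (\<delta> = 0)) (UNIV \<times> G)" by simp
  \<comment> \<open>These boxes eventually contain every finite set of translations, so the series
    may be evaluated along them, where \<open>tiling_limit\<close> gives the value.\<close>
  define A where "A m = {l :: int ^ 'd. \<forall>i. \<bar>l $ i\<bar> \<le> int m}" for m
  have "filterlim (\<lambda>m. A m \<times> G) (finite_subsets_at_top (UNIV \<times> G)) sequentially"
    unfolding filterlim_finite_subsets_at_top
  proof (intro allI impI)
    fix X :: "((int ^ 'd) \<times> (bit ^ 'd)) set" assume X: "finite X \<and> X \<subseteq> UNIV \<times> G"
    have "\<forall>\<^sub>F m in sequentially. \<forall>p\<in>X. \<forall>i. \<bar>fst p $ i\<bar> \<le> int m"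
    proof (intro eventually_ball_finite ballI)
      show "\<forall>\<^sub>F m in sequentially. \<forall>i. \<bar>fst p $ i\<bar> \<le> int m" for p :: "(int ^ 'd) \<times> (bit ^ 'd)"
      proof (rule eventually_all_finite)
        show "\<forall>\<^sub>F m in sequentially. \<bar>fst p $ i\<bar> \<le> int m" for i
          using eventually_ge_at_top[of "nat \<bar>fst p $ i\<bar>"] by eventually_elim linarith
      qed
    qed (use X in auto)
    then show "\<forall>\<^sub>F m in sequentially. finite (A m \<times> G) \<and> X \<subseteq> A m \<times> G \<and> A m \<times> G \<subseteq> UNIV \<times> G"
    proof eventually_elim
      case (elim m)
      then have "X \<subseteq> A m \<times> G" using X by (auto simp: A_def)
      then show ?case using finite_G finite_int_box[of "int m"] by (auto simp: A_def)
    qed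
  qed
  from filterlim_compose[OF Jsum[unfolded has_sum_def] this]
  have "(\<lambda>m. sum J (A m \<times> G)) \<longlonglongrightarrow> of_bool (\<delta> = 0)" .
  moreover have "(\<lambda>m. sum J (A m \<times> G)) \<longlonglongrightarrow> (\<Sum>h\<in>G. LINT x|lborel. W x)"
  proof -
    have "sum J (A m \<times> G) = (\<Sum>h\<in>G. \<Sum>l\<in>A m. LINT x|lborel.
        indicator (ccube 1) (x + (real_vec l + (1/2) *\<^sub>R real_vec (bit_rep h))) * W x)" for m
      by (subst sum.swap) (simp add: sum.cartesian_product J_def half_shift_def case_prod_unfold)
    then show ?thesis
      unfolding A_def by (simp only:) (intro tendsto_sum tiling_limit Wi)
  qed
  \<comment> \<open>Each of the 2^k classes h tiles space once and contributes the full
    integral.\<close>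
  ultimately have "(\<Sum>h\<in>G. LINT x|lborel. W x) = of_bool (\<delta> = 0)" by (rule LIMSEQ_unique[rotated])
  then have "2 ^ k * (LINT x|lborel. W x) = of_bool (\<delta> = 0)" by (simp add: card_G)
  then show ?thesis by (simp add: W_def field_simps)
qed

text \<open>The frequency difference of two reflections of \<gamma> has trivial character by
  \<open>chi_reflect\<close>, so it is one of the frequencies at which
  \<open>dual_window_coef\<close> applies.\<close>

lemma dual_atom_inner:
  assumes "\<sigma> \<in> G" "\<tau> \<in> G"
  shows "cinner (gab v (m, reflect \<sigma> \<gamma>)) (gab g (m, reflect \<tau> \<gamma>)) =
    of_bool (reflect (\<sigma> + \<tau>) \<gamma> = \<gamma>) / 2 ^ k"
proof -
  define \<delta> where "\<delta> = reflect \<tau> \<gamma> - reflect \<sigma> \<gamma>"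
  have "chi \<delta> h * chi (reflect \<sigma> \<gamma>) h = chi (reflect \<tau> \<gamma>) h" for h
    by (simp add: \<delta>_def flip: chi_add_left)
  then have "chi \<delta> h = 1" for h
    by (metis chi_mult_self chi_reflect mult.assoc mult.right_neutral)
  then have "l2_inner (gabor g (m, reflect \<tau> \<gamma>)) (gabor v (m, reflect \<sigma> \<gamma>)) = of_bool (\<delta> = 0) / 2 ^ k"
    unfolding gabor_inner[OF gL2 v] \<delta>_def[symmetric] by (rule dual_window_coef)
  moreover have "\<delta> = 0 \<longleftrightarrow> reflect (\<sigma> + \<tau>) \<gamma> = \<gamma>"
    unfolding \<delta>_def reflect_add by (metis eq_iff_diff_eq_0 reflect_reflect)
  ultimately have "cinner (gab g (m, reflect \<tau> \<gamma>)) (gab v (m, reflect \<sigma> \<gamma>)) =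
      of_bool (reflect (\<sigma> + \<tau>) \<gamma> = \<gamma>) / 2 ^ k"
    by (simp add: cinner_cls gL2 v)
  then have "cnj (cinner (gab g (m, reflect \<tau> \<gamma>)) (gab v (m, reflect \<sigma> \<gamma>))) =
      of_bool (reflect (\<sigma> + \<tau>) \<gamma> = \<gamma>) / 2 ^ k" by simp
  then show ?thesis by (simp only: cnj_cinner)
qed

text \<open>The double sum over \<open>G\<close> depends on \<sigma> + \<tau> only and reduces to
  the character sum over the stabilizer, counted 2^k times. That sum is 0 or the stabilizer size,
  and orbit length times stabilizer size is 2^k, which the powers of 2 in the normalisation
  cancel.\<close>

lemma dual_wilson_inner:
  "2 ^ k * cinner (wil v (l, h, \<gamma>)) (wil g (l, h, \<gamma>)) \<in> {0, 1}"
proof -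
  define c where "c = complex_of_real (sqrt (card (orbit G \<gamma>)) / 2 ^ k)"
  define St where "St = stabilizer G \<gamma>"
  have cc: "c * cnj c = of_nat (card (orbit G \<gamma>)) / (2 ^ k * 2 ^ k)"
    by (simp add: c_def flip: of_real_mult)
  have orb: "of_nat (card (orbit G \<gamma>)) * of_nat (card St) = (2 ^ k :: complex)"
    using arg_cong[OF card_orbit_stabilizer[OF sep iso rep, of \<gamma>], of of_nat] by (simp add: St_def)
  have "cinner (wil v (l, h, \<gamma>)) (wil g (l, h, \<gamma>)) = c * cnj c *
      (\<Sum>\<sigma>\<in>G. \<Sum>\<tau>\<in>G. sgn_char h \<gamma> \<sigma> * (sgn_char h \<gamma> \<tau> *
        cinner (gab v (half_shift l h, reflect \<sigma> \<gamma>)) (gab g (half_shift l h, reflect \<tau> \<gamma>))))"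
    unfolding cls_wilson[OF v] cls_wilson[OF gL2] c_def[symmetric]
    by (simp add: cinner_scaleC_left cinner_scaleC_right cinner_sum_left cinner_sum_right
        sum_distrib_left mult_ac) (subst sum.swap, simp add: mult_ac)
  also have "(\<Sum>\<sigma>\<in>G. \<Sum>\<tau>\<in>G. sgn_char h \<gamma> \<sigma> * (sgn_char h \<gamma> \<tau> *
        cinner (gab v (half_shift l h, reflect \<sigma> \<gamma>)) (gab g (half_shift l h, reflect \<tau> \<gamma>)))) =
      (\<Sum>\<sigma>\<in>G. \<Sum>\<tau>\<in>G. sgn_char h \<gamma> (\<sigma> + \<tau>) * of_bool (reflect (\<sigma> + \<tau>) \<gamma> = \<gamma>) / 2 ^ k)"
    by (intro sum.cong refl) (simp add: dual_atom_inner chi_add_right mult.assoc)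
  also have "\<dots> = (\<Sum>\<sigma>\<in>G. \<Sum>\<tau>\<in>G. sgn_char h \<gamma> \<tau> * of_bool (reflect \<tau> \<gamma> = \<gamma>) / 2 ^ k)"
    by (intro sum.cong refl sum_shift_G)
  also have "(\<Sum>\<tau>\<in>G. sgn_char h \<gamma> \<tau> * of_bool (reflect \<tau> \<gamma> = \<gamma>) / 2 ^ k) = (\<Sum>\<tau>\<in>St. sgn_char h \<gamma> \<tau>) / 2 ^ k"
    unfolding sum_divide_distrib St_def
    using finite_G by (intro sum.mono_neutral_cong_right) (auto simp: stabilizer_def[OF sep iso rep])
  finally have eq: "2 ^ k * cinner (wil v (l, h, \<gamma>)) (wil g (l, h, \<gamma>)) =
      of_nat (card (orbit G \<gamma>)) * (\<Sum>\<tau>\<in>St. sgn_char h \<gamma> \<tau>) / 2 ^ k"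
    by (simp add: cc card_G)
  then show ?thesis
    using sum_chi_stabilizer[OF sep iso rep, of "\<rho> (I h) + \<gamma>" \<gamma>] orb
    by (auto simp: St_def[symmetric])
qed

end

section \<open>Transfer between the two systems\<close>

lemma energy_on_dense:
  assumes "x \<in> cls ` {f. test_fun f}"
  shows "(\<lambda>j. (cmod (cinner x (gab g j)))\<^sup>2) summable_on JG"
    "(\<lambda>j. (cmod (cinner x (wil g j)))\<^sup>2) summable_on JW"
    "frame_energy JG (gab g) x = 2 ^ k * frame_energy JW (wil g) x"
  using assms energy_identity by auto

lemma bessel_equiv: "bessel JG (gab g) b \<longleftrightarrow> bessel JW (wil g) (b / 2 ^ k)"
proof
  assume "bessel JG (gab g) b"
  then show "bessel JW (wil g) (b / 2 ^ k)"
    by (rule bessel_transfer[OF closure_test_fun]) (simp_all add: energy_on_dense)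
next
  assume "bessel JW (wil g) (b / 2 ^ k)"
  then have "bessel JG (gab g) (b / 2 ^ k / (1 / 2 ^ k))"
    by (rule bessel_transfer[OF closure_test_fun]) (simp_all add: energy_on_dense)
  then show "bessel JG (gab g) b" by simp
qed

text \<open>The Bessel bounds in the theorem are arbitrary reals; a negative one is excluded because
  the indicator of the unit cube has norm 1.\<close>

lemma bessel_nonneg:
  assumes "bessel J (\<phi> :: 'j \<Rightarrow> (real ^ 'd) L2_space) b"
  shows "0 \<le> b"
proof -
  have "inner (cls (cube_wave 0 :: real ^ 'd \<Rightarrow> complex)) (cls (cube_wave 0)) = 1"
    by (simp add: inner_cls cube_wave_inner)
  then have "(norm (cls (cube_wave 0 :: real ^ 'd \<Rightarrow> complex)))\<^sup>2 = 1"
    by (simp add: power2_norm_eq_inner)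
  then show ?thesis
    using besselD[OF assms, of "{}" "cls (cube_wave 0)"] by simp
qed

lemma energy_eq:
  assumes "bessel JG (gab g) b"
  shows "frame_energy JG (gab g) x = 2 ^ k * frame_energy JW (wil g) x"
proof -
  have W: "bessel JW (wil g) (b / 2 ^ k)" using assms bessel_equiv by blast
  show ?thesis
    by (rule frame_energy_eq_of_dense[OF closure_test_fun assms bessel_nonneg[OF assms] W bessel_nonneg[OF W]])
      (rule energy_on_dense)
qed

lemma frame_op_eq:
  assumes "bessel JG (gab g) b"
  shows "frame_op JG (gab g) x = 2 ^ k *\<^sub>R frame_op JW (wil g) x"
proof -
  have W: "bessel JW (wil g) (b / 2 ^ k)" using assms bessel_equiv by blast
  show ?thesis
    by (rule frame_op_eq_of_energy[OF assms bessel_nonneg[OF assms] W bessel_nonneg[OF W]])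
      (rule energy_eq[OF assms])
qed

lemma frame_imp_wilson_riesz:
  assumes B: "bessel JG (gab g) b" and a: "0 < a"
    and lower: "\<And>x. a * (norm x)\<^sup>2 \<le> frame_energy JG (gab g) x"
  shows "dense_in JW (wil g)" "riesz_seq JW (wil g) (a / 2 ^ k) (b / 2 ^ k)"
proof -
  note b0 = bessel_nonneg[OF B]
  have W: "bessel JW (wil g) (b / 2 ^ k)" using B bessel_equiv by blast
  note W0 = bessel_nonneg[OF W]
  have a': "0 < a / 2 ^ k" using a by simp
  have lower': "a / 2 ^ k * (norm x)\<^sup>2 \<le> frame_energy JW (wil g) x" for x
    using lower[of x] energy_eq[OF B, of x] by (simp add: field_simps)
  obtain y where y: "frame_op JG (gab g) y = cls g" using frame_op_surj[OF B b0 a lower] by blast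
  obtain v where v: "v \<in> L2" "y = cls v" by (rule L2_space_cases)
  note Sv = y[unfolded v(2)]
  \<comment> \<open>The factor 2^k undoes the ratio of the two frame operators, so that
    \<open>u j\<close> becomes the preimage of \<open>wil g j\<close> under the Wilson one.\<close>
  define u where "u j = (2 ^ k :: real) *\<^sub>R wil v j" for j
  have Su: "frame_op JW (wil g) (u (l, h, \<gamma>)) = wil g (l, h, \<gamma>)" if h: "h \<in> G" for l h \<gamma>
  proof -
    let ?S = "frame_op JG (gab g)"
    have lin: "linear ?S" by (rule bounded_linear.linear[OF frame_op_bounded_linear[OF B b0]])
    have "frame_op JW (wil g) (u (l, h, \<gamma>)) = ?S (wil v (l, h, \<gamma>))"
      unfolding u_def frame_op_eq[OF B]
      using bounded_linear.linear[OF frame_op_bounded_linear[OF W W0]] by (simp add: linear_cmul)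
    also have "\<dots> = wil g (l, h, \<gamma>)"
      unfolding cls_wilson[OF v(1)] cls_wilson[OF gL2]
      by (simp add: frame_op_scaleC[OF B b0] linear_sum[OF lin]
          frame_op_dual_atom[OF B b0 a lower v(1) Sv h])
    finally show ?thesis .
  qed
  have uj: "frame_op JW (wil g) (u j) = wil g j \<and> cinner (u j) (wil g j) = 1" if j: "j \<in> JW" for j
  proof -
    obtain l h \<gamma> where lh: "j = (l, h, \<gamma>)" by (cases j)
    have h: "h \<in> G" using j by (simp add: lh wilson_index_def)
    have nz: "wil g j \<noteq> 0"
      using j by (simp add: wilson_index_def zero_L2_space_def cls_eq_iff wilson_L2 gL2)
    have S: "frame_op JW (wil g) (u j) = wil g j" using Su[OF h] by (simp add: lh)
    have "cinner (u j) (wil g j) \<in> {0, 1}"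
      using dual_wilson_inner[OF B b0 a lower v(1) Sv, of l h \<gamma>]
      by (simp add: u_def lh cinner_scaleR_left)
    \<comment> \<open>This inner product is the Wilson energy of \<open>u j\<close>. If it were 0,
      the lower bound would give u j = 0 and then a zero member, which the index set
      excludes.\<close>
    moreover have "cinner (u j) (wil g j) \<noteq> 0"
    proof
      assume "cinner (u j) (wil g j) = 0"
      then have "cinner (wil g j) (u j) = 0" by (metis cnj_cinner complex_cnj_zero)
      then have "frame_energy JW (wil g) (u j) = 0"
        using frame_op_energy[OF W W0, of "u j"] by (simp add: S)
      then have "a / 2 ^ k * (norm (u j))\<^sup>2 \<le> 0" using lower'[of "u j"] by simp
      then have "\<not> 0 < (norm (u j))\<^sup>2" using mult_pos_pos[OF a', of "(norm (u j))\<^sup>2"] by linarith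
      then have "u j = 0" by simp
      then have "wil g j = 0"
        using S bounded_linear.linear[OF frame_op_bounded_linear[OF W W0]] by (simp add: linear_0)
      with nz show False by simp
    qed
    ultimately show ?thesis using S by simp
  qed
  show "dense_in JW (wil g)"
    by (rule frame_imp_riesz(1)[OF W W0 a' lower', of u]) (use uj in auto)
  show "riesz_seq JW (wil g) (a / 2 ^ k) (b / 2 ^ k)"
    by (rule frame_imp_riesz(2)[OF W W0 a' lower', of u]) (use uj in auto)
qed

lemma frame_equiv:
  "frame_bounds JG (gabor g) a b \<longleftrightarrow>
     riesz_basis_bounds JW (wilson G k I \<rho> g) (a / 2 ^ k) (b / 2 ^ k)"
proof
  assume "frame_bounds JG (gabor g) a b"
  then have "0 < a" "0 < b" "bessel JG (gab g) b" "\<And>x. a * (norm x)\<^sup>2 \<le> frame_energy JG (gab g) x"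
    by (auto simp: frame_bounds_iff)
  then show "riesz_basis_bounds JW (wilson G k I \<rho> g) (a / 2 ^ k) (b / 2 ^ k)"
    using frame_imp_wilson_riesz[of b a] by (simp add: riesz_basis_bounds_iff wilson_family)
next
  assume "riesz_basis_bounds JW (wilson G k I \<rho> g) (a / 2 ^ k) (b / 2 ^ k)"
  then have r: "0 < a / 2 ^ k" "0 < b / 2 ^ k" "dense_in JW (wil g)" "riesz_seq JW (wil g) (a / 2 ^ k) (b / 2 ^ k)"
    by (auto simp: riesz_basis_bounds_iff)
  have B: "bessel JG (gab g) b" using riesz_imp_frame(1)[OF r] bessel_equiv by blast
  have "a * (norm x)\<^sup>2 \<le> frame_energy JG (gab g) x" for x
    using riesz_imp_frame(2)[OF r, of x] energy_eq[OF B, of x] by (simp add: field_simps)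
  then show "frame_bounds JG (gabor g) a b"
    using r B by (simp add: frame_bounds_iff gabor_family gL2 zero_less_divide_iff)
qed

lemma tight_equiv:
  "tight_frame_bound JG (gabor g) (2 ^ k) \<longleftrightarrow> orthonormal_basis JW (wilson G k I \<rho> g)"
  using frame_equiv[of "2 ^ k" "2 ^ k"]
  by (simp add: tight_frame_bound_def riesz_basis_bounds_iff orthonormal_basis_iff)

text \<open>An operator on functions is obtained from the one on classes by choosing representatives
  with \<open>rep\<close>; \<open>frame_operator_unique\<close> shows that any other choice has the
  same classes as values.\<close>

lemma frame_operator_exists:
  assumes "L2_family J \<phi>" "bessel J (\<lambda>j. cls (\<phi> j)) b" "0 \<le> b"
  shows "\<exists>S. is_frame_operator J \<phi> S"
  using frame_op_has_sum[OF assms(2,3)]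
  by (intro exI[of _ "\<lambda>f. rep (frame_op J (\<lambda>j. cls (\<phi> j)) (cls f))"])
    (simp add: is_frame_operator_iff[OF assms(1)])

lemma frame_operator_unique:
  assumes "L2_family J \<phi>" "bessel J (\<lambda>j. cls (\<phi> j)) b" "0 \<le> b" "is_frame_operator J \<phi> S" "f \<in> L2"
  shows "S f \<in> L2" "cls (S f) = frame_op J (\<lambda>j. cls (\<phi> j)) (cls f)"
proof -
  have S: "S f \<in> L2" "((\<lambda>j. cinner (cls f) (cls (\<phi> j)) *\<^sub>C cls (\<phi> j)) has_sum cls (S f)) J"
    using assms(4,5) by (auto simp: is_frame_operator_iff[OF assms(1)])
  show "S f \<in> L2" by (rule S)
  show "cls (S f) = frame_op J (\<lambda>j. cls (\<phi> j)) (cls f)"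
    by (rule has_sum_unique[OF S(2) frame_op_has_sum[OF assms(2,3)]])
qed

lemma frame_operators:
  assumes B: "bessel_bound JG (gabor g) b"
  shows "\<exists>S. is_frame_operator JG (gabor g) S"
    "\<exists>S. is_frame_operator JW (wilson G k I \<rho> g) S"
    "is_frame_operator JG (gabor g) S\<^sub>G \<Longrightarrow> is_frame_operator JW (wilson G k I \<rho> g) S\<^sub>W \<Longrightarrow> f \<in> L2 \<Longrightarrow>
       AE x in lborel. S\<^sub>G f x = 2 ^ k * S\<^sub>W f x"
proof -
  have B': "bessel JG (gab g) b" using B by (simp add: bessel_bound_iff)
  have W: "bessel JW (wil g) (b / 2 ^ k)" using B' bessel_equiv by blast
  note fG = gabor_family[OF gL2] and bG = bessel_nonneg[OF B'] and bW = bessel_nonneg[OF W]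
  show "\<exists>S. is_frame_operator JG (gabor g) S"
    by (rule frame_operator_exists[OF fG B' bG])
  show "\<exists>S. is_frame_operator JW (wilson G k I \<rho> g) S"
    by (rule frame_operator_exists[OF wilson_family W bW])
  assume SG: "is_frame_operator JG (gabor g) S\<^sub>G" and SW: "is_frame_operator JW (wilson G k I \<rho> g) S\<^sub>W"
    and f: "f \<in> L2"
  note G' = frame_operator_unique[OF fG B' bG SG f] and W' = frame_operator_unique[OF wilson_family W bW SW f]
  have "cls (S\<^sub>G f) = cls (\<lambda>x. of_real (2 ^ k) * S\<^sub>W f x)"
    using frame_op_eq[OF B', of "cls f"] by (simp only: G'(2) W'(2)[symmetric] cls_scaleR[OF W'(1)])
  then show "AE x in lborel. S\<^sub>G f x = 2 ^ k * S\<^sub>W f x"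
    using G'(1) W'(1) by (simp add: cls_eq_iff)
qed

end

theorem theorem4p5:
  fixes G :: "(bit ^ 'd) set" and k :: nat and s :: "nat \<Rightarrow> bit ^ 'd"
    and I :: "bit ^ 'd \<Rightarrow> (int ^ 'd) set" and \<rho> :: "(int ^ 'd) set \<Rightarrow> int ^ 'd"
    and g ghat :: "real ^ 'd \<Rightarrow> complex" and N :: "(int ^ 'd) set"
  defines "JG \<equiv> gabor_index G"
    and "JW \<equiv> wilson_index G k I \<rho> g N"
    and "\<G> \<equiv> gabor g"
    and "\<W> \<equiv> wilson G k I \<rho> g"
  assumes "separable_group G k s"
    and "is_dual_iso G k s I"
    and "\<forall>c\<in>carrier (dual_group G). \<rho> c \<in> c"
    and "g \<in> L2"
    and "\<forall>x :: int ^ 'd. card (N \<inter> orbit G x) = 1"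
    and "\<exists>g'. separable_fun k s g' \<and> (AE x in lborel. g x = g' x)"
    and "has_fourier_L2 g ghat"
    and "AE \<omega> in lborel. ghat \<omega> = cnj (ghat \<omega>)"
  shows "(\<forall>b. (bessel_bound JG \<G> b \<longleftrightarrow> bessel_bound JW \<W> (b / 2 ^ k)) \<and>
            (bessel_bound JG \<G> b \<or> bessel_bound JW \<W> (b / 2 ^ k) \<longrightarrow>
               (\<exists>S\<^sub>G. is_frame_operator JG \<G> S\<^sub>G) \<and> (\<exists>S\<^sub>W. is_frame_operator JW \<W> S\<^sub>W) \<and>
               (\<forall>S\<^sub>G S\<^sub>W. is_frame_operator JG \<G> S\<^sub>G \<longrightarrow> is_frame_operator JW \<W> S\<^sub>W \<longrightarrow>
                  (\<forall>f\<in>L2. AE x in lborel. S\<^sub>G f x = 2 ^ k * S\<^sub>W f x))))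
       \<and> (\<forall>a b. frame_bounds JG \<G> a b \<longleftrightarrow> riesz_basis_bounds JW \<W> (a / 2 ^ k) (b / 2 ^ k))
       \<and> (tight_frame_bound JG \<G> (2 ^ k) \<longleftrightarrow> orthonormal_basis JW \<W>)"
proof -
  interpret wilson_system G k s I \<rho> g N
    by (intro wilson_system.intro assms real_fourier_imp_hermitian[OF assms(11,12)])
  have bess: "bessel_bound JG \<G> b \<longleftrightarrow> bessel_bound JW \<W> (b / 2 ^ k)" for b
    using bessel_equiv[of b] gabor_family[OF gL2] wilson_family
    by (simp add: bessel_bound_iff JG_def JW_def \<G>_def \<W>_def)
  have ops: "(\<exists>S\<^sub>G. is_frame_operator JG \<G> S\<^sub>G) \<and> (\<exists>S\<^sub>W. is_frame_operator JW \<W> S\<^sub>W) \<and>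
      (\<forall>S\<^sub>G S\<^sub>W. is_frame_operator JG \<G> S\<^sub>G \<longrightarrow> is_frame_operator JW \<W> S\<^sub>W \<longrightarrow>
         (\<forall>f\<in>L2. AE x in lborel. S\<^sub>G f x = 2 ^ k * S\<^sub>W f x))"
    if "bessel_bound JG \<G> b" for b
    using frame_operators[of b] that unfolding JG_def JW_def \<G>_def \<W>_def by blast
  have "frame_bounds JG \<G> a b \<longleftrightarrow> riesz_basis_bounds JW \<W> (a / 2 ^ k) (b / 2 ^ k)" for a b
    using frame_equiv[of a b] by (simp add: JG_def JW_def \<G>_def \<W>_def)
  moreover have "tight_frame_bound JG \<G> (2 ^ k) \<longleftrightarrow> orthonormal_basis JW \<W>"
    using tight_equiv by (simp add: JG_def JW_def \<G>_def \<W>_def)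
  ultimately show ?thesis using bess ops by blast
qed

end
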